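(* Let $n\ge 3$, let $\Omega\subset\mathbf{R}^n$ be a domain with $C^1$ boundary, and let $b\in\Omega$. For every $\alpha\in(0,1)$ and every $K\ge1$ there is a constant $M=M(\alpha,b,K,\Omega)$, depending only on $\alpha$, $b$, $K$ and $\Omega$, such that every $K$-quasiconformal harmonic mapping $f:\mathbf{B}\to\Omega$ which is Lipschitz continuous in $\mathbf{B}$ and satisfies $f(0)=b$ is $\alpha$-H\"older continuous with H\"older coefficient $M$, i.e. \[ |f(x)-f(y)|\le M|x-y|^{\alpha}\quad\text{for all } x,y\in\mathbf{B}. \]
   Context: Notation: $\mathbf{B}=\{x\in\mathbf{R}^n:|x|<1\}$ is the open unit ball, with the Euclidean norm. $C^1$ boundary: a domain $\Omega\subset\mathbf{R}^n$ has $C^1$ boundary if there is a $C^1$ diffeomorphism (up to the boundary) $\Phi:\overline{\mathbf{B}}\to\overline{\Omega}$. Harmonic mapping: $f=(f_1,\dots,f_n):U\to\mathbf{R}^n$ is harmonic in a domain $U$ if each $f_j$ is a real-valued harmonic function, $\Delta f_j=0$ in $U$. Quasiconformal mapping: for domains $U,V\subset\mathbf{R}^n$ and $K\ge1$, a homeomorphism $f:U\to V$ (onto $V$) is $K$-quasiconformal if $f$ is absolutely continuous on lines (i.e. absolutely continuous on almost every segment parallel to one of the coordinate axes, with partial derivatives that exist and are locally $L^n$-integrable in $U$) and $|\nabla f(x)|\le K\, l(\nabla f(x))$ for all $x\in U$, where $|\nabla f(x)|=\sup\{|f'(x)h|:|h|=1\}$ and $l(\nabla f(x))=\inf\{|f'(x)h|:|h|=1\}$.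 (Harmonic mappings are smooth, so $f'(x)$ exists at every point.) The Lipschitz constant of $f$ is not prescribed, and $M$ does not depend on it. *)

theory Defs
  imports "HOL-Analysis.Analysis"
begin

(* Derivatives are taken within S, so that S may be a closed region: this is C^1 smoothness up to
   the boundary.  For open S it is ordinary C^1 smoothness. *)
definition C1_on :: "'a::real_normed_vector set \<Rightarrow> ('a \<Rightarrow> 'b::real_normed_vector) \<Rightarrow> bool" where
  "C1_on S f \<longleftrightarrow>
     (\<exists>f' :: 'a \<Rightarrow> 'a \<Rightarrow>\<^sub>L 'b.
        (\<forall>x\<in>S. (f has_derivative blinfun_apply (f' x)) (at x within S)) \<and> continuous_on S f')"

definition C2_on :: "'a::real_normed_vector set \<Rightarrow> ('a \<Rightarrow> 'b::real_normed_vector) \<Rightarrow> bool" where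
  "C2_on S f \<longleftrightarrow>
     (\<exists>f' :: 'a \<Rightarrow> 'a \<Rightarrow>\<^sub>L 'b.
        (\<forall>x\<in>S. (f has_derivative blinfun_apply (f' x)) (at x within S)) \<and> C1_on S f')"

definition C1_diffeomorphism ::
    "'a::real_normed_vector set \<Rightarrow> 'b::real_normed_vector set \<Rightarrow> ('a \<Rightarrow> 'b) \<Rightarrow> ('b \<Rightarrow> 'a) \<Rightarrow> bool" where
  "C1_diffeomorphism S T \<Phi> \<Psi> \<longleftrightarrow> homeomorphism S T \<Phi> \<Psi> \<and> C1_on S \<Phi> \<and> C1_on T \<Psi>"

(* A diffeomorphism of B onto Omega that is C^1 up to the boundary together with its inverse.
   The clause on the image of the open ball is not redundant: without it, the ball with its centre
   removed would qualify, its closure being the closed ball. *)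
definition has_C1_boundary :: "'a::real_normed_vector set \<Rightarrow> bool" where
  "has_C1_boundary \<Omega> \<longleftrightarrow>
     (\<exists>\<Phi> \<Psi>. C1_diffeomorphism (cball (0::'a) 1) (closure \<Omega>) \<Phi> \<Psi> \<and> \<Phi> ` ball 0 1 = \<Omega>)"

definition partial_deriv ::
    "'n \<Rightarrow> (real^'n \<Rightarrow> 'b::real_normed_vector) \<Rightarrow> real^'n \<Rightarrow> 'b" where
  "partial_deriv i f x = vector_derivative (\<lambda>t. f (x + t *\<^sub>R axis i 1)) (at 0)"

definition laplacian :: "(real^'n \<Rightarrow> real) \<Rightarrow> real^'n \<Rightarrow> real" where
  "laplacian u x = (\<Sum>i\<in>UNIV. partial_deriv i (partial_deriv i u) x)"

definition harmonic_function_on :: "(real^'n) set \<Rightarrow> (real^'n \<Rightarrow> real) \<Rightarrow> bool" where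
  "harmonic_function_on U u \<longleftrightarrow> C2_on U u \<and> (\<forall>x\<in>U. laplacian u x = 0)"

definition harmonic_mapping_on :: "(real^'n) set \<Rightarrow> (real^'n \<Rightarrow> real^'n) \<Rightarrow> bool" where
  "harmonic_mapping_on U f \<longleftrightarrow> (\<forall>j. harmonic_function_on U (\<lambda>x. f x $ j))"

(* I is a finite family of non-overlapping intervals [s,t], each encoded as the pair (s,t). *)
definition abs_continuous_on_interval ::
    "real \<Rightarrow> real \<Rightarrow> (real \<Rightarrow> 'b::real_normed_vector) \<Rightarrow> bool" where
  "abs_continuous_on_interval a b g \<longleftrightarrow>
     (\<forall>\<epsilon>>0. \<exists>\<delta>>0. \<forall>I :: (real \<times> real) set.
        finite I \<and> (\<forall>(s, t)\<in>I. a \<le> s \<and> s \<le> t \<and> t \<le> b) \<and>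
        disjoint_family_on (\<lambda>(s, t). {s<..<t}) I \<and> (\<Sum>(s, t)\<in>I. t - s) < \<delta>
        \<longrightarrow> (\<Sum>(s, t)\<in>I. norm (g t - g s)) < \<epsilon>)"

(* Absolute continuity on lines, with partial derivatives in L^n_loc.  Almost every segment of a box
   parallel to the i-th axis is meant with respect to (n-1)-dimensional Lebesgue measure in the
   coordinates other than i; a point z of that space gives the segment
   t \<mapsto> (z with i-th coordinate t). *)
definition ACL_on :: "(real^'n) set \<Rightarrow> (real^'n \<Rightarrow> real^'n) \<Rightarrow> bool" where
  "ACL_on U f \<longleftrightarrow>
     (\<forall>i a b. cbox a b \<subseteq> U \<longrightarrow>
        (AE z in (\<Pi>\<^sub>M j\<in>UNIV - {i}. (lborel :: real measure)).
           (\<forall>j. j \<noteq> i \<longrightarrow> a $ j \<le> z j \<and> z j \<le> b $ j) \<longrightarrow>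
           abs_continuous_on_interval (a $ i) (b $ i)
             (\<lambda>t. f (\<chi> j. if j = i then t else z j)))) \<and>
     (\<forall>i. (AE x in lebesgue_on U. (\<lambda>t. f (x + t *\<^sub>R axis i 1)) differentiable (at 0)) \<and>
        partial_deriv i f \<in> borel_measurable (lebesgue_on U) \<and>
        (\<forall>C. compact C \<and> C \<subseteq> U \<longrightarrow>
           set_integrable lebesgue C (\<lambda>x. norm (partial_deriv i f x) ^ CARD('n))))"

(* |A| and l(A) of a linear map A *)
definition max_stretch :: "(real^'n \<Rightarrow> real^'n) \<Rightarrow> real" where
  "max_stretch A = (SUP h\<in>sphere 0 1. norm (A h))"

definition min_stretch :: "(real^'n \<Rightarrow> real^'n) \<Rightarrow> real" where
  "min_stretch A = (INF h\<in>sphere 0 1. norm (A h))"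

(* The distortion inequality is required at every point of U, hence so is differentiability. *)
definition quasiconformal ::
    "real \<Rightarrow> (real^'n) set \<Rightarrow> (real^'n) set \<Rightarrow> (real^'n \<Rightarrow> real^'n) \<Rightarrow> bool" where
  "quasiconformal K U V f \<longleftrightarrow>
     (\<exists>g. homeomorphism U V f g) \<and> ACL_on U f \<and>
     (\<forall>x\<in>U. f differentiable (at x) \<and>
        max_stretch (frechet_derivative f (at x)) \<le> K * min_stretch (frechet_derivative f (at x)))"

end

theory Submission
  imports Defs
begin

text \<open>
  Write \<open>G x\<close> for the operator norm of the derivative of \<open>f\<close> at \<open>x\<close> and \<open>\<delta>(x) = 1 - |x|\<close>.
  A bound \<open>\<delta>(x) powr (1 - \<alpha>) * G x \<le> N\<close> on the ball implies Hoelder continuity with exponent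
  \<open>\<alpha>\<close> and coefficient \<open>(2/\<alpha> + 1) * N\<close> (\<open>holder_of_gradient\<close>). Since \<open>f\<close> is Lipschitz, the
  supremum \<open>N\<close> of the left hand side is finite, and the task is to bound it independently of the
  Lipschitz constant. Take a point \<open>x\<close> at which at least half of the supremum is attained, and put
  \<open>d = \<delta>(x)\<close>. If \<open>d\<close> is bounded below, then so is everything: the gradient of a bounded harmonic
  function is at most a constant times its bound divided by \<open>d\<close>. So the point is to exclude small \<open>d\<close>.

  For small \<open>d\<close> let \<open>a = x/|x|\<close> and \<open>q = f(a)\<close>. As the boundary of \<open>\<Omega>\<close> is \<open>C\<^sup>1\<close>, it is flat near \<open>q\<close>: for a
  unit normal \<open>v\<close> the harmonic function \<open>u = (f - q) \<bullet> v\<close> satisfies \<open>|u| \<le> \<epsilon> |f - q|\<close> at those boundary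
  points of the ball that \<open>f\<close> maps close to \<open>q\<close>. By the Hoelder estimate with coefficient \<open>N\<close>, the
  boundary values of \<open>u\<close> are then at most \<open>\<epsilon> N |w - a| powr \<alpha>\<close> for \<open>w\<close> near \<open>a\<close>, and at most
  \<open>N |w - a| powr \<alpha>\<close> for \<open>w\<close> farther than \<open>R = d/\<epsilon>\<^sub>0\<close> from \<open>a\<close>. Comparison with explicit
  superharmonic barriers (\<open>harmonic_le_barrier\<close>) gives \<open>|u| \<le> small * N * d powr \<alpha>\<close> near \<open>x\<close>, hence
  a small bound for the gradient of \<open>u\<close> at \<open>x\<close>. Quasiconformality makes the gradient of the single
  component \<open>u\<close> comparable with \<open>G x\<close>, so \<open>d powr (1 - \<alpha>) * G x\<close> is at most a small multiple of \<open>N\<close>,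
  against the choice of \<open>x\<close> (\<open>extremal_point_contradiction\<close>).

  That argument needs \<open>f\<close> to map all boundary points within distance \<open>R\<close> of \<open>a\<close> close to \<open>q\<close>. Again by
  the extremality of \<open>x\<close>, the distances are at most a constant times \<open>N * d powr \<alpha>\<close>, that is, a constant times
  \<open>d * G x\<close>. So it suffices that \<open>d * G x\<close> tends to zero with \<open>d\<close>, uniformly
  over all admissible \<open>f\<close> (\<open>conformal_scale_small\<close>). This is a capacity argument. If \<open>d * G x\<close> is
  not small, the image of the ball of radius \<open>d/2\<close> around \<open>x\<close> contains a ball of fixed radius.
  So does the image of the ball of radius \<open>3/4\<close> around the origin, because \<open>f(0) = b\<close> keeps a fixed distance
  from the boundary. Consider the function \<open>ln (|z - x|\<^sup>2 + d\<^sup>2)\<close> transported to \<open>\<Omega>\<close> by the inverse of \<open>f\<close>.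
  Between the two image balls it increases by about \<open>2 ln (1/d)\<close>, while its energy is of the order
  \<open>ln (1/d)\<close>; integration along parallel segments joining the two balls bounds \<open>d\<close> from
  below (\<open>separation_inequality\<close>). The inverse is not differentiable at images of critical points of
  \<open>f\<close>. As \<open>f\<close> is quadratic there, these images are so small that almost every segment in a given direction
  avoids them; this is where the dimension is at least three (\<open>negligible_shadow\<close>).

  The only tool from the theory of harmonic functions is the maximum principle; the interior
  gradient estimate follows from it by comparing a function with its reflection in a coordinate
  hyperplane (\<open>harmonic_partial_le\<close>).
\<close>

section \<open>Change of variables for norm bounds on the derivative\<close>

text \<open>
  The change of variables theorem is stated for well-ordered index types. This copy of an initial
  segment of the natural numbers provides such a type with the cardinality of an arbitrary finite one.
\<close>

typedef (overloaded) 'n ordered_index = "{..<CARD('n::finite)}"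
  by (rule exI[of _ 0]) simp

instantiation ordered_index :: (finite) linorder
begin
definition "i \<le> j \<longleftrightarrow> Rep_ordered_index i \<le> Rep_ordered_index j"
definition "i < j \<longleftrightarrow> Rep_ordered_index i < Rep_ordered_index j"
instance
  by standard
    (auto simp: less_eq_ordered_index_def less_ordered_index_def Rep_ordered_index_inject)
end

instance ordered_index :: (finite) finite
proof
  have "UNIV = (Abs_ordered_index :: nat \<Rightarrow> 'a ordered_index) ` {..<CARD('a)}"
    using type_definition.Abs_image[OF type_definition_ordered_index] by metis
  then show "finite (UNIV :: 'a ordered_index set)" by (metis finite_imageI finite_lessThan)
qed

instance ordered_index :: (finite) wellorder
proof
  fix P :: "'a ordered_index \<Rightarrow> bool" and a
  assume *: "\<And>x. (\<And>y. y < x \<Longrightarrow> P y) \<Longrightarrow> P x"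
  show "P a"
    by (induction a rule: measure_induct_rule[of Rep_ordered_index])
       (metis * less_ordered_index_def)
qed

lemma card_ordered_index: "CARD('n::finite ordered_index) = CARD('n)"
  using type_definition.card[OF type_definition_ordered_index[where 'n='n]] by simp

text \<open>Renaming coordinates is an isometry of Euclidean spaces that preserves
  Lebesgue measure, so estimates that mention only norms and integrals can be moved between
  different index types.\<close>

lemma exists_reindexing:
  "\<exists>(T :: real^'n \<Rightarrow> real^'n::finite ordered_index) U. linear T \<and> linear U \<and> (\<forall>x. U (T x) = x) \<and> (\<forall>y. T (U y) = y)
     \<and> (\<forall>x. norm (T x) = norm x) \<and> (\<forall>y. norm (U y) = norm y) \<and> lborel = distr lborel borel T"
proof -
  obtain e where e: "bij_betw e (UNIV :: 'n ordered_index set) (UNIV :: 'n set)"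
    using finite_same_card_bij[of "UNIV :: 'n ordered_index set" "UNIV :: 'n set"]
    by (auto simp: card_ordered_index)
  define T where "T x = (\<chi> i. x $ e i)" for x :: "real^'n"
  define U where "U y = (\<chi> j. y $ inv e j)" for y :: "real^'n ordered_index"
  have ei: "inv e (e i) = i" "e (inv e j) = j" for i j
    using e by (simp_all add: bij_betw_def surj_f_inv_f)
  have UT: "U (T x) = x" and TU: "T (U y) = y" for x y
    by (simp_all add: T_def U_def ei vec_eq_iff)
  have lT: "linear T" and lU: "linear U"
    by (auto intro!: linearI simp: T_def U_def vec_eq_iff)
  have nT: "norm (T x) = norm x" for x
    unfolding norm_vec_def L2_set_def T_def
    using sum.reindex_bij_betw[OF e, of "\<lambda>j. (norm (x $ j))\<^sup>2"] by simp
  have nU: "norm (U y) = norm y" for y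
    using nT[of "U y"] by (simp add: TU)
  have prodB: "(\<Prod>b\<in>Basis. g b) = (\<Prod>i\<in>UNIV. g (axis i 1))" for g :: "real^'m::finite \<Rightarrow> real"
    unfolding Basis_vec_def
    by (simp, subst prod.UNION_disjoint) (auto simp: axis_eq_axis)
  have "lborel = distr lborel borel T"
  proof (rule lborel_eqI)
    fix l u :: "real^'n ordered_index"
    assume lu: "\<And>b. b \<in> Basis \<Longrightarrow> l \<bullet> b \<le> u \<bullet> b"
    have lu': "l $ i \<le> u $ i" for i
      using lu[of "axis i 1"] by (simp add: inner_axis)
    have Tm: "T \<in> borel_measurable borel"
      by (intro borel_measurable_continuous_onI linear_continuous_on) (simp add: lT linear_conv_bounded_linear[symmetric])
    have vi: "T -` box l u = box (U l) (U u)"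
    proof -
      have "(\<forall>i. l $ i < x $ e i \<and> x $ e i < u $ i) \<longleftrightarrow> (\<forall>j. l $ inv e j < x $ j \<and> x $ j < u $ inv e j)" for x
        by (metis ei)
      then show ?thesis by (auto simp: mem_box_cart T_def U_def)
    qed
    have "emeasure (distr lborel borel T) (box l u) = emeasure lborel (box (U l) (U u))"
      using Tm by (subst emeasure_distr) (auto simp: vi)
    also have "\<dots> = (\<Prod>b\<in>Basis. (U u - U l) \<bullet> b)"
      by (rule emeasure_lborel_box) (auto simp: Basis_vec_def inner_axis U_def lu')
    also have "(\<Prod>b\<in>Basis. (U u - U l) \<bullet> b) = (\<Prod>j\<in>UNIV. (u - l) $ inv e j)"
      by (simp add: prodB inner_axis U_def)
    also have "\<dots> = (\<Prod>i\<in>UNIV. (u - l) $ i)"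
      using prod.reindex_bij_betw[OF e, of "\<lambda>j. (u - l) $ inv e j"] by (simp add: ei)
    also have "\<dots> = (\<Prod>b\<in>Basis. (u - l) \<bullet> b)"
      by (simp add: prodB inner_axis)
    finally show "emeasure (distr lborel borel T) (box l u) = (\<Prod>b\<in>Basis. (u - l) \<bullet> b)" .
  qed simp
  then show ?thesis using lT lU UT TU nT nU by blast
qed

lemma det_le_norm_bound:
  fixes A :: "real^'n::finite \<Rightarrow> real^'n"
  assumes "linear A" and b: "\<And>h. norm (A h) \<le> a * norm h"
  shows "\<bar>det (matrix A)\<bar> \<le> fact CARD('n) * a ^ CARD('n)"
proof -
  have ent: "\<bar>matrix A $ i $ j\<bar> \<le> a" for i j
    using b[of "axis j 1"] component_le_norm_cart[of "A (axis j 1)" i]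
    by (simp add: matrix_def)
  have a0: "0 \<le> a" using ent by (meson abs_ge_zero order_trans)
  have "\<bar>det (matrix A)\<bar> \<le> (\<Sum>p\<in>{p. p permutes UNIV}. \<bar>of_int (sign p) * (\<Prod>i\<in>UNIV. matrix A $ i $ p i)\<bar>)"
    unfolding det_def by (rule sum_abs)
  also have "\<dots> \<le> (\<Sum>p\<in>{p::'n\<Rightarrow>'n. p permutes UNIV}. a ^ CARD('n))"
  proof (rule sum_mono)
    fix p :: "'n \<Rightarrow> 'n"
    have "\<bar>of_int (sign p) * (\<Prod>i\<in>UNIV. matrix A $ i $ p i)\<bar> = (\<Prod>i\<in>UNIV. \<bar>matrix A $ i $ p i\<bar>)"
      by (simp add: abs_mult abs_prod sign_def)
    also have "\<dots> \<le> (\<Prod>i\<in>(UNIV::'n set). a)"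
      by (rule prod_mono) (simp add: ent)
    finally show "\<bar>of_int (sign p) * (\<Prod>i\<in>UNIV. matrix A $ i $ p i)\<bar> \<le> a ^ CARD('n)" by simp
  qed
  also have "\<dots> = fact CARD('n) * a ^ CARD('n)"
    by (simp add: card_permutations)
  finally show ?thesis .
qed

text \<open>Apply the upper bound to the inverse map.\<close>

lemma det_ge_norm_bound:
  fixes A :: "real^'n::finite \<Rightarrow> real^'n"
  assumes lA: "linear A" and b: "\<And>h. l * norm h \<le> norm (A h)" and l: "0 \<le> l"
  shows "l ^ CARD('n) \<le> fact CARD('n) * \<bar>det (matrix A)\<bar>"
proof (cases "l = 0")
  case False
  then have l: "0 < l" using l by simp
  have inj: "inj A"
  proof (rule injI)
    fix x y assume "A x = A y"
    then have "l * norm (x - y) \<le> 0" using b[of "x - y"] by (simp add: linear_diff[OF lA])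
    then show "x = y" using l by (simp add: mult_le_0_iff)
  qed
  obtain B where B: "linear B" "A \<circ> B = id"
    using linear_surjective_right_inverse[OF lA linear_injective_imp_surjective[OF lA inj]] by auto
  have "norm (B h) \<le> (1/l) * norm h" for h
    using b[of "B h"] B(2) l by (simp add: field_simps fun_eq_iff)
  then have d: "\<bar>det (matrix B)\<bar> \<le> fact CARD('n) * (1/l) ^ CARD('n)"
    by (rule det_le_norm_bound[OF B(1)])
  have "det (matrix A) * det (matrix B) = 1"
    using matrix_compose[OF B(1) lA] B(2) by (metis det_I det_mul matrix_id_mat_1)
  then have "1 = \<bar>det (matrix A)\<bar> * \<bar>det (matrix B)\<bar>" by (metis abs_mult abs_one)
  also have "\<dots> \<le> \<bar>det (matrix A)\<bar> * (fact CARD('n) * (1/l) ^ CARD('n))"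
    by (intro mult_left_mono d) simp
  finally show ?thesis using l by (simp add: field_simps power_divide)
qed (simp add: power_0_left)

text \<open>The integral may be infinite on both sides: absolute integrability
  of the two integrands is equivalent, and in the integrable case the values agree.\<close>

lemma nn_integral_change_of_variables_ordered:
  fixes \<phi> :: "real^'m::{finite,wellorder} \<Rightarrow> real^'m::_" and h :: "real^'m::_ \<Rightarrow> real"
  assumes S: "open S" and im: "\<phi> ` S \<in> sets borel"
    and d: "\<And>x. x \<in> S \<Longrightarrow> (\<phi> has_derivative \<phi>' x) (at x)"
    and inj: "inj_on \<phi> S" and h: "h \<in> borel_measurable borel" and h0: "\<And>y. 0 \<le> h y"
  shows "(\<integral>\<^sup>+y. ennreal (h y) * indicator (\<phi> ` S) y \<partial>lebesgue)
       = (\<integral>\<^sup>+x. ennreal (\<bar>det (matrix (\<phi>' x))\<bar> * h (\<phi> x)) * indicator S x \<partial>lebesgue)"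
    (is "?L = ?R")
proof -
  have Sl: "S \<in> sets lebesgue" using S by auto
  have d': "\<And>x. x \<in> S \<Longrightarrow> (\<phi> has_derivative \<phi>' x) (at x within S)"
    using d has_derivative_at_withinI by blast
  let ?D = "\<lambda>x. \<bar>det (matrix (\<phi>' x))\<bar> * h (\<phi> x)"
  let ?h = "\<lambda>y. vec (h y) :: real^1"
  have iml: "\<phi> ` S \<in> sets lebesgue" using im by auto
  have cont: "continuous_on S \<phi>" using d' by (meson has_derivative_continuous_on)
  have ai: "set_integrable lebesgue A (\<lambda>y. vec (g y) :: real^1) \<longleftrightarrow> set_integrable lebesgue A g" 
    for A and g :: "real^'m::_ \<Rightarrow> real"
    by (subst absolutely_integrable_componentwise_iff) (auto simp: Basis_vec_def inner_axis)
  have iff: "set_integrable lebesgue (\<phi> ` S) h \<longleftrightarrow> set_integrable lebesgue S ?D"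
    using absolutely_integrable_change_of_variables[OF Sl d' inj, of ?h]
    using ai[of "\<phi> ` S" h] ai[of S ?D] by (auto simp: vec_def scaleR_vec_def)
  have eq: "integral (\<phi> ` S) h = integral S ?D" if "set_integrable lebesgue (\<phi> ` S) h"
  proof -
    have "integral (\<phi> ` S) ?h = integral S (\<lambda>x. \<bar>det (matrix (\<phi>' x))\<bar> *\<^sub>R ?h (\<phi> x))"
      using integral_change_of_variables[OF Sl d' inj, of ?h] ai[of "\<phi> ` S" h] that by auto
    moreover have "integral (\<phi> ` S) ?h $ 1 = integral (\<phi> ` S) h"
      using ai[of "\<phi> ` S" h] that
      by (subst integral_component_eq_cart[symmetric]) (auto simp: absolutely_integrable_on_def)
    moreover have "integral S (\<lambda>x. \<bar>det (matrix (\<phi>' x))\<bar> *\<^sub>R ?h (\<phi> x)) $ 1 = integral S ?D"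
      using ai[of S ?D] that iff
      by (subst integral_component_eq_cart[symmetric]) (auto simp: absolutely_integrable_on_def vec_def scaleR_vec_def)
    ultimately show ?thesis by metis
  qed
  have conv: "(\<integral>\<^sup>+y. ennreal (g y) * indicator A y \<partial>lebesgue) = 
       (if set_integrable lebesgue A g then ennreal (integral A g) else \<infinity>)"
    if A: "A \<in> sets lebesgue" and m: "(\<lambda>y. indicator A y * g y) \<in> borel_measurable lebesgue" and g: "\<And>y. 0 \<le> g y"
    for A and g :: "real^'m::_ \<Rightarrow> real"
  proof -
    have e: "ennreal (g y) * indicator A y = ennreal (indicator A y * g y)" for y
      by (simp add: indicator_def)
    show ?thesis
    proof (cases "set_integrable lebesgue A g")
      case True
      then have i: "integrable lebesgue (\<lambda>y. indicator A y * g y)" by (simp add: set_integrable_def)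
      have "integral A g = (LINT y|lebesgue. indicator A y * g y)"
        using set_lebesgue_integral_eq_integral(2)[OF True] by (simp add: set_lebesgue_integral_def)
      then show ?thesis using True nn_integral_eq_integral[OF i] g by (simp add: e)
    next
      case False
      then have "\<not> integrable lebesgue (\<lambda>y. indicator A y * g y)" by (simp add: set_integrable_def)
      then have "\<not> (\<integral>\<^sup>+y. ennreal (norm (indicator A y * g y)) \<partial>lebesgue) < \<infinity>"
        using m by (simp add: integrable_iff_bounded)
      moreover have "norm (indicator A y * g y) = indicator A y * g y" for y
        using g[of y] by simp
      ultimately have "\<not> (\<integral>\<^sup>+y. ennreal (indicator A y * g y) \<partial>lebesgue) < \<infinity>"
        by (simp only: simp_thms)
      then have "(\<integral>\<^sup>+y. ennreal (indicator A y * g y) \<partial>lebesgue) = \<infinity>"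
        by (simp only: infinity_ennreal_def less_top[symmetric] not_not)
      then show ?thesis using False by (simp only: e if_False)
    qed
  qed
  have m1: "(\<lambda>y. indicator (\<phi> ` S) y * h y) \<in> borel_measurable lebesgue"
    by (rule measurable_completion)
       (use h im in \<open>auto intro!: borel_measurable_times borel_measurable_indicator\<close>)
  have m2: "(\<lambda>x. indicator S x * ?D x) \<in> borel_measurable lebesgue"
  proof -
    have "(\<lambda>x. h (\<phi> x)) \<in> borel_measurable (restrict_space borel S)"
      by (rule measurable_compose[OF borel_measurable_continuous_on_restrict[OF cont] h])
    then have "(\<lambda>x. indicator S x * h (\<phi> x)) \<in> borel_measurable borel"
      using borel_measurable_restrict_space_iff[of S borel "\<lambda>x. h (\<phi> x)"] S by simp
    then have a: "(\<lambda>x. indicator S x * h (\<phi> x)) \<in> borel_measurable lebesgue"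
      by (intro measurable_completion) simp
    have "(\<lambda>x. det (matrix (\<phi>' x))) \<in> borel_measurable (lebesgue_on S)"
      by (rule borel_measurable_det_Jacobian[OF Sl d'])
    then have "(\<lambda>x. indicator S x * det (matrix (\<phi>' x))) \<in> borel_measurable lebesgue"
      using borel_measurable_restrict_space_iff[of S lebesgue "\<lambda>x. det (matrix (\<phi>' x))"] Sl by simp
    then have "(\<lambda>x. \<bar>indicator S x * det (matrix (\<phi>' x))\<bar> * (indicator S x * h (\<phi> x))) \<in> borel_measurable lebesgue"
      using a by measurable
    moreover have "\<bar>indicator S x * det (matrix (\<phi>' x))\<bar> * (indicator S x * h (\<phi> x)) = indicator S x * ?D x" for x
      by (simp add: indicator_def)
    ultimately show ?thesis by simp
  qed
  show ?thesis
    using conv[OF iml m1 h0] conv[OF Sl m2] h0 iff eq by simp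
qed


text \<open>The determinant enters later arguments only through the norm of
  the derivative. Two-sided bounds of this kind, with the factor \<open>fact CARD('n)\<close> from the Leibniz
  formula, no longer refer to an ordering of the coordinates.\<close>

lemma nn_integral_norm_change_of_variables:
  fixes \<phi> :: "real^'n \<Rightarrow> real^'n::finite" and h :: "real^'n \<Rightarrow> real"
  assumes S: "open S" and im: "open (\<phi> ` S)"
    and d: "\<And>x. x \<in> S \<Longrightarrow> (\<phi> has_derivative \<phi>' x) (at x)"
    and inj: "inj_on \<phi> S" and h: "h \<in> borel_measurable borel" and h0: "\<And>y. 0 \<le> h y"
  shows nn_integral_image_le:
    "(\<lambda>x. ennreal (a x ^ CARD('n) * h (\<phi> x)) * indicator S x) \<in> borel_measurable borel \<Longrightarrow>
       (\<And>x k. x \<in> S \<Longrightarrow> norm (\<phi>' x k) \<le> a x * norm k) \<Longrightarrow>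
       (\<integral>\<^sup>+y. ennreal (h y) * indicator (\<phi> ` S) y \<partial>lborel)
       \<le> ennreal (fact CARD('n)) * (\<integral>\<^sup>+x. ennreal (a x ^ CARD('n) * h (\<phi> x)) * indicator S x \<partial>lborel)"
    and nn_integral_image_ge:
    "(\<lambda>x. ennreal (l x ^ CARD('n) * h (\<phi> x)) * indicator S x) \<in> borel_measurable borel \<Longrightarrow>
       (\<And>x k. x \<in> S \<Longrightarrow> l x * norm k \<le> norm (\<phi>' x k)) \<Longrightarrow> (\<And>x. 0 \<le> l x) \<Longrightarrow>
       (\<integral>\<^sup>+x. ennreal (l x ^ CARD('n) * h (\<phi> x)) * indicator S x \<partial>lborel)
       \<le> ennreal (fact CARD('n)) * (\<integral>\<^sup>+y. ennreal (h y) * indicator (\<phi> ` S) y \<partial>lborel)"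
proof -
  obtain T :: "real^'n \<Rightarrow> real^'n ordered_index" and U where
    lT: "linear T" and lU: "linear U" and UT: "\<And>x. U (T x) = x" and TU: "\<And>y. T (U y) = y"
    and nT: "\<And>x. norm (T x) = norm x" and nU: "\<And>y. norm (U y) = norm y"
    and dist: "(lborel :: (real^'n ordered_index) measure) = distr lborel borel T"
    using exists_reindexing by metis
  have bT: "bounded_linear T" and bU: "bounded_linear U"
    using lT lU by (simp_all add: linear_conv_bounded_linear)
  have cT: "continuous_on A T" and cU: "continuous_on B U" for A B
    by (simp_all add: bT bU linear_continuous_on)
  have mT: "T \<in> borel_measurable borel" and mU: "U \<in> borel_measurable borel"
    by (simp_all add: borel_measurable_continuous_onI cT cU)
  have imT: "T ` A = U -` A" for A using UT TU by (auto simp: image_iff) metis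
  have trans: "(\<integral>\<^sup>+y. F y \<partial>lebesgue) = (\<integral>\<^sup>+x. F (T x) \<partial>lborel)" if "F \<in> borel_measurable borel" for F
    unfolding nn_integral_completion
    by (subst dist, subst nn_integral_distr) (use mT that in auto)
  define \<psi> where "\<psi> = T \<circ> \<phi> \<circ> U"
  define \<psi>' where "\<psi>' y = T \<circ> \<phi>' (U y) \<circ> U" for y
  have S': "open (T ` S)" unfolding imT by (rule open_vimage[OF S cU])
  have im\<psi>: "\<psi> ` (T ` S) = T ` (\<phi> ` S)" by (auto simp: \<psi>_def UT image_iff)
  have openim: "open (\<psi> ` (T ` S))" unfolding im\<psi> by (subst imT) (rule open_vimage[OF im cU])
  have d': "(\<psi> has_derivative \<psi>' y) (at y)" if "y \<in> T ` S" for y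
  proof -
    have "U y \<in> S" using that UT by auto
    then show ?thesis unfolding \<psi>_def \<psi>'_def
      by (intro diff_chain_at d)
         (use bounded_linear_imp_has_derivative[OF bU] bounded_linear_imp_has_derivative[OF bT] in auto)
  qed
  have inj': "inj_on \<psi> (T ` S)"
    using inj by (auto simp: inj_on_def \<psi>_def UT) (metis UT)
  have CV: "(\<integral>\<^sup>+y. ennreal (h (U y)) * indicator (\<psi> ` (T ` S)) y \<partial>lebesgue)
       = (\<integral>\<^sup>+x. ennreal (\<bar>det (matrix (\<psi>' x))\<bar> * h (U (\<psi> x))) * indicator (T ` S) x \<partial>lebesgue)"
    by (rule nn_integral_change_of_variables_ordered[OF S' _ d' inj'])
       (use openim h0 measurable_compose[OF mU h] in auto)
  have L: "(\<integral>\<^sup>+y. ennreal (h (U y)) * indicator (\<psi> ` (T ` S)) y \<partial>lebesgue)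
       = (\<integral>\<^sup>+y. ennreal (h y) * indicator (\<phi> ` S) y \<partial>lborel)"
  proof (subst trans)
    show "(\<lambda>y. ennreal (h (U y)) * indicator (\<psi> ` (T ` S)) y) \<in> borel_measurable borel"
      by (intro borel_measurable_times_ennreal measurable_compose[OF measurable_compose[OF mU h]]
            borel_measurable_indicator) (use openim in auto)
    have "indicator (\<psi> ` (T ` S)) (T y) = (indicator (\<phi> ` S) y :: ennreal)" for y
      unfolding im\<psi> by (auto simp: indicator_def imT UT)
    then show "(\<integral>\<^sup>+y. ennreal (h (U (T y))) * indicator (\<psi> ` (T ` S)) (T y) \<partial>lborel)
       = (\<integral>\<^sup>+y. ennreal (h y) * indicator (\<phi> ` S) y \<partial>lborel)" by (simp add: UT)
  qed
  note eq = CV[unfolded L]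
  have lin: "linear (\<psi>' y)" if "y \<in> T ` S" for y
    using has_derivative_linear[OF d'[OF that]] .
  have indT: "indicator (T ` S) (T y) = (indicator S y :: ennreal)" for y
    by (auto simp: indicator_def imT UT)
  have pull_back: "(\<integral>\<^sup>+y. c * (F (U y) * indicator (T ` S) y) \<partial>lebesgue) = c * (\<integral>\<^sup>+x. F x * indicator S x \<partial>lborel)"
    if "(\<lambda>x. F x * indicator S x) \<in> borel_measurable borel" for c :: ennreal and F :: "real^'n \<Rightarrow> ennreal"
  proof (subst trans)
    have e: "F (U y) * indicator (T ` S) y = (\<lambda>x. F x * indicator S x) (U y)" for y
      using indT[of "U y"] by (simp add: TU)
    show "(\<lambda>y. c * (F (U y) * indicator (T ` S) y)) \<in> borel_measurable borel"
      unfolding e by (intro borel_measurable_times_ennreal borel_measurable_const measurable_compose[OF mU that])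
    show "(\<integral>\<^sup>+x. c * (F (U (T x)) * indicator (T ` S) (T x)) \<partial>lborel) = c * (\<integral>\<^sup>+x. F x * indicator S x \<partial>lborel)"
      using that by (simp add: UT indT nn_integral_cmult)
  qed
  have \<phi>U: "U (\<psi> y) = \<phi> (U y)" for y by (simp add: \<psi>_def UT)
  show "(\<integral>\<^sup>+y. ennreal (h y) * indicator (\<phi> ` S) y \<partial>lborel)
       \<le> ennreal (fact CARD('n)) * (\<integral>\<^sup>+x. ennreal (a x ^ CARD('n) * h (\<phi> x)) * indicator S x \<partial>lborel)"
    if m: "(\<lambda>x. ennreal (a x ^ CARD('n) * h (\<phi> x)) * indicator S x) \<in> borel_measurable borel"
      and a: "\<And>x k. x \<in> S \<Longrightarrow> norm (\<phi>' x k) \<le> a x * norm k"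
  proof -
    have "ennreal (\<bar>det (matrix (\<psi>' y))\<bar> * h (U (\<psi> y))) \<le> ennreal (fact CARD('n)) * ennreal (a (U y) ^ CARD('n) * h (\<phi> (U y)))"
      if "y \<in> T ` S" for y
    proof -
      have "U y \<in> S" using that UT by auto
      then have "norm (\<psi>' y k) \<le> a (U y) * norm k" for k
        using a[of "U y" "U k"] by (simp add: \<psi>'_def nT nU)
      from det_le_norm_bound[OF lin[OF that] this]
      have "\<bar>det (matrix (\<psi>' y))\<bar> \<le> fact CARD('n) * a (U y) ^ CARD('n)" by (simp add: card_ordered_index)
      then show ?thesis using h0[of "\<phi> (U y)"]
        by (subst ennreal_mult'[symmetric]) (auto intro!: ennreal_leI mult_right_mono simp: mult.assoc[symmetric] \<phi>U)
    qed
    then have "(\<integral>\<^sup>+y. ennreal (\<bar>det (matrix (\<psi>' y))\<bar> * h (U (\<psi> y))) * indicator (T ` S) y \<partial>lebesgue)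
      \<le> (\<integral>\<^sup>+y. ennreal (fact CARD('n)) * (ennreal (a (U y) ^ CARD('n) * h (\<phi> (U y))) * indicator (T ` S) y) \<partial>lebesgue)"
      by (intro nn_integral_mono) (auto simp: indicator_def)
    then show ?thesis unfolding eq pull_back[OF m] .
  qed
  show "(\<integral>\<^sup>+x. ennreal (l x ^ CARD('n) * h (\<phi> x)) * indicator S x \<partial>lborel)
       \<le> ennreal (fact CARD('n)) * (\<integral>\<^sup>+y. ennreal (h y) * indicator (\<phi> ` S) y \<partial>lborel)"
    if m: "(\<lambda>x. ennreal (l x ^ CARD('n) * h (\<phi> x)) * indicator S x) \<in> borel_measurable borel"
      and l: "\<And>x k. x \<in> S \<Longrightarrow> l x * norm k \<le> norm (\<phi>' x k)" and l0: "\<And>x. 0 \<le> l x"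
  proof -
    have pw: "ennreal (l (U y) ^ CARD('n) * h (\<phi> (U y))) \<le> ennreal (fact CARD('n)) * ennreal (\<bar>det (matrix (\<psi>' y))\<bar> * h (U (\<psi> y)))"
      if "y \<in> T ` S" for y
    proof -
      have "U y \<in> S" using that UT by auto
      then have "l (U y) * norm k \<le> norm (\<psi>' y k)" for k
        using l[of "U y" "U k"] by (simp add: \<psi>'_def nT nU)
      from det_ge_norm_bound[OF lin[OF that] this l0]
      have "l (U y) ^ CARD('n) \<le> fact CARD('n) * \<bar>det (matrix (\<psi>' y))\<bar>" by (simp add: card_ordered_index)
      then show ?thesis using h0[of "\<phi> (U y)"]
        by (subst ennreal_mult'[symmetric]) (auto intro!: ennreal_leI mult_right_mono simp: mult.assoc[symmetric] \<phi>U)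
    qed
    define c :: real where "c = 1 / fact CARD('n)"
    have c: "ennreal c * ennreal (fact CARD('n)) = 1"
      by (subst ennreal_mult'[symmetric]) (auto simp: c_def)
    have "ennreal c * ennreal (l (U y) ^ CARD('n) * h (\<phi> (U y))) \<le> ennreal (\<bar>det (matrix (\<psi>' y))\<bar> * h (U (\<psi> y)))"
      if "y \<in> T ` S" for y
      using mult_left_mono[OF pw[OF that], of "ennreal c"] by (simp add: mult.assoc[symmetric] c)
    then have "(\<integral>\<^sup>+y. ennreal c * (ennreal (l (U y) ^ CARD('n) * h (\<phi> (U y))) * indicator (T ` S) y) \<partial>lebesgue)
      \<le> (\<integral>\<^sup>+y. ennreal (\<bar>det (matrix (\<psi>' y))\<bar> * h (U (\<psi> y))) * indicator (T ` S) y \<partial>lebesgue)"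
      by (intro nn_integral_mono) (auto simp: indicator_def)
    then have "ennreal c * (\<integral>\<^sup>+x. ennreal (l x ^ CARD('n) * h (\<phi> x)) * indicator S x \<partial>lborel)
       \<le> (\<integral>\<^sup>+y. ennreal (h y) * indicator (\<phi> ` S) y \<partial>lborel)"
      unfolding eq[symmetric] pull_back[OF m] .
    from mult_left_mono[OF this, of "ennreal (fact CARD('n))"] show ?thesis
      using c[unfolded mult.commute[of "ennreal c"]] by (simp add: mult.assoc[symmetric])
  qed
qed

section \<open>Pointwise Laplacian and the maximum principle\<close>

text \<open>Second derivatives along the coordinate lines through a single point are all that
  the maximum principle needs. A predicate, rather than a value, records that they exist.\<close>

definition has_laplacian :: "(real^'n \<Rightarrow> real) \<Rightarrow> real \<Rightarrow> real^'n \<Rightarrow> bool" where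
  "has_laplacian u l x \<longleftrightarrow>
     (\<exists>g gg. (\<forall>i. (\<forall>\<^sub>F t in nhds 0. ((\<lambda>t. u (x + t *\<^sub>R axis i 1)) has_real_derivative g i t) (at t))
                \<and> (g i has_real_derivative gg i) (at 0)) \<and> l = (\<Sum>i\<in>UNIV. gg i))"

lemma has_laplacianI:
  assumes "\<And>i. \<forall>\<^sub>F t in nhds 0. ((\<lambda>t. u (x + t *\<^sub>R axis i 1)) has_real_derivative g i t) (at t)"
    and "\<And>i. (g i has_real_derivative gg i) (at 0)" and "l = (\<Sum>i\<in>UNIV. gg i)"
  shows "has_laplacian u l x"
  unfolding has_laplacian_def using assms by blast

lemma has_laplacian_add:
  assumes "has_laplacian u k x" "has_laplacian v l x"
  shows "has_laplacian (\<lambda>z. u z + v z) (k + l) x"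
proof -
  obtain g gg where g: "\<And>i. \<forall>\<^sub>F t in nhds 0. ((\<lambda>t. u (x + t *\<^sub>R axis i 1)) has_real_derivative g i t) (at t)"
    "\<And>i. (g i has_real_derivative gg i) (at 0)" "k = (\<Sum>i\<in>UNIV. gg i)"
    using assms(1) unfolding has_laplacian_def by blast
  obtain h hh where h: "\<And>i. \<forall>\<^sub>F t in nhds 0. ((\<lambda>t. v (x + t *\<^sub>R axis i 1)) has_real_derivative h i t) (at t)"
    "\<And>i. (h i has_real_derivative hh i) (at 0)" "l = (\<Sum>i\<in>UNIV. hh i)"
    using assms(2) unfolding has_laplacian_def by blast
  show ?thesis
  proof (rule has_laplacianI[where g = "\<lambda>i t. g i t + h i t" and gg = "\<lambda>i. gg i + hh i"])
    show "\<forall>\<^sub>F t in nhds 0. ((\<lambda>t. u (x + t *\<^sub>R axis i 1) + v (x + t *\<^sub>R axis i 1)) has_real_derivative g i t + h i t) (at t)" for i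
      using g(1)[of i] h(1)[of i] by eventually_elim (rule DERIV_add)
    show "((\<lambda>t. g i t + h i t) has_real_derivative gg i + hh i) (at 0)" for i
      by (rule DERIV_add[OF g(2) h(2)])
  qed (simp add: g(3) h(3) sum.distrib)
qed

lemma has_laplacian_cmult:
  assumes "has_laplacian u k x"
  shows "has_laplacian (\<lambda>z. c * u z) (c * k) x"
proof -
  obtain g gg where g: "\<And>i. \<forall>\<^sub>F t in nhds 0. ((\<lambda>t. u (x + t *\<^sub>R axis i 1)) has_real_derivative g i t) (at t)"
    "\<And>i. (g i has_real_derivative gg i) (at 0)" "k = (\<Sum>i\<in>UNIV. gg i)"
    using assms(1) unfolding has_laplacian_def by blast
  show ?thesis
  proof (rule has_laplacianI[where g = "\<lambda>i t. c * g i t" and gg = "\<lambda>i. c * gg i"])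
    show "\<forall>\<^sub>F t in nhds 0. ((\<lambda>t. c * u (x + t *\<^sub>R axis i 1)) has_real_derivative c * g i t) (at t)" for i
      using g(1)[of i] by eventually_elim (rule DERIV_cmult)
    show "((\<lambda>t. c * g i t) has_real_derivative c * gg i) (at 0)" for i
      by (rule DERIV_cmult[OF g(2)])
  qed (simp add: g(3) sum_distrib_left)
qed

lemma has_laplacian_const: "has_laplacian (\<lambda>z. c) 0 x"
  by (rule has_laplacianI[where g = "\<lambda>i t. 0" and gg = "\<lambda>i. 0"]) (auto intro: always_eventually)

lemma has_laplacian_uminus: "has_laplacian u k x \<Longrightarrow> has_laplacian (\<lambda>z. - u z) (- k) x"
  using has_laplacian_cmult[of u k x "-1"] by simp

lemma has_laplacian_diff:
  "has_laplacian u k x \<Longrightarrow> has_laplacian v l x \<Longrightarrow> has_laplacian (\<lambda>z. u z - v z) (k - l) x"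
  using has_laplacian_add[of u k x "\<lambda>z. - v z" "- l"] has_laplacian_uminus[of v l x] by simp

lemma has_laplacian_sum:
  assumes "finite J" "\<And>j. j \<in> J \<Longrightarrow> has_laplacian (u j) (k j) x"
  shows "has_laplacian (\<lambda>z. \<Sum>j\<in>J. u j z) (\<Sum>j\<in>J. k j) x"
  using assms by (induction J) (auto intro: has_laplacian_add has_laplacian_const)

lemma has_laplacian_translate:
  assumes "has_laplacian u k (x + h)"
  shows "has_laplacian (\<lambda>z. u (z + h)) k x"
proof -
  have eq: "x + t *\<^sub>R axis i 1 + h = x + h + t *\<^sub>R axis i 1" for t i by simp
  show ?thesis using assms by (simp only: has_laplacian_def eq)
qed

text \<open>Quadratic polynomials, the auxiliary functions in the maximum principle and
  in the gradient estimate, have explicit restrictions to coordinate lines.\<close>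

lemma has_laplacian_line_quadratic:
  assumes "\<And>i t. u (x + t *\<^sub>R axis i 1) = u x + a i * t + b i * t\<^sup>2"
  shows "has_laplacian u (\<Sum>i\<in>UNIV. 2 * b i) x"
  by (rule has_laplacianI[where g = "\<lambda>i t. a i + b i * (2 * t)" and gg = "\<lambda>i. 2 * b i"])
     (auto intro!: always_eventually derivative_eq_intros simp: assms)

definition reflect :: "'n \<Rightarrow> real^'n \<Rightarrow> real^'n" where
  "reflect i z = z - (2 * z $ i) *\<^sub>R axis i 1"

lemma has_laplacian_reflect:
  assumes "has_laplacian u k (reflect i x)"
  shows "has_laplacian (\<lambda>z. u (reflect i z)) k x"
proof -
  obtain g gg where g: "\<And>j. \<forall>\<^sub>F t in nhds 0. ((\<lambda>t. u (reflect i x + t *\<^sub>R axis j 1)) has_real_derivative g j t) (at t)"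
    "\<And>j. (g j has_real_derivative gg j) (at 0)" "k = (\<Sum>j\<in>UNIV. gg j)"
    using assms(1) unfolding has_laplacian_def by blast
  have r1: "reflect i (x + t *\<^sub>R axis j 1) = reflect i x + t *\<^sub>R axis j 1" if "j \<noteq> i" for j t
    using that by (simp add: reflect_def axis_def)
  have r2: "reflect i (x + t *\<^sub>R axis i 1) = reflect i x + (- t) *\<^sub>R axis i 1" for t
    by (simp add: reflect_def vec_eq_iff axis_def algebra_simps)
  show ?thesis
  proof (rule has_laplacianI[where g = "\<lambda>j t. if j = i then - g j (- t) else g j t" and gg = gg])
    fix j
    show "\<forall>\<^sub>F t in nhds 0. ((\<lambda>t. u (reflect i (x + t *\<^sub>R axis j 1))) has_real_derivative 
             (if j = i then - g j (- t) else g j t)) (at t)"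
    proof (cases "j = i")
      case True
      have "filterlim (\<lambda>t::real. - t) (nhds 0) (nhds 0)"
        using tendsto_minus[OF filterlim_ident[of "nhds (0::real)"]] by simp
      then have "\<forall>\<^sub>F t in nhds 0. ((\<lambda>t. u (reflect i x + t *\<^sub>R axis j 1)) has_real_derivative g j (- t)) (at (- t))"
        by (rule eventually_compose_filterlim[OF g(1)[of j]])
      then show ?thesis
      proof eventually_elim
        case (elim t)
        have "((\<lambda>t. u (reflect i x + (- t) *\<^sub>R axis j 1)) has_real_derivative g j (- t) * (- 1)) (at t)"
          by (rule DERIV_chain2[where f = "\<lambda>t. u (reflect i x + t *\<^sub>R axis j 1)" and g = uminus, OF elim]) (auto intro!: derivative_eq_intros)
        then show ?case using True by (simp add: r2)
      qed
    next
      case False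
      then show ?thesis using g(1)[of j] by (simp add: r1)
    qed
    show "((\<lambda>t. if j = i then - g j (- t) else g j t) has_real_derivative gg j) (at 0)"
    proof (cases "j = i")
      case True
      have "((\<lambda>t. g j (- t)) has_real_derivative gg j * (- 1)) (at 0)"
        by (rule DERIV_chain2[of "g j"]) (use g(2)[of j] in \<open>auto intro!: derivative_eq_intros\<close>)
      from DERIV_minus[OF this] show ?thesis using True by simp
    qed (use g(2)[of j] in simp)
  qed (rule g(3))
qed

lemma second_derivative_local_max:
  fixes p g :: "real \<Rightarrow> real"
  assumes "\<forall>\<^sub>F t in nhds 0. (p has_real_derivative g t) (at t)" and "(g has_real_derivative c) (at 0)"
    and "\<forall>\<^sub>F t in nhds 0. p t \<le> p 0"
  shows "c \<le> 0"
proof (rule ccontr)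
  assume "\<not> c \<le> 0"
  then have c: "0 < c" by simp
  obtain d where d: "d > 0" "\<And>t. \<bar>t\<bar> < d \<Longrightarrow> (p has_real_derivative g t) (at t)" "\<And>t. \<bar>t\<bar> < d \<Longrightarrow> p t \<le> p 0"
    using eventually_conj[OF assms(1,3)] unfolding eventually_nhds_metric dist_real_def by auto
  have "g 0 = 0"
    by (rule DERIV_local_max[OF d(2)]) (use d in auto)
  obtain e where e: "e > 0" "\<And>h. 0 < h \<Longrightarrow> h < e \<Longrightarrow> g 0 < g (0 + h)"
    using DERIV_pos_inc_right[OF assms(2) c] by auto
  define h where "h = min d e / 2"
  have h: "0 < h" "h < d" "h < e" using d e by (auto simp: h_def min_def)
  obtain z where z: "0 < z" "z < h" "p h - p 0 = (h - 0) * g z"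
    using MVT2[of 0 h p g] d(2) h by auto
  have "0 < g z" using e(2)[of z] z h \<open>g 0 = 0\<close> by simp
  then have "p h > p 0" using z h by (metis diff_gt_0_iff_gt diff_zero mult_pos_pos)
  then show False using d(3)[of h] h by simp
qed

text \<open>Adding a small positive multiple of \<open>|z|\<^sup>2\<close> makes the Laplacian strictly positive, so a
  maximum of the sum cannot lie in the interior.\<close>

lemma weak_maximum_principle:
  fixes w :: "real^'n \<Rightarrow> real"
  assumes U: "bounded U" "open U" and cont: "continuous_on (closure U) w"
    and bd: "\<And>x. x \<in> frontier U \<Longrightarrow> w x \<le> 0"
    and sub: "\<And>x. x \<in> U \<Longrightarrow> \<exists>l\<ge>0. has_laplacian w l x"
    and x: "x \<in> U"
  shows "w x \<le> 0"
proof (rule ccontr)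
  assume "\<not> w x \<le> 0"
  then have wx: "w x > 0" by simp
  obtain R where R: "R > 0" "\<And>z. z \<in> closure U \<Longrightarrow> norm z \<le> R"
    using bounded_closure[OF U(1)] unfolding bounded_pos by blast
  \<comment> \<open>with this factor the added term stays below \<open>w x\<close> on the closure of \<open>U\<close>\<close>
  define k where "k = w x / (2 * R\<^sup>2)"
  have k: "k > 0" and kR: "k * R\<^sup>2 < w x" using wx R by (auto simp: k_def field_simps)
  define W where "W z = w z + k * (z \<bullet> z)" for z
  have cW: "continuous_on (closure U) W" unfolding W_def by (intro continuous_intros cont)
  obtain m where m: "m \<in> closure U" "\<And>z. z \<in> closure U \<Longrightarrow> W z \<le> W m"
    using continuous_attains_sup[OF compact_closure[THEN iffD2, OF U(1)] _ cW] x closure_subset by blast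
  have "W x \<le> W m" using m x closure_subset by blast
  moreover have "w x \<le> W x" using k by (simp add: W_def)
  ultimately have Wm: "w x \<le> W m" by linarith
  have mU: "m \<in> U"
  proof (rule ccontr)
    assume "m \<notin> U"
    then have "m \<in> frontier U" using m U by (simp add: frontier_def interior_open)
    moreover have "m \<bullet> m \<le> R\<^sup>2" using R(2)[OF m(1)] by (simp add: dot_square_norm power_mono)
    ultimately have "W m \<le> k * R\<^sup>2" using bd[of m] mult_left_mono[of "m \<bullet> m" "R\<^sup>2" k] less_imp_le[OF k]
      unfolding W_def by linarith
    then show False using kR Wm by simp
  qed
  obtain l where l: "l \<ge> 0" "has_laplacian w l m" using sub[OF mU] by blast
  have "has_laplacian (\<lambda>z. z \<bullet> z) (\<Sum>i\<in>(UNIV::'n set). 2 * 1) m"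
    by (rule has_laplacian_line_quadratic[where a = "\<lambda>i. 2 * m $ i"])
       (simp add: inner_axis inner_axis' inner_add_left inner_add_right inner_axis_axis power2_eq_square algebra_simps)
  then have "has_laplacian W (l + k * (\<Sum>i\<in>(UNIV::'n set). 2 * 1)) m"
    unfolding W_def by (intro has_laplacian_add l has_laplacian_cmult)
  then obtain g gg where g: "\<And>i. \<forall>\<^sub>F t in nhds 0. ((\<lambda>t. W (m + t *\<^sub>R axis i 1)) has_real_derivative g i t) (at t)"
    "\<And>i. (g i has_real_derivative gg i) (at 0)" "l + k * (\<Sum>i\<in>(UNIV::'n set). 2 * 1) = (\<Sum>i\<in>UNIV. gg i)"
    unfolding has_laplacian_def by blast
  have "gg i \<le> 0" for i
  proof (rule second_derivative_local_max[OF g(1,2)])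
    have "((\<lambda>t. m + t *\<^sub>R axis i 1) \<longlongrightarrow> m + 0 *\<^sub>R axis i 1) (nhds (0::real))"
      by (intro tendsto_intros filterlim_ident)
    then have "\<forall>\<^sub>F t in nhds (0::real). m + t *\<^sub>R axis i 1 \<in> U"
      using topological_tendstoD[OF _ U(2)] mU by fastforce
    then show "\<forall>\<^sub>F t in nhds 0. W (m + t *\<^sub>R axis i 1) \<le> W (m + 0 *\<^sub>R axis i 1)"
      by eventually_elim (use m closure_subset in auto)
  qed
  then have "(\<Sum>i\<in>UNIV. gg i) \<le> 0" by (rule sum_nonpos)
  moreover have "0 < k * (\<Sum>i\<in>(UNIV::'n set). 2 * 1)" using k by simp
  ultimately show False using g(3) l by linarith
qed

lemma has_laplacian_harmonic_function:
  fixes u :: "real^'n \<Rightarrow> real"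
  assumes h: "harmonic_function_on U u" and U: "open U" and x: "x \<in> U"
  shows "has_laplacian u 0 x" 
proof -
  obtain f' :: "real^'n \<Rightarrow> (real^'n) \<Rightarrow>\<^sub>L real" where f': "\<And>x. x \<in> U \<Longrightarrow> (u has_derivative blinfun_apply (f' x)) (at x)"
    and c1: "C1_on U f'"
    using h U unfolding harmonic_function_on_def C2_on_def by (metis at_within_open)
  obtain f'' where f'': "\<And>x. x \<in> U \<Longrightarrow> (f' has_derivative blinfun_apply (f'' x)) (at x)"
    using c1 U unfolding C1_on_def by (metis at_within_open)
  define e where "e i = (axis i 1 :: real^'n)" for i
  have line: "((\<lambda>t. z + t *\<^sub>R e i) has_derivative (\<lambda>t. t *\<^sub>R e i)) (at t)" for z i t
    by (auto intro!: derivative_eq_intros)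
  have d1: "((\<lambda>t. u (z + t *\<^sub>R e i)) has_real_derivative f' (z + t *\<^sub>R e i) (e i)) (at t)"
    if "z + t *\<^sub>R e i \<in> U" for z t i
    using diff_chain_at[OF line f'[OF that]]
    by (simp add: has_field_derivative_def o_def blinfun.scaleR_right mult_commute_abs)
  have pd: "partial_deriv i u z = f' z (e i)" if "z \<in> U" for z i
    using d1[of z 0 i] that unfolding partial_deriv_def e_def[symmetric]
    by (intro vector_derivative_at) (simp add: has_real_derivative_iff_has_vector_derivative)
  have d2: "((\<lambda>t. f' (x + t *\<^sub>R e i) (e i)) has_real_derivative f'' x (e i) (e i)) (at 0)" for i
  proof -
    have "((\<lambda>t. f' (x + t *\<^sub>R e i)) has_derivative (\<lambda>t. f'' x (t *\<^sub>R e i))) (at 0)"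
      using diff_chain_at[OF line[of x i 0], of f' "f'' x"] f''[OF x] by (simp add: o_def)
    then have "((\<lambda>t. f' (x + t *\<^sub>R e i) (e i)) has_derivative (\<lambda>t. f'' x (t *\<^sub>R e i) (e i))) (at 0)"
      by (rule bounded_linear.has_derivative[OF blinfun.bounded_linear_left])
    then show ?thesis
      by (simp add: has_field_derivative_def blinfun.scaleR_right blinfun.scaleR_left mult_commute_abs)
  qed
  have evU: "\<forall>\<^sub>F t in nhds (0::real). x + t *\<^sub>R e i \<in> U" for i
  proof -
    have "((\<lambda>t. x + t *\<^sub>R e i) \<longlongrightarrow> x + 0 *\<^sub>R e i) (nhds (0::real))"
      by (intro tendsto_intros filterlim_ident)
    then show ?thesis using topological_tendstoD[OF _ U] x by fastforce
  qed
  have pd2: "partial_deriv i (partial_deriv i u) x = f'' x (e i) (e i)" for i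
  proof -
    have "((\<lambda>t. partial_deriv i u (x + t *\<^sub>R e i)) has_real_derivative f'' x (e i) (e i)) (at 0)"
    proof (rule DERIV_cong_ev[THEN iffD1, OF refl _ refl d2])
      show "\<forall>\<^sub>F t in nhds 0. blinfun_apply (f' (x + t *\<^sub>R e i)) (e i) = partial_deriv i u (x + t *\<^sub>R e i)"
        using evU[of i] by eventually_elim (simp add: pd)
    qed
    then show ?thesis
      unfolding partial_deriv_def[of i "partial_deriv i u"] e_def[symmetric]
      by (intro vector_derivative_at) (simp add: has_real_derivative_iff_has_vector_derivative)
  qed
  show ?thesis
  proof (rule has_laplacianI[where g = "\<lambda>i t. f' (x + t *\<^sub>R e i) (e i)" and gg = "\<lambda>i. f'' x (e i) (e i)"])
    show "\<forall>\<^sub>F t in nhds 0. ((\<lambda>t. u (x + t *\<^sub>R axis i 1)) has_real_derivative f' (x + t *\<^sub>R e i) (e i)) (at t)" for i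
      using evU[of i] unfolding e_def[symmetric] by eventually_elim (rule d1)
    show "0 = (\<Sum>i\<in>UNIV. f'' x (e i) (e i))"
    proof -
      have "laplacian u x = 0" using h x by (auto simp: harmonic_function_on_def)
      then show ?thesis unfolding laplacian_def pd2 by simp
    qed
  qed (rule d2)
qed

section \<open>Interior gradient estimates\<close>

text \<open>The function \<open>v z = u z - u (reflect i z)\<close> is harmonic in the half ball, vanishes on
  its flat face and is at most \<open>2 * M\<close> on the spherical part. The quadratic polynomial subtracted in
  \<open>w\<close> is harmonic and dominates these boundary values, and the derivative of \<open>v\<close>
  in the direction of \<open>i\<close> at the origin is twice the derivative of \<open>u\<close>.\<close>

lemma harmonic_partial_le:
  fixes u :: "real^'n \<Rightarrow> real" and M r :: real
  assumes r: "0 < r" and cont: "continuous_on (cball 0 r) u"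
    and lap: "\<And>z. z \<in> ball 0 r \<Longrightarrow> has_laplacian u 0 z"
    and M: "\<And>z. z \<in> cball 0 r \<Longrightarrow> \<bar>u z\<bar> \<le> M"
    and d: "(u has_derivative u') (at 0)"
  shows "u' (axis i 1) \<le> CARD('n) * M / r"
proof -
  define n where "n = real CARD('n)"
  define e where "e = (axis i 1 :: real^'n)"
  define U where "U = ball 0 r \<inter> {z::real^'n. 0 < z $ i}"
  \<comment> \<open>the coefficient \<open>n\<close> balances the Laplacians of the two quadratic terms\<close>
  define w where "w z = u z - u (reflect i z) - 2 * M * ((1 / r\<^sup>2) * (z \<bullet> z) + n * ((1/r) * z $ i + (- 1 / r\<^sup>2) * (z $ i)\<^sup>2))" for z
  have n1: "1 \<le> n" unfolding n_def using zero_less_card_finite[where 'a='n] by linarith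
  have M0: "0 \<le> M" using M[of 0] r by fastforce
  have nr: "norm (reflect i z) = norm z" for z
  proof -
    have "reflect i z \<bullet> reflect i z = z \<bullet> z"
      by (simp add: reflect_def inner_diff_left inner_diff_right inner_axis inner_axis' inner_axis_axis algebra_simps)
    then show ?thesis by (simp add: norm_eq_sqrt_inner)
  qed
  have linr: "linear (reflect i)"
    by (intro linearI) (simp_all add: reflect_def algebra_simps)
  have crefl: "continuous_on S (reflect i)" for S
    by (rule linear_continuous_on) (use linr in \<open>simp add: linear_conv_bounded_linear\<close>)
  have clU: "closure U \<subseteq> cball 0 r \<inter> {z. 0 \<le> z $ i}"
    by (rule closure_minimal) (auto simp: U_def intro!: closed_Int closed_Collect_le continuous_intros)
  have openU: "open U" unfolding U_def by (intro open_Int open_ball open_Collect_less continuous_intros)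
  have claim: "w z \<le> 0" if "z \<in> U" for z
  proof (rule weak_maximum_principle[OF _ openU _ _ _ that])
    show "bounded U" unfolding U_def by (intro bounded_Int) auto
    have "continuous_on (cball 0 r) (\<lambda>z. u (reflect i z))"
      by (rule continuous_on_compose2[OF cont crefl]) (auto simp: nr)
    then have "continuous_on (cball 0 r) w" unfolding w_def by (intro continuous_intros cont)
    then show "continuous_on (closure U) w" by (rule continuous_on_subset) (use clU in auto)
    show "w z \<le> 0" if "z \<in> frontier U" for z
    proof -
      have z: "z \<in> cball 0 r" "0 \<le> z $ i" and zU: "z \<notin> U"
        using that clU openU by (auto simp: frontier_def interior_open)
      have t: "z $ i \<le> r" using z component_le_norm_cart[of z i] by (simp add: order_trans)
      have q: "0 \<le> (1/r) * z $ i + (- 1 / r\<^sup>2) * (z $ i)\<^sup>2"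
      proof -
        have "(1/r) * z $ i + (- 1 / r\<^sup>2) * (z $ i)\<^sup>2 = (z $ i * (r - z $ i)) / r\<^sup>2"
          using r by (simp add: field_simps power2_eq_square)
        then show ?thesis using z t by simp
      qed
      show ?thesis
      proof (cases "z $ i = 0")
        case True
        then have "reflect i z = z" by (simp add: reflect_def)
        then show ?thesis using M0 True by (simp add: w_def)
      next
        case False
        then have "z \<notin> ball 0 r" using zU z by (auto simp: U_def)
        then have "norm z = r" using z by simp
        then have "(1 / r\<^sup>2) * (z \<bullet> z) = 1" using r by (simp add: dot_square_norm)
        then have "1 \<le> (1 / r\<^sup>2) * (z \<bullet> z) + n * ((1/r) * z $ i + (- 1 / r\<^sup>2) * (z $ i)\<^sup>2)"
          using mult_nonneg_nonneg[OF order_trans[OF zero_le_one n1] q] by linarith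
        then have "2 * M * 1 \<le> 2 * M * ((1 / r\<^sup>2) * (z \<bullet> z) + n * ((1/r) * z $ i + (- 1 / r\<^sup>2) * (z $ i)\<^sup>2))"
          by (rule mult_left_mono) (use M0 in simp)
        moreover have "u z - u (reflect i z) \<le> 2 * M"
          using M[of z] M[of "reflect i z"] z by (auto simp: nr)
        ultimately show ?thesis by (simp add: w_def)
      qed
    qed
    show "\<exists>l\<ge>0. has_laplacian w l z" if "z \<in> U" for z
    proof -
      have l1: "has_laplacian u 0 z" using that lap by (simp add: U_def)
      have l2: "has_laplacian (\<lambda>z. u (reflect i z)) 0 z"
        by (rule has_laplacian_reflect, rule lap) (use that in \<open>simp add: U_def nr\<close>)
      have l3: "has_laplacian (\<lambda>z. z \<bullet> z) (\<Sum>j\<in>(UNIV::'n set). 2 * 1) z"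
        by (rule has_laplacian_line_quadratic[where a = "\<lambda>j. 2 * z $ j"])
           (simp add: inner_axis inner_axis' inner_add_left inner_add_right inner_axis_axis power2_eq_square algebra_simps)
      have l4: "has_laplacian (\<lambda>z. z $ i) (\<Sum>j\<in>(UNIV::'n set). 2 * 0) z"
        by (rule has_laplacian_line_quadratic[where a = "\<lambda>j. if j = i then 1 else 0"])
           (auto simp: axis_def)
      have l5: "has_laplacian (\<lambda>z. (z $ i)\<^sup>2) (\<Sum>j\<in>(UNIV::'n set). 2 * (if j = i then 1 else 0)) z"
        by (rule has_laplacian_line_quadratic[where a = "\<lambda>j. if j = i then 2 * z $ i else 0"])
           (auto simp: axis_def power2_eq_square algebra_simps)
      have "has_laplacian w (0 - 0 - 2 * M * ((1/r\<^sup>2) * (\<Sum>j\<in>(UNIV::'n set). 2 * 1)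
          + n * ((1/r) * (\<Sum>j\<in>(UNIV::'n set). 2 * 0) + (-1/r\<^sup>2) * (\<Sum>j\<in>(UNIV::'n set). 2 * (if j = i then 1 else 0))))) z"
        unfolding w_def
        by (intro has_laplacian_diff has_laplacian_add has_laplacian_cmult l1 l2 l3 l4 l5)
      moreover have "0 - 0 - 2 * M * ((1/r\<^sup>2) * (\<Sum>j\<in>(UNIV::'n set). 2 * 1)
          + n * ((1/r) * (\<Sum>j\<in>(UNIV::'n set). 2 * 0) + (-1/r\<^sup>2) * (\<Sum>j\<in>(UNIV::'n set). 2 * (if j = i then 1 else 0)))) = 0"
        using r by (simp add: n_def sum_distrib_left[symmetric])
      ultimately show ?thesis by auto
    qed
  qed
  have line: "((\<lambda>t. (c * t) *\<^sub>R e) has_derivative (\<lambda>t. (c * t) *\<^sub>R e)) (at 0)" for c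
    by (auto intro!: derivative_eq_intros)
  have lin: "linear u'" using d has_derivative_linear by blast
  have dl: "((\<lambda>t. u ((c * t) *\<^sub>R e)) has_real_derivative c * u' e) (at 0)" for c
    using diff_chain_at[OF line, of u u' c] d linear_cmul[OF lin, of _ e]
    by (simp add: has_field_derivative_def o_def mult_commute_abs mult.assoc mult.left_commute)
  define p where "p t = u ((1 * t) *\<^sub>R e) - u (((-1) * t) *\<^sub>R e) - 2 * M * ((1 / r\<^sup>2) * t\<^sup>2 + n * ((1/r) * t + (- 1 / r\<^sup>2) * t\<^sup>2))" for t
  have dp: "(p has_real_derivative 2 * (u' e - M * n / r)) (at 0)"
    unfolding p_def by (rule derivative_eq_intros dl refl | simp)+ 
  have pw: "p t \<le> 0" if "0 < t" "t < r" for t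
  proof -
    have "t *\<^sub>R e \<in> U" using that r by (simp add: U_def e_def)
    then have "w (t *\<^sub>R e) \<le> 0" by (rule claim)
    moreover have "reflect i (t *\<^sub>R e) = ((-1) * t) *\<^sub>R e"
      by (simp add: reflect_def e_def vec_eq_iff axis_def)
    ultimately show ?thesis
      by (simp add: w_def p_def) (simp add: e_def inner_axis_axis power2_eq_square)
  qed
  \<comment> \<open>\<open>p\<close> vanishes at zero and is nonpositive to the right of it, so its derivative is nonpositive\<close>
  show ?thesis
  proof (rule ccontr)
    assume "\<not> ?thesis"
    then have "0 < 2 * (u' e - M * n / r)" by (simp add: e_def n_def mult.commute)
    from DERIV_pos_inc_right[OF dp this] obtain s where s: "s > 0" "\<And>h. 0 < h \<Longrightarrow> h < s \<Longrightarrow> p 0 < p (0 + h)" by auto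
    have "p 0 < p (0 + min s r / 2)" by (rule s(2)) (use s r in \<open>auto simp: min_def\<close>)
    moreover have "p (0 + min s r / 2) \<le> 0" using pw[of "min s r / 2"] s(1) r by (auto simp: min_def)
    moreover have "p 0 = 0" by (simp add: p_def)
    ultimately show False by simp
  qed
qed

text \<open>Sum over the coordinates; the half radius leaves room for a closed ball, on which
  the preceding estimate is stated.\<close>

lemma harmonic_gradient_bound:
  fixes u :: "real^'n \<Rightarrow> real" and M r :: real
  assumes r: "0 < r" and cont: "continuous_on (ball x r) u"
    and lap: "\<And>z. z \<in> ball x r \<Longrightarrow> has_laplacian u 0 z"
    and M: "\<And>z. z \<in> ball x r \<Longrightarrow> \<bar>u z\<bar> \<le> M"
    and d: "(u has_derivative u') (at x)"
  shows "\<bar>u' h\<bar> \<le> 2 * (real CARD('n))\<^sup>2 * M / r * norm h"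
proof -
  have sub: "z + x \<in> ball x r" if "z \<in> cball 0 (r/2)" for z
    using that r by (auto simp: dist_norm)
  define v where "v c z = c * u (z + x)" for c :: real and z
  have M0: "0 \<le> M" using M[of x] r by fastforce
  have part: "c * u' (axis i 1) \<le> CARD('n) * M / (r/2)" if c: "\<bar>c\<bar> = 1" for c i
  proof (rule harmonic_partial_le[where u = "v c" and u' = "\<lambda>h. c * u' h"])
    show "0 < r/2" using r by simp
    show "continuous_on (cball 0 (r/2)) (v c)"
      unfolding v_def by (intro continuous_intros continuous_on_compose2[OF cont]) (use sub in auto)
    show "has_laplacian (v c) 0 z" if "z \<in> ball 0 (r/2)" for z
      using has_laplacian_cmult[OF has_laplacian_translate[OF lap[OF sub]], of z c] that
      unfolding v_def by simp
    show "\<bar>v c z\<bar> \<le> M" if "z \<in> cball 0 (r/2)" for z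
      using M[OF sub[OF that]] c by (simp add: v_def abs_mult)
    have "((\<lambda>z. u (z + x)) has_derivative u') (at 0)"
    proof -
      have "((\<lambda>z. z + x) has_derivative (\<lambda>z. z)) (at 0)" by (auto intro!: derivative_eq_intros)
      from diff_chain_at[OF this, of u u'] d show ?thesis by (simp add: o_def)
    qed
    then show "(v c has_derivative (\<lambda>h. c * u' h)) (at 0)"
      unfolding v_def by (rule has_derivative_mult_right)
  qed
  have pi: "\<bar>u' (axis i 1)\<bar> \<le> 2 * CARD('n) * M / r" for i
    using part[of 1 i] part[of "-1" i] by (simp add: abs_le_iff mult_ac)
  have lin: "linear u'" using d has_derivative_linear by blast
  have "u' h = u' (\<Sum>i\<in>UNIV. (h $ i) *\<^sub>R axis i 1)"
    by (metis basis_expansion scalar_mult_eq_scaleR)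
  also have "\<dots> = (\<Sum>i\<in>UNIV. h $ i * u' (axis i 1))"
    by (simp add: linear_sum[OF lin] linear_cmul[OF lin])
  also have "\<bar>\<dots>\<bar> \<le> (\<Sum>i\<in>UNIV. \<bar>h $ i\<bar> * \<bar>u' (axis i 1)\<bar>)"
    using sum_abs[of "\<lambda>i. h $ i * u' (axis i 1)" UNIV] by (simp add: abs_mult)
  also have "\<dots> \<le> (\<Sum>i\<in>(UNIV::'n set). norm h * (2 * CARD('n) * M / r))"
    by (intro sum_mono mult_mono pi component_le_norm_cart) auto
  also have "\<dots> = 2 * (real CARD('n))\<^sup>2 * M / r * norm h"
    by (simp add: power2_eq_square)
  finally show ?thesis .
qed


lemma norm_le_if_inner_le:
  fixes v :: "'a::real_inner"
  assumes "\<And>e. norm e = 1 \<Longrightarrow> v \<bullet> e \<le> c" "0 \<le> c"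
  shows "norm v \<le> c"
proof (cases "v = 0")
  case False
  then have "v \<bullet> ((1 / norm v) *\<^sub>R v) = norm v" by (simp add: dot_square_norm power2_eq_square)
  then show ?thesis using assms(1)[of "(1 / norm v) *\<^sub>R v"] False by simp
qed (use assms(2) in simp)

text \<open>All linear functionals of \<open>f\<close> are required to be harmonic, not only its
  components, because the estimates below are applied in arbitrary directions.\<close>

definition harmonic_with_derivative ::
  "(real^'n) set \<Rightarrow> (real^'n \<Rightarrow> real^'n) \<Rightarrow> (real^'n \<Rightarrow> real^'n \<Rightarrow> real^'n) \<Rightarrow> bool" where
  "harmonic_with_derivative U f f' \<longleftrightarrow>
     (\<forall>z\<in>U. (f has_derivative f' z) (at z) \<and> (\<forall>e. has_laplacian (\<lambda>z. f z \<bullet> e) 0 z))"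

lemma vector_gradient_bound:
  fixes f :: "real^'n \<Rightarrow> real^'n" and M r :: real
  assumes r: "0 < r" and H: "harmonic_with_derivative (ball x r) f f'"
    and M: "\<And>z. z \<in> ball x r \<Longrightarrow> norm (f z - c) \<le> M"
  shows "norm (f' x h) \<le> 2 * (real CARD('n))\<^sup>2 * M / r * norm h"
proof (rule norm_le_if_inner_le)
  have d: "(f has_derivative f' z) (at z)" if "z \<in> ball x r" for z
    using H that by (auto simp: harmonic_with_derivative_def)
  have M0: "0 \<le> M" using M[of x] r by (meson centre_in_ball norm_ge_zero order_trans)
  then show "0 \<le> 2 * (real CARD('n))\<^sup>2 * M / r * norm h" using r by simp
  fix e :: "real^'n" assume e: "norm e = 1"
  have "\<bar>f' x h \<bullet> e\<bar> \<le> 2 * (real CARD('n))\<^sup>2 * M / r * norm h"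
  proof (rule harmonic_gradient_bound[OF r, where u = "\<lambda>z. f z \<bullet> e - c \<bullet> e"])
    have "continuous_on (ball x r) f"
      using d by (meson continuous_at_imp_continuous_on has_derivative_continuous)
    then show "continuous_on (ball x r) (\<lambda>z. f z \<bullet> e - c \<bullet> e)" by (intro continuous_intros)
    show "has_laplacian (\<lambda>z. f z \<bullet> e - c \<bullet> e) 0 z" if "z \<in> ball x r" for z
      using has_laplacian_diff[of "\<lambda>z. f z \<bullet> e" 0 z, OF _ has_laplacian_const] H that
      by (auto simp: harmonic_with_derivative_def)
    show "\<bar>f z \<bullet> e - c \<bullet> e\<bar> \<le> M" if "z \<in> ball x r" for z
      using Cauchy_Schwarz_ineq2[of "f z - c" e] M[OF that] e by (simp add: inner_diff_left)
    show "((\<lambda>z. f z \<bullet> e - c \<bullet> e) has_derivative (\<lambda>h. f' x h \<bullet> e)) (at x)"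
      using d[of x] r by (auto intro!: derivative_eq_intros)
  qed
  then show "f' x h \<bullet> e \<le> 2 * (real CARD('n))\<^sup>2 * M / r * norm h" by simp
qed

text \<open>The increment \<open>f (z + h) - f z\<close> is harmonic and at most \<open>Q * norm h\<close>, so the gradient
  estimate bounds the increment of the derivative.\<close>

lemma derivative_lipschitz:
  fixes f :: "real^'n \<Rightarrow> real^'n" and Q r :: real
  assumes r: "0 < r" and H: "harmonic_with_derivative (ball x r) f f'"
    and Q: "\<And>z k. z \<in> ball x r \<Longrightarrow> norm (f' z k) \<le> Q * norm k"
    and h: "norm h < r / 2"
  shows "norm (f' (x + h) k - f' x k) \<le> 4 * (real CARD('n))\<^sup>2 * Q / r * norm h * norm k"
proof -
  have d: "(f has_derivative f' z) (at z)" if "z \<in> ball x r" for z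
    using H that by (auto simp: harmonic_with_derivative_def)
  define D where "D z = f (z + h) - f z" for z
  have zh: "z + h \<in> ball x r" "z \<in> ball x r" if "z \<in> ball x (r/2)" for z
  proof -
    have "norm (x - (z + h)) \<le> norm (x - z) + norm h"
      using norm_triangle_ineq4[of "x - z" h] by (simp add: algebra_simps)
    then show "z + h \<in> ball x r" "z \<in> ball x r"
      using that h norm_ge_zero[of "x - z"] unfolding mem_ball dist_norm by linarith+
  qed
  have HD: "harmonic_with_derivative (ball x (r/2)) D (\<lambda>z k. f' (z + h) k - f' z k)"
    unfolding harmonic_with_derivative_def
  proof (intro ballI conjI allI)
    fix z e assume z: "z \<in> ball x (r/2)"
    have "((\<lambda>z. z + h) has_derivative (\<lambda>z. z)) (at z)" by (auto intro!: derivative_eq_intros)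
    from diff_chain_at[OF this, of f "f' (z + h)"] d[OF zh(1)[OF z]]
    have "((\<lambda>z. f (z + h)) has_derivative f' (z + h)) (at z)" by (simp add: o_def)
    then show "(D has_derivative (\<lambda>k. f' (z + h) k - f' z k)) (at z)"
      unfolding D_def by (rule has_derivative_diff) (rule d[OF zh(2)[OF z]])
    have "has_laplacian (\<lambda>z. f (z + h) \<bullet> e) 0 z"
      by (rule has_laplacian_translate) (use H zh(1)[OF z] in \<open>auto simp: harmonic_with_derivative_def\<close>)
    moreover have "has_laplacian (\<lambda>z. f z \<bullet> e) 0 z"
      using H zh(2)[OF z] by (auto simp: harmonic_with_derivative_def)
    ultimately show "has_laplacian (\<lambda>z. D z \<bullet> e) 0 z"
      using has_laplacian_diff[of "\<lambda>z. f (z + h) \<bullet> e" 0 z "\<lambda>z. f z \<bullet> e" 0]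
      by (simp add: D_def inner_diff_left)
  qed
  have "norm (D z - 0) \<le> Q * norm h" if z: "z \<in> ball x (r/2)" for z
  proof -
    have "norm (f (z + h) - f z) \<le> Q * norm (z + h - z)"
    proof (rule differentiable_bound[OF convex_ball[of x r]])
      show "(f has_derivative f' w) (at w within ball x r)" if "w \<in> ball x r" for w
        using d[OF that] by (rule has_derivative_at_withinI)
      show "onorm (f' w) \<le> Q" if "w \<in> ball x r" for w
        by (rule onorm_le) (use Q[OF that] in simp)
    qed (use zh[OF z] in auto)
    then show ?thesis by (simp add: D_def)
  qed
  from vector_gradient_bound[OF _ HD this] r
  have "norm (f' (x + h) k - f' x k) \<le> 2 * (real CARD('n))\<^sup>2 * (Q * norm h) / (r/2) * norm k" by simp
  then show ?thesis by (simp add: mult_ac)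
qed

lemma taylor_bound:
  fixes f :: "real^'n \<Rightarrow> real^'n" and Q r :: real
  assumes r: "0 < r" and H: "harmonic_with_derivative (ball x r) f f'"
    and Q: "\<And>z k. z \<in> ball x r \<Longrightarrow> norm (f' z k) \<le> Q * norm k"
    and h: "norm h < r / 2"
  shows "norm (f (x + h) - f x - f' x h) \<le> 4 * (real CARD('n))\<^sup>2 * Q / r * (norm h)\<^sup>2"
proof -
  have d: "(f has_derivative f' z) (at z)" if "z \<in> ball x r" for z
    using H that by (auto simp: harmonic_with_derivative_def)
  have Q0: "0 \<le> Q"
  proof -
    obtain k :: "real^'n" where "norm k = 1" using vector_choose_size[of 1] by auto
    then show ?thesis using Q[of x k] r by (simp add: order_trans[OF norm_ge_zero])
  qed
  have seg: "x + t *\<^sub>R (x + h - x) \<in> cball x (norm h)" if "t \<in> {0..1}" for t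
    using that mult_left_le_one_le[of "norm h" "\<bar>t\<bar>"] by (auto simp: dist_norm)
  have dw: "(f has_derivative f' z) (at z within cball x (norm h))" if "z \<in> cball x (norm h)" for z
    by (rule has_derivative_at_withinI, rule d) (use that h r in auto)
  have on: "onorm (f' z - f' x) \<le> 4 * (real CARD('n))\<^sup>2 * Q / r * norm h" if "z \<in> cball x (norm h)" for z
  proof (rule onorm_le)
    fix k
    have nz: "norm (z - x) \<le> norm h" using that by (simp add: dist_norm norm_minus_commute)
    then have "norm (f' (x + (z - x)) k - f' x k) \<le> 4 * (real CARD('n))\<^sup>2 * Q / r * norm (z - x) * norm k"
      by (intro derivative_lipschitz[OF r H Q]) (use h in auto)
    also have "\<dots> \<le> 4 * (real CARD('n))\<^sup>2 * Q / r * norm h * norm k"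
      using nz Q0 r by (intro mult_right_mono mult_left_mono) auto
    finally show "norm ((f' z - f' x) k) \<le> 4 * (real CARD('n))\<^sup>2 * Q / r * norm h * norm k" by simp
  qed
  have "norm (f (x + h) - f x - f' x (x + h - x)) \<le> norm (x + h - x) * (4 * (real CARD('n))\<^sup>2 * Q / r * norm h)"
    by (rule differentiable_bound_linearization[OF seg dw on]) auto
  then show ?thesis by (simp add: power2_eq_square mult_ac)
qed

section \<open>Superharmonic barriers at boundary points\<close>

text \<open>On the ball \<open>1 - z \<bullet> a\<close> is the distance of \<open>z\<close> from the tangent plane at the boundary point \<open>a\<close>.
  The power of \<open>norm (z - a)\<close> prescribes the boundary growth but is subharmonic; the concave power of
  the distance to the tangent plane is superharmonic, and its coefficient is the smallest that makes
  the sum superharmonic.\<close>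

definition barrier :: "real^'n \<Rightarrow> real \<Rightarrow> real^'n \<Rightarrow> real" where
  "barrier a \<beta> z = norm (z - a) powr \<beta> + ((real CARD('n) - 2 + \<beta>) / (1 - \<beta>)) * (1 - z \<bullet> a) powr \<beta>"

lemma has_laplacian_norm_powr:
  fixes y :: "real^'n"
  assumes "y \<noteq> 0"
  shows "has_laplacian (\<lambda>z. norm z powr \<beta>) (\<beta> * (real CARD('n) - 2 + \<beta>) * norm y powr (\<beta> - 2)) y"
proof -
  define q where "q = y \<bullet> y"
  have q: "q > 0" using assms by (simp add: q_def)
  define Q where "Q i t = q + 2 * y $ i * t + t\<^sup>2" for i t
  have Qeq: "(y + t *\<^sub>R axis i 1) \<bullet> (y + t *\<^sub>R axis i 1) = Q i t" for i t
    by (simp add: Q_def q_def inner_axis inner_axis' inner_add_left inner_add_right inner_axis_axis power2_eq_square algebra_simps)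
  have np: "norm v powr c = (v \<bullet> v) powr (c/2)" for v :: "real^'n" and c
    by (simp add: norm_eq_sqrt_inner powr_half_sqrt[symmetric] powr_powr)
  have DQ: "(Q i has_real_derivative 2 * y $ i + 2 * t) (at t)" for i t
    unfolding Q_def[abs_def] by (auto intro!: derivative_eq_intros)
  show ?thesis
  proof (rule has_laplacianI[where g = "\<lambda>i t. (\<beta>/2) * Q i t powr (\<beta>/2 - 1) * (2 * y $ i + 2 * t)"
        and gg = "\<lambda>i. (\<beta>/2) * ((\<beta>/2 - 1) * q powr (\<beta>/2 - 2) * (2 * y $ i) * (2 * y $ i) + q powr (\<beta>/2 - 1) * 2)"])
    fix i
    have "(Q i \<longlongrightarrow> Q i 0) (nhds 0)"
      unfolding Q_def[abs_def] by (intro tendsto_intros filterlim_ident)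
    then have ev: "\<forall>\<^sub>F t in nhds 0. Q i t > 0"
      using q by (auto simp: Q_def dest: order_tendstoD)
    show "\<forall>\<^sub>F t in nhds 0. ((\<lambda>t. norm (y + t *\<^sub>R axis i 1) powr \<beta>) has_real_derivative
            (\<beta>/2) * Q i t powr (\<beta>/2 - 1) * (2 * y $ i + 2 * t)) (at t)"
      using ev
    proof eventually_elim
      case (elim t)
      have "((\<lambda>t. Q i t powr (\<beta>/2)) has_real_derivative (\<beta>/2) * Q i t powr (\<beta>/2 - of_nat 1) * (2 * y $ i + 2 * t)) (at t)"
        by (rule DERIV_fun_powr[OF DQ elim])
      then show ?case by (simp add: np Qeq)
    qed
    have Q0: "Q i 0 = q" by (simp add: Q_def)
    have "((\<lambda>t. Q i t powr (\<beta>/2 - 1)) has_real_derivative (\<beta>/2 - 1) * Q i 0 powr (\<beta>/2 - 1 - of_nat 1) * (2 * y $ i + 2 * 0)) (at 0)"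
      by (rule DERIV_fun_powr[OF DQ]) (simp add: Q0 q)
    then have "((\<lambda>t. Q i t powr (\<beta>/2 - 1)) has_real_derivative (\<beta>/2 - 1) * q powr (\<beta>/2 - 2) * (2 * y $ i)) (at 0)"
      by (simp add: Q0)
    moreover have "((\<lambda>t. 2 * y $ i + 2 * t) has_real_derivative 2) (at 0)"
      by (auto intro!: derivative_eq_intros)
    ultimately have "((\<lambda>t. Q i t powr (\<beta>/2 - 1) * (2 * y $ i + 2 * t)) has_real_derivative
        (\<beta>/2 - 1) * q powr (\<beta>/2 - 2) * (2 * y $ i) * (2 * y $ i + 2 * 0) + 2 * Q i 0 powr (\<beta>/2 - 1)) (at 0)"
      by (rule DERIV_mult)
    from DERIV_cmult[OF this, of "\<beta>/2"]
    have "((\<lambda>t. \<beta>/2 * (Q i t powr (\<beta>/2 - 1) * (2 * y $ i + 2 * t))) has_real_derivative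
        \<beta>/2 * ((\<beta>/2 - 1) * q powr (\<beta>/2 - 2) * (2 * y $ i) * (2 * y $ i + 2 * 0) + 2 * Q i 0 powr (\<beta>/2 - 1))) (at 0)" .
    then show "((\<lambda>t. (\<beta>/2) * Q i t powr (\<beta>/2 - 1) * (2 * y $ i + 2 * t)) has_real_derivative
        (\<beta>/2) * ((\<beta>/2 - 1) * q powr (\<beta>/2 - 2) * (2 * y $ i) * (2 * y $ i) + q powr (\<beta>/2 - 1) * 2)) (at 0)"
      by (simp add: Q0 mult_ac)
  next
    have qs: "(\<Sum>i\<in>UNIV. y $ i * y $ i) = q" by (simp add: q_def inner_vec_def)
    have "(\<Sum>i\<in>UNIV. (\<beta>/2) * ((\<beta>/2 - 1) * q powr (\<beta>/2 - 2) * (2 * y $ i) * (2 * y $ i) + q powr (\<beta>/2 - 1) * 2))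
      = (\<Sum>i\<in>UNIV. (2 * \<beta> * (\<beta>/2 - 1) * q powr (\<beta>/2 - 2)) * (y $ i * y $ i) + \<beta> * q powr (\<beta>/2 - 1))"
      by (rule sum.cong) (simp_all add: algebra_simps)
    also have "\<dots> = 2 * \<beta> * (\<beta>/2 - 1) * (q powr (\<beta>/2 - 2) * q) + CARD('n) * (\<beta> * q powr (\<beta>/2 - 1))"
      by (simp add: sum.distrib sum_distrib_left[symmetric] qs)
    also have "\<dots> = \<beta> * (real CARD('n) - 2 + \<beta>) * q powr (\<beta>/2 - 1)"
    proof -
      have "q powr (\<beta>/2 - 2) * q = q powr (\<beta>/2 - 1)"
        using q powr_mult_base[of q "\<beta>/2 - 2"] by (simp add: mult.commute)
      then show ?thesis by (simp only:) (simp add: algebra_simps)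
    qed
    also have "\<dots> = \<beta> * (real CARD('n) - 2 + \<beta>) * norm y powr (\<beta> - 2)"
      unfolding np q_def by (simp add: diff_divide_distrib)
    finally show "\<beta> * (real CARD('n) - 2 + \<beta>) * norm y powr (\<beta> - 2) =
      (\<Sum>i\<in>UNIV. (\<beta>/2) * ((\<beta>/2 - 1) * q powr (\<beta>/2 - 2) * (2 * y $ i) * (2 * y $ i) + q powr (\<beta>/2 - 1) * 2))"
      by (rule sym)
  qed
qed

lemma has_laplacian_affine_powr:
  fixes a z :: "real^'n"
  assumes "norm a = 1" and s: "0 < 1 - z \<bullet> a"
  shows "has_laplacian (\<lambda>z. (1 - z \<bullet> a) powr \<beta>) (\<beta> * (\<beta> - 1) * (1 - z \<bullet> a) powr (\<beta> - 2)) z"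
proof -
  define s where "s = 1 - z \<bullet> a"
  have s: "s > 0" using assms by (simp add: s_def)
  have eq: "1 - (z + t *\<^sub>R axis i 1) \<bullet> a = s - a $ i * t" for i t
    by (simp add: s_def inner_add_left inner_axis')
  have D: "((\<lambda>t. s - a $ i * t) has_real_derivative - a $ i) (at t)" for i t
    by (auto intro!: derivative_eq_intros)
  show ?thesis
  proof (rule has_laplacianI[where g = "\<lambda>i t. \<beta> * (s - a $ i * t) powr (\<beta> - 1) * (- a $ i)"
        and gg = "\<lambda>i. \<beta> * (\<beta> - 1) * s powr (\<beta> - 2) * (a $ i * a $ i)"])
    fix i
    have "((\<lambda>t. s - a $ i * t) \<longlongrightarrow> s - a $ i * 0) (nhds 0)"
      by (intro tendsto_intros filterlim_ident)
    then have "\<forall>\<^sub>F t in nhds 0. s - a $ i * t > 0"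
      using s by (auto dest: order_tendstoD)
    then show "\<forall>\<^sub>F t in nhds 0. ((\<lambda>t. (1 - (z + t *\<^sub>R axis i 1) \<bullet> a) powr \<beta>) has_real_derivative
          \<beta> * (s - a $ i * t) powr (\<beta> - 1) * (- a $ i)) (at t)"
    proof eventually_elim
      case (elim t)
      then show ?case unfolding eq using DERIV_fun_powr[OF D elim, of \<beta>] by simp
    qed
    have "((\<lambda>t. (s - a $ i * t) powr (\<beta> - 1)) has_real_derivative (\<beta> - 1) * s powr (\<beta> - 2) * (- a $ i)) (at 0)"
      using DERIV_fun_powr[OF D[of i 0], of "\<beta> - 1"] s by simp
    from DERIV_cmult[OF this, of "- \<beta> * a $ i"]
    show "((\<lambda>t. \<beta> * (s - a $ i * t) powr (\<beta> - 1) * (- a $ i)) has_real_derivative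
          \<beta> * (\<beta> - 1) * s powr (\<beta> - 2) * (a $ i * a $ i)) (at 0)"
      by (simp add: mult_ac)
  next
    have "(\<Sum>i\<in>UNIV. a $ i * a $ i) = 1"
      using assms(1) by (simp add: norm_eq_sqrt_inner inner_vec_def)
    then show "\<beta> * (\<beta> - 1) * (1 - z \<bullet> a) powr (\<beta> - 2) = (\<Sum>i\<in>UNIV. \<beta> * (\<beta> - 1) * s powr (\<beta> - 2) * (a $ i * a $ i))"
      by (simp add: sum_distrib_left[symmetric] s_def)
  qed
qed

text \<open>The Laplacian of the first term is a positive multiple of \<open>norm (z - a) powr (\<beta> - 2)\<close>,
  that of the second is the negative of the same multiple of \<open>(1 - z \<bullet> a) powr (\<beta> - 2)\<close>. As the distance to the
  tangent plane is at most the distance to \<open>a\<close> and the exponent is negative, the second term wins.\<close>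

lemma barrier_superharmonic:
  fixes a z :: "real^'n"
  assumes n: "2 \<le> CARD('n)" and a: "norm a = 1" and b: "0 < \<beta>" "\<beta> < 1" and z: "z \<in> ball 0 1"
  shows "\<exists>l\<le>0. has_laplacian (barrier a \<beta>) l z"
proof -
  have za: "z \<bullet> a < 1"
    using Cauchy_Schwarz_ineq2[of z a] a z by (auto simp: abs_le_iff)
  have aa: "a \<bullet> a = 1" using a by (simp add: dot_square_norm)
  have ne: "z - a \<noteq> 0" using a z by auto
  define A where "A = (real CARD('n) - 2 + \<beta>) / (1 - \<beta>)"
  define s where "s = 1 - z \<bullet> a"
  have s: "0 < s" using za by (simp add: s_def)
  have sle: "s \<le> norm (z - a)"
    using Cauchy_Schwarz_ineq2[of "z - a" a] a by (auto simp: inner_diff_left aa s_def abs_le_iff)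
  have l1: "has_laplacian (\<lambda>z. norm (z + (- a)) powr \<beta>) (\<beta> * (real CARD('n) - 2 + \<beta>) * norm (z - a) powr (\<beta> - 2)) z"
    by (rule has_laplacian_translate) (use has_laplacian_norm_powr[OF ne, of \<beta>] in simp)
  have l2: "has_laplacian (\<lambda>z. (1 - z \<bullet> a) powr \<beta>) (\<beta> * (\<beta> - 1) * s powr (\<beta> - 2)) z"
    unfolding s_def by (rule has_laplacian_affine_powr[OF a]) (use za in simp)
  have L: "has_laplacian (barrier a \<beta>) (\<beta> * (real CARD('n) - 2 + \<beta>) * norm (z - a) powr (\<beta> - 2) + A * (\<beta> * (\<beta> - 1) * s powr (\<beta> - 2))) z"
    using has_laplacian_add[OF l1 has_laplacian_cmult[OF l2, of A]]
    unfolding barrier_def[abs_def] A_def by simp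
  have "A * (\<beta> * (\<beta> - 1) * s powr (\<beta> - 2)) = - (\<beta> * (real CARD('n) - 2 + \<beta>) * s powr (\<beta> - 2))"
    using b by (simp add: A_def field_simps)
  moreover have "norm (z - a) powr (\<beta> - 2) \<le> s powr (\<beta> - 2)"
    by (rule powr_mono2') (use b s sle in auto)
  then have "\<beta> * (real CARD('n) - 2 + \<beta>) * norm (z - a) powr (\<beta> - 2) \<le> \<beta> * (real CARD('n) - 2 + \<beta>) * s powr (\<beta> - 2)"
    by (rule mult_left_mono) (use b n in auto)
  ultimately have "\<beta> * (real CARD('n) - 2 + \<beta>) * norm (z - a) powr (\<beta> - 2) + A * (\<beta> * (\<beta> - 1) * s powr (\<beta> - 2)) \<le> 0"
    by linarith
  with L show ?thesis by blast
qed

lemma barrier_ge: "2 \<le> CARD('n) \<Longrightarrow> 0 < \<beta> \<Longrightarrow> \<beta> < 1 \<Longrightarrow> norm (z - a) powr \<beta> \<le> barrier (a :: real^'n) \<beta> z"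
  by (simp add: barrier_def)

lemma barrier_le:
  fixes a z :: "real^'n"
  assumes n: "2 \<le> CARD('n)" and a: "norm a = 1" and b: "0 < \<beta>" "\<beta> < 1" and z: "z \<in> ball 0 1"
    and d: "norm (z - a) \<le> d"
  shows "barrier a \<beta> z \<le> (1 + (real CARD('n) - 2 + \<beta>) / (1 - \<beta>)) * d powr \<beta>"
proof -
  have za: "z \<bullet> a < 1"
    using Cauchy_Schwarz_ineq2[of z a] a z by (auto simp: abs_le_iff)
  have aa: "a \<bullet> a = 1" using a by (simp add: dot_square_norm)
  have sle: "1 - z \<bullet> a \<le> norm (z - a)"
    using Cauchy_Schwarz_ineq2[of "z - a" a] a by (auto simp: inner_diff_left aa abs_le_iff)
  have p1: "norm (z - a) powr \<beta> \<le> d powr \<beta>" by (rule powr_mono2) (use b d in auto)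
  have p2: "(1 - z \<bullet> a) powr \<beta> \<le> d powr \<beta>" by (rule powr_mono2) (use b d za sle in auto)
  have "((real CARD('n) - 2 + \<beta>) / (1 - \<beta>)) * (1 - z \<bullet> a) powr \<beta> \<le> ((real CARD('n) - 2 + \<beta>) / (1 - \<beta>)) * d powr \<beta>"
    by (rule mult_left_mono[OF p2]) (use b n in auto)
  then show ?thesis using p1 by (simp add: barrier_def distrib_right)
qed

text \<open>Boundary growth of order \<open>\<beta> < 1\<close> at \<open>a\<close> is inherited by the interior. Two
  exponents are allowed at once, since the boundary values will be controlled by different powers near
  to and far from \<open>a\<close>.\<close>

lemma harmonic_le_barrier:
  fixes u :: "real^'n \<Rightarrow> real" and a :: "real^'n"
  assumes n: "2 \<le> CARD('n)" and a: "norm a = 1" and b: "0 < \<beta>" "\<beta> < 1" and g: "0 < \<gamma>" "\<gamma> < 1"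
    and c: "0 \<le> c\<^sub>1" "0 \<le> c\<^sub>2"
    and cont: "continuous_on (cball 0 1) u"
    and lap: "\<And>z. z \<in> ball 0 1 \<Longrightarrow> has_laplacian u 0 z"
    and bd: "\<And>w. w \<in> sphere 0 1 \<Longrightarrow> u w \<le> c\<^sub>1 * norm (w - a) powr \<beta> + c\<^sub>2 * norm (w - a) powr \<gamma>"
    and z: "z \<in> ball 0 1"
  shows "u z \<le> c\<^sub>1 * barrier a \<beta> z + c\<^sub>2 * barrier a \<gamma> z"
proof -
  have "u z - (c\<^sub>1 * barrier a \<beta> z + c\<^sub>2 * barrier a \<gamma> z) \<le> 0"
  proof (rule weak_maximum_principle[where w = "\<lambda>z. u z - (c\<^sub>1 * barrier a \<beta> z + c\<^sub>2 * barrier a \<gamma> z)", OF bounded_ball open_ball _ _ _ z])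
    have cb: "continuous_on (cball 0 1) (barrier a b)" if "0 < b" for b
    proof -
      have "0 \<le> 1 - w \<bullet> a" if "w \<in> cball 0 1" for w :: "real^'n"
        using Cauchy_Schwarz_ineq2[of w a] a that by (auto simp: abs_le_iff)
      then have "continuous_on (cball 0 1) (\<lambda>z. (1 - z \<bullet> a) powr b)"
        using that by (intro continuous_on_powr') (auto intro!: continuous_intros)
      moreover have "continuous_on (cball 0 1) (\<lambda>z. norm (z - a) powr b)"
        using that by (intro continuous_on_powr') (auto intro!: continuous_intros)
      ultimately show ?thesis
        unfolding barrier_def[abs_def]
        by (intro continuous_on_add continuous_on_mult continuous_on_const)
    qed
    show "continuous_on (closure (ball 0 1)) (\<lambda>z. u z - (c\<^sub>1 * barrier a \<beta> z + c\<^sub>2 * barrier a \<gamma> z))"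
      using b g by (auto intro!: continuous_intros cont cb)
    show "u w - (c\<^sub>1 * barrier a \<beta> w + c\<^sub>2 * barrier a \<gamma> w) \<le> 0" if "w \<in> frontier (ball 0 1)" for w
    proof -
      have "u w \<le> c\<^sub>1 * norm (w - a) powr \<beta> + c\<^sub>2 * norm (w - a) powr \<gamma>"
        using bd that by simp
      also have "\<dots> \<le> c\<^sub>1 * barrier a \<beta> w + c\<^sub>2 * barrier a \<gamma> w"
        by (intro add_mono mult_left_mono barrier_ge n b g c)
      finally show ?thesis by simp
    qed
    show "\<exists>l\<ge>0. has_laplacian (\<lambda>z. u z - (c\<^sub>1 * barrier a \<beta> z + c\<^sub>2 * barrier a \<gamma> z)) l w" if w: "w \<in> ball 0 1" for w
    proof -
      obtain k l where kl: "k \<le> 0" "l \<le> 0" "has_laplacian (barrier a \<beta>) k w" "has_laplacian (barrier a \<gamma>) l w"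
        using barrier_superharmonic[OF n a b w] barrier_superharmonic[OF n a g w] by blast
      have "has_laplacian (\<lambda>z. u z - (c\<^sub>1 * barrier a \<beta> z + c\<^sub>2 * barrier a \<gamma> z)) (0 - (c\<^sub>1 * k + c\<^sub>2 * l)) w"
        by (intro has_laplacian_diff has_laplacian_add has_laplacian_cmult lap w kl)
      moreover have "c\<^sub>1 * k + c\<^sub>2 * l \<le> 0"
        using c kl by (intro add_nonpos_nonpos mult_nonneg_nonpos)
      ultimately show ?thesis by (intro exI[of _ "0 - (c\<^sub>1 * k + c\<^sub>2 * l)"]) simp
    qed
  qed
  then show ?thesis by simp
qed

section \<open>Line integrals, logarithmic energy and null shadows\<close>

text \<open>A weighted Young inequality with crude constants: compare \<open>a\<close> with \<open>\<tau> * b\<close>.\<close>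

lemma young_product:
  fixes a b \<tau> :: real
  assumes "0 \<le> a" "0 \<le> b" "0 < \<tau>" "1 \<le> n"
  shows "a * b ^ (n - 1) \<le> a ^ n / \<tau> ^ (n - 1) + \<tau> * b ^ n"
proof -
  obtain m where n: "n = Suc m" using assms(4) by (cases n) auto
  show ?thesis
  proof (cases "a \<le> \<tau> * b")
    case True
    then have "a * b ^ m \<le> (\<tau> * b) * b ^ m" by (rule mult_right_mono) (use assms in simp)
    moreover have "0 \<le> a ^ n / \<tau> ^ m" using assms by simp
    ultimately show ?thesis by (simp add: n)
  next
    case False
    then have "b \<le> a / \<tau>" using assms by (simp add: field_simps)
    then have "a * b ^ m \<le> a * (a / \<tau>) ^ m"
      using assms by (intro mult_left_mono power_mono) auto
    moreover have "0 \<le> \<tau> * b ^ n" using assms by simp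
    ultimately show ?thesis by (simp add: n power_divide)
  qed
qed

lemma log_distance_derivative:
  fixes c :: "real \<Rightarrow> 'a::real_inner"
  assumes d: "(c has_derivative (\<lambda>h. h *\<^sub>R v)) (at t)" and s: "0 < s"
  obtains D where "((\<lambda>t. ln ((norm (c t - b))\<^sup>2 + s\<^sup>2)) has_real_derivative D) (at t)"
    "\<bar>D\<bar> \<le> 2 * norm v / sqrt ((norm (c t - b))\<^sup>2 + s\<^sup>2)"
proof -
  define q where "q = sqrt ((norm (c t - b))\<^sup>2 + s\<^sup>2)"
  have q: "0 < q" "q\<^sup>2 = (norm (c t - b))\<^sup>2 + s\<^sup>2" using s by (simp_all add: q_def add_nonneg_pos)
  have "norm (c t - b) \<le> q" unfolding q_def by (rule real_le_rsqrt) simp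
  have "((\<lambda>t. (c t - b) \<bullet> (c t - b) + s\<^sup>2) has_derivative (\<lambda>h. 2 * ((c t - b) \<bullet> v) * h)) (at t)"
    by (rule derivative_eq_intros d refl)+ (simp add: inner_commute algebra_simps fun_eq_iff)
  then have "((\<lambda>t. (norm (c t - b))\<^sup>2 + s\<^sup>2) has_real_derivative 2 * ((c t - b) \<bullet> v)) (at t)"
    by (simp add: has_field_derivative_def power2_norm_eq_inner)
  from DERIV_ln_divide[THEN DERIV_chain2, OF _ this]
  have "((\<lambda>t. ln ((norm (c t - b))\<^sup>2 + s\<^sup>2)) has_real_derivative 2 * ((c t - b) \<bullet> v) / q\<^sup>2) (at t)"
    using s by (simp add: q(2) add_nonneg_pos)
  moreover have "\<bar>2 * ((c t - b) \<bullet> v) / q\<^sup>2\<bar> \<le> 2 * norm v / q"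
  proof -
    have "\<bar>(c t - b) \<bullet> v\<bar> \<le> norm (c t - b) * norm v" by (rule Cauchy_Schwarz_ineq2)
    also have "\<dots> \<le> q * norm v" by (rule mult_right_mono) (fact, simp)
    finally have "2 * \<bar>(c t - b) \<bullet> v\<bar> / q\<^sup>2 \<le> 2 * (q * norm v) / q\<^sup>2"
      by (intro divide_right_mono mult_left_mono) auto
    then show ?thesis using q(1) by (simp add: abs_mult power2_eq_square)
  qed
  ultimately show ?thesis using that unfolding q_def by blast
qed

lemma borel_measurable_continuous_restricted:
  fixes h :: "'a::topological_space \<Rightarrow> real"
  assumes "open S" "continuous_on S h"
  shows "(\<lambda>x. ennreal (h x) * indicator S x) \<in> borel_measurable borel"
proof -
  have "(\<lambda>x. indicator S x *\<^sub>R h x) \<in> borel_measurable borel"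
    by (rule borel_measurable_continuous_on_indicator[OF _ assms(2)]) (use assms(1) in simp)
  then have "(\<lambda>x. ennreal (indicator S x *\<^sub>R h x)) \<in> borel_measurable borel" by measurable
  moreover have "ennreal (indicator S x *\<^sub>R h x) = ennreal (h x) * indicator S x" for x
    by (simp add: indicator_def)
  ultimately show ?thesis by simp
qed

text \<open>The energy density of \<open>ln (|z - a|\<^sup>2 + d\<^sup>2)\<close> has the critical homogeneity \<open>- n\<close>: every doubling of the
  radius adds at most the same amount, so the total grows only linearly in the number of doublings.\<close>

lemma log_energy:
  fixes a :: "real^'n"
  assumes d: "0 < d"
  shows "(\<integral>\<^sup>+z. ennreal ((1 / sqrt ((norm (z - a))\<^sup>2 + d\<^sup>2)) ^ CARD('n)) * indicator (ball a (2 ^ k * d)) z \<partial>lborel)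
     \<le> ennreal (real (k + 1) * 2 ^ CARD('n) * unit_ball_vol CARD('n))"
proof (induction k)
  define \<omega> where "\<omega> = unit_ball_vol (real CARD('n))"
  have \<omega>: "0 \<le> \<omega>" by (simp add: \<omega>_def unit_ball_vol_nonneg)
  define F where "F z = (1 / sqrt ((norm (z - a))\<^sup>2 + d\<^sup>2)) ^ CARD('n)" for z
  have F0: "0 \<le> F z" for z by (simp add: F_def)
  have Fm: "F \<in> borel_measurable borel" unfolding F_def[abs_def] by measurable
  have Fle: "F z \<le> (1 / r) ^ CARD('n)" if "r > 0" "r \<le> norm (z - a) \<or> r \<le> d" for z r
  proof -
    have "r\<^sup>2 \<le> (norm (z - a))\<^sup>2 + d\<^sup>2"
      using that(2)
    proof
      assume "r \<le> norm (z - a)"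
      then have "r\<^sup>2 \<le> (norm (z - a))\<^sup>2" using that(1) by (intro power_mono) auto
      then show ?thesis by (simp add: add_increasing2)
    next
      assume "r \<le> d"
      then have "r\<^sup>2 \<le> d\<^sup>2" using that(1) by (intro power_mono) auto
      then show ?thesis by (simp add: add_increasing)
    qed
    then have "r \<le> sqrt ((norm (z - a))\<^sup>2 + d\<^sup>2)" by (rule real_le_rsqrt)
    moreover from this have "0 < sqrt ((norm (z - a))\<^sup>2 + d\<^sup>2)" using that(1) by linarith
    ultimately show ?thesis unfolding F_def using that(1)
      by (intro power_mono divide_left_mono mult_pos_pos) auto
  qed
  have eb: "emeasure lborel (ball a r) = ennreal (\<omega> * r ^ CARD('n))" if "0 \<le> r" for r
    using emeasure_ball[OF that, of a] by (simp add: \<omega>_def)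
  have const: "(\<integral>\<^sup>+z. ennreal c * indicator (ball a r) z \<partial>lborel) = ennreal (c * (\<omega> * r ^ CARD('n)))"
    if "0 \<le> r" "0 \<le> c" for c r
    using that eb[OF that(1)] \<omega> by (simp add: nn_integral_cmult_indicator ennreal_mult)
  {
    case 0
    have "(\<integral>\<^sup>+z. ennreal (F z) * indicator (ball a d) z \<partial>lborel)
       \<le> (\<integral>\<^sup>+z. ennreal ((1/d) ^ CARD('n)) * indicator (ball a d) z \<partial>lborel)"
      by (intro nn_integral_mono mult_right_mono ennreal_leI Fle d) auto
    also have "\<dots> = ennreal \<omega>"
      using d const[of d "(1/d)^CARD('n)"] by (simp add: power_divide)
    also have "\<dots> \<le> ennreal (2 ^ CARD('n) * \<omega>)"
      using mult_right_mono[OF one_le_power[of "2::real" "CARD('n)"] \<omega>] by (intro ennreal_leI) simp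
    finally show ?case by (simp add: F_def \<omega>_def)
  next
    case (Suc k)
    define r where "r = 2 ^ k * d"
    have r: "r > 0" using d by (simp add: r_def)
    have "(\<integral>\<^sup>+z. ennreal (F z) * indicator (ball a (2 * r)) z \<partial>lborel)
       \<le> (\<integral>\<^sup>+z. ennreal (F z) * indicator (ball a r) z + ennreal ((1/r) ^ CARD('n)) * indicator (ball a (2 * r)) z \<partial>lborel)"
    proof (intro nn_integral_mono)
      fix z
      show "ennreal (F z) * indicator (ball a (2 * r)) z \<le> ennreal (F z) * indicator (ball a r) z + ennreal ((1/r) ^ CARD('n)) * indicator (ball a (2 * r)) z"
      proof (cases "z \<in> ball a r")
        case False
        then have "r \<le> norm (z - a)" by (simp add: dist_norm norm_minus_commute)
        then have "ennreal (F z) \<le> ennreal ((1/r) ^ CARD('n))" by (intro ennreal_leI Fle r) simp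
        then show ?thesis using False by (auto simp: indicator_def)
      qed (auto simp: indicator_def)
    qed
    also have "\<dots> = (\<integral>\<^sup>+z. ennreal (F z) * indicator (ball a r) z \<partial>lborel) + (\<integral>\<^sup>+z. ennreal ((1/r) ^ CARD('n)) * indicator (ball a (2 * r)) z \<partial>lborel)"
      by (rule nn_integral_add) (use Fm in \<open>auto intro!: borel_measurable_times_ennreal borel_measurable_indicator\<close>)
    also have "(\<integral>\<^sup>+z. ennreal ((1/r) ^ CARD('n)) * indicator (ball a (2 * r)) z \<partial>lborel) = ennreal (2 ^ CARD('n) * \<omega>)"
      using r const[of "2*r" "(1/r)^CARD('n)"] by (simp add: power_divide power_mult_distrib mult.commute)
    also have "(\<integral>\<^sup>+z. ennreal (F z) * indicator (ball a r) z \<partial>lborel) \<le> ennreal (real (k + 1) * 2 ^ CARD('n) * \<omega>)"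
      using Suc.IH by (simp only: F_def \<omega>_def r_def)
    also have "ennreal (real (k + 1) * 2 ^ CARD('n) * \<omega>) + ennreal (2 ^ CARD('n) * \<omega>) = ennreal (real (Suc k + 1) * 2 ^ CARD('n) * \<omega>)"
      using \<omega> by (subst ennreal_plus[symmetric]) (auto simp: algebra_simps)
    finally show ?case by (simp add: F_def \<omega>_def r_def mult.assoc)
  }
qed

text \<open>By Tonelli and translation invariance, averaging over parallel segments
  does not see the direction \<open>h\<close>.\<close>

lemma nn_integral_segments:
  fixes F :: "'a::euclidean_space \<Rightarrow> ennreal" and h :: 'a
  assumes F: "F \<in> borel_measurable borel" and T: "0 \<le> T"
  shows "(\<integral>\<^sup>+y. (\<integral>\<^sup>+t. F (y + t *\<^sub>R h) * indicator {0..T} t \<partial>lborel) \<partial>lborel) = ennreal T * (\<integral>\<^sup>+z. F z \<partial>lborel)"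
proof -
  have m: "(\<lambda>(t::real, y). F (y + t *\<^sub>R h) * indicator {0..T} t) \<in> borel_measurable (lborel \<Otimes>\<^sub>M lborel)"
    using F by measurable
  have tr: "(\<integral>\<^sup>+y. F (y + c) \<partial>lborel) = (\<integral>\<^sup>+z. F z \<partial>lborel)" for c
  proof -
    have "(\<integral>\<^sup>+z. F z \<partial>lborel) = (\<integral>\<^sup>+z. F z \<partial>distr lborel borel ((+) c))" by (simp add: lborel_distr_plus)
    also have "\<dots> = (\<integral>\<^sup>+y. F (c + y) \<partial>lborel)" using F by (subst nn_integral_distr) auto
    finally show ?thesis by (simp add: add.commute)
  qed
  have "(\<integral>\<^sup>+y. (\<integral>\<^sup>+t. F (y + t *\<^sub>R h) * indicator {0..T} t \<partial>lborel) \<partial>lborel)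
     = (\<integral>\<^sup>+t. (\<integral>\<^sup>+y. F (y + t *\<^sub>R h) * indicator {0..T} t \<partial>lborel) \<partial>lborel)"
    using lborel_pair.Fubini[OF m] by simp
  also have "\<dots> = (\<integral>\<^sup>+t. (\<integral>\<^sup>+z. F z \<partial>lborel) * indicator {0..T} t \<partial>lborel)"
  proof (rule nn_integral_cong)
    fix t
    have "(\<lambda>y. F (y + t *\<^sub>R h)) \<in> borel_measurable lborel" using F by measurable
    then show "(\<integral>\<^sup>+y. F (y + t *\<^sub>R h) * indicator {0..T} t \<partial>lborel) = (\<integral>\<^sup>+z. F z \<partial>lborel) * indicator {0..T} t"
      by (simp add: nn_integral_multc tr)
  qed
  also have "\<dots> = ennreal T * (\<integral>\<^sup>+z. F z \<partial>lborel)"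
    using T by (simp add: nn_integral_cmult_indicator mult.commute)
  finally show ?thesis .
qed

lemma increment_le_nn_integral:
  fixes w w' a :: "real \<Rightarrow> real"
  assumes T: "0 \<le> T" and w: "\<And>t. t \<in> {0..T} \<Longrightarrow> (w has_real_derivative w' t) (at t)"
    and a: "continuous_on {0..T} a" and le: "\<And>t. t \<in> {0..T} \<Longrightarrow> \<bar>w' t\<bar> \<le> a t"
  shows "ennreal \<bar>w T - w 0\<bar> \<le> (\<integral>\<^sup>+t. ennreal (a t) * indicator {0..T} t \<partial>lborel)"
proof (cases "T = 0")
  case False
  then have T: "0 < T" using T by simp
  define A where "A t = integral {0..t} a" for t
  have Ad: "(A has_vector_derivative a t) (at t within {0..T})" if "t \<in> {0..T}" for t
    unfolding A_def by (rule integral_has_vector_derivative[OF a that])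
  have a0: "0 \<le> a t" if "t \<in> {0..T}" for t using le[OF that] by simp
  have "norm (w T - w 0) \<le> A T - A 0"
  proof (rule differentiable_bound_general[OF T])
    show "continuous_on {0..T} w"
      using w by (meson DERIV_isCont continuous_at_imp_continuous_on)
    show "continuous_on {0..T} A"
      using Ad by (meson continuous_on_eq_continuous_within has_vector_derivative_continuous)
    fix t assume t: "0 < t" "t < T"
    show "(w has_vector_derivative w' t) (at t)"
      using w[of t] t by (simp add: has_real_derivative_iff_has_vector_derivative)
    show "(A has_vector_derivative a t) (at t)"
      using Ad[of t] t at_within_Icc_at[of 0 t T] by simp
    show "norm (w' t) \<le> a t" using le[of t] t by simp
  qed
  then have "\<bar>w T - w 0\<bar> \<le> integral {0..T} a" by (simp add: A_def)
  moreover have "(\<integral>\<^sup>+t. ennreal (a t) * indicator {0..T} t \<partial>lborel) = ennreal (integral {0..T} a)"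
  proof -
    let ?f = "\<lambda>t. indicator {0..T} t * a t"
    have m: "?f \<in> borel_measurable borel"
      using borel_measurable_continuous_on_indicator[OF _ a] by simp
    have "(a has_integral integral {0..T} a) {0..T}"
      by (rule integrable_integral[OF integrable_continuous_interval[OF a]])
    have hi: "(?f has_integral integral {0..T} a) UNIV"
    proof -
      have "?f = (\<lambda>t. if t \<in> {0..T} then a t else 0)" by (auto simp: indicator_def)
      then show ?thesis
        using \<open>(a has_integral integral {0..T} a) {0..T}\<close> by (simp only: has_integral_restrict_UNIV)
    qed
    have "(\<integral>\<^sup>+t. ennreal (?f t) \<partial>lborel) = ennreal (integral {0..T} a)"
      by (rule nn_integral_has_integral_lborel[OF m _ hi]) (use a0 in \<open>auto simp: indicator_def\<close>)
    moreover have "ennreal (?f t) = ennreal (a t) * indicator {0..T} t" for t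
      by (simp add: indicator_def)
    ultimately show ?thesis by simp
  qed
  ultimately show ?thesis by (simp add: ennreal_leI)
qed simp

text \<open>A map that is flat to second order on \<open>C\<close> sends a piece of diameter \<open>1/N\<close> into a ball of
  radius of order \<open>1/N\<^sup>2\<close>. There are of the order \<open>N^n\<close> pieces, and the segment
  attached to each image is covered by of the order \<open>N\<^sup>2\<close> balls of that radius. The total volume is
  of the order \<open>N^(n + 2 - 2 * n)\<close>, which tends to zero exactly when \<open>n > 2\<close>.\<close>

lemma negligible_shadow:
  fixes \<theta> :: "real^'n \<Rightarrow> real^'n" and h :: "real^'n"
  assumes n: "3 \<le> CARD('n)" and C: "bounded C"
    and q: "\<And>x c. x \<in> C \<Longrightarrow> c \<in> C \<Longrightarrow> norm (\<theta> x - \<theta> c) \<le> M * (norm (x - c))\<^sup>2"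
  shows "negligible {\<theta> c - t *\<^sub>R h | c t. c \<in> C \<and> t \<in> {0..1::real}}"
proof -
  define n where "n = CARD('n)"
  obtain R where R: "R > 0" "\<And>x. x \<in> C \<Longrightarrow> norm x \<le> R" using C unfolding bounded_pos by blast
  define S where "S = {\<theta> c - t *\<^sub>R h | c t. c \<in> C \<and> t \<in> {0..1::real}}"
  define M' where "M' = \<bar>M\<bar>"
  define B where "B = M' * n\<^sup>2 + norm h"
  define D where "D = (2 * R + 4) ^ n * 2 * (unit_ball_vol n * B ^ n)"
  have B0: "0 \<le> B" by (simp add: B_def M'_def)
  have D0: "0 \<le> D" using R B0 by (simp add: D_def unit_ball_vol_nonneg)
  have cover: "\<exists>T. S \<subseteq> T \<and> T \<in> lmeasurable \<and> measure lebesgue T \<le> D / N" if N: "N \<ge> 1" for N :: nat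
  proof -
    \<comment> \<open>\<open>key\<close> names the grid cube of side \<open>1/N\<close> that contains the point\<close>
    define key where "key x = (\<lambda>i. \<lfloor>real N * x $ i\<rfloor>)" for x :: "real^'n"
    define I where "I = {- \<lceil>N * R\<rceil> - 1 .. \<lceil>N * R\<rceil>}"
    have keyI: "key ` C \<subseteq> PiE UNIV (\<lambda>_. I)"
    proof
      fix k assume "k \<in> key ` C"
      then obtain x where x: "x \<in> C" "k = key x" by blast
      have "\<lfloor>real N * x $ i\<rfloor> \<in> I" for i
      proof -
        have "\<bar>x $ i\<bar> \<le> R" using component_le_norm_cart[of x i] R(2)[OF x(1)] by linarith
        then have "\<bar>real N * x $ i\<bar> \<le> N * R" by (simp add: abs_mult mult_left_mono)
        then show ?thesis unfolding I_def by (simp add: abs_le_iff) linarith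
      qed
      then show "k \<in> PiE UNIV (\<lambda>_. I)" by (auto simp: x key_def)
    qed
    have finI: "finite (PiE (UNIV :: 'n set) (\<lambda>_. I))" by (intro finite_PiE) (auto simp: I_def)
    then have finK: "finite (key ` C)" using keyI finite_subset by blast
    have "card (key ` C) \<le> card (PiE (UNIV :: 'n set) (\<lambda>_. I))" by (rule card_mono[OF finI keyI])
    also have "\<dots> = card I ^ n" by (simp add: card_PiE n_def)
    finally have "real (card (key ` C)) \<le> real (card I) ^ n" by (metis of_nat_le_iff of_nat_power)
    moreover have "real (card I) \<le> N * (2 * R + 4)"
    proof -
      have pos: "0 \<le> real N * R" using R by simp
      then have "real (card I) = 2 * real_of_int \<lceil>N * R\<rceil> + 2"
        by (simp add: I_def)
      also have "\<dots> \<le> 2 * (real N * R + 1) + 2" by (intro add_right_mono mult_left_mono of_int_ceiling_le_add_one) simp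
      finally show ?thesis using N by (simp add: field_simps)
    qed
    ultimately have cardK: "real (card (key ` C)) \<le> (N * (2 * R + 4)) ^ n"
      by (meson of_nat_0_le_iff order_trans power_mono)
    define rep where "rep k = (SOME x. x \<in> C \<and> key x = k)" for k
    have rep: "rep k \<in> C" "key (rep k) = k" if "k \<in> key ` C" for k
      using that someI_ex[of "\<lambda>x. x \<in> C \<and> key x = k"] unfolding rep_def by blast+
    define \<rho> where "\<rho> = B / N\<^sup>2"
    have \<rho>0: "0 \<le> \<rho>" using B0 by (simp add: \<rho>_def)
    define T where "T = (\<Union>k\<in>key ` C. \<Union>j\<in>{..<N\<^sup>2}. cball (\<theta> (rep k) - (real j / N\<^sup>2) *\<^sub>R h) \<rho>)"
    have "S \<subseteq> T"
    proof
      fix z assume "z \<in> S"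
      then obtain c t where c: "c \<in> C" and t: "0 \<le> t" "t \<le> 1" and z: "z = \<theta> c - t *\<^sub>R h"
        unfolding S_def by auto
      define k where "k = key c"
      have k: "k \<in> key ` C" using c by (simp add: k_def)
      have "\<bar>(c - rep k) $ i\<bar> \<le> 1 / N" for i
      proof -
        have "\<lfloor>real N * c $ i\<rfloor> = \<lfloor>real N * rep k $ i\<rfloor>"
          using fun_cong[OF rep(2)[OF k], of i] by (simp add: k_def key_def)
        then have "\<bar>real N * c $ i - real N * rep k $ i\<bar> \<le> 1" by linarith
        moreover have "real N * \<bar>(c - rep k) $ i\<bar> = \<bar>real N * c $ i - real N * rep k $ i\<bar>"
          by (simp add: abs_mult right_diff_distrib[symmetric])
        ultimately have "real N * \<bar>(c - rep k) $ i\<bar> \<le> 1" by simp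
        then show ?thesis using N by (simp add: field_simps)
      qed
      then have "(\<Sum>i\<in>UNIV. \<bar>(c - rep k) $ i\<bar>) \<le> (\<Sum>i\<in>(UNIV::'n set). 1 / N)" by (intro sum_mono)
      then have nc: "norm (c - rep k) \<le> n / N"
        using norm_le_l1_cart[of "c - rep k"] by (simp add: n_def)
      have "norm (\<theta> c - \<theta> (rep k)) \<le> M * (norm (c - rep k))\<^sup>2" by (rule q[OF c rep(1)[OF k]])
      also have "\<dots> \<le> M' * (norm (c - rep k))\<^sup>2" by (rule mult_right_mono) (auto simp: M'_def)
      also have "\<dots> \<le> M' * (n / N)\<^sup>2" by (intro mult_left_mono power_mono nc) (auto simp: M'_def)
      finally have n1: "norm (\<theta> c - \<theta> (rep k)) \<le> M' * n\<^sup>2 / N\<^sup>2" by (simp add: power_divide)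
      obtain j where j: "j < N\<^sup>2" "\<bar>t - real j / N\<^sup>2\<bar> \<le> 1 / N\<^sup>2"
      proof (cases "t = 1")
        case True
        show ?thesis by (rule that[of "N\<^sup>2 - 1"]) (use N True in \<open>auto simp: field_simps of_nat_diff\<close>)
      next
        case False
        define j where "j = nat \<lfloor>t * real (N\<^sup>2)\<rfloor>"
        have jt: "real j \<le> t * real (N\<^sup>2)" "t * real (N\<^sup>2) < real j + 1"
          using t N by (auto simp: j_def)
        show ?thesis
        proof (rule that[of j])
          have "t * real (N\<^sup>2) < real (N\<^sup>2)" using False t N by simp
          then show "j < N\<^sup>2" using jt by linarith
          have "\<bar>t * real (N\<^sup>2) - real j\<bar> \<le> 1" using jt by linarith
          moreover have "t * real (N\<^sup>2) - real j = real (N\<^sup>2) * (t - real j / N\<^sup>2)"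
            using N by (simp add: field_simps)
          ultimately have "real (N\<^sup>2) * \<bar>t - real j / N\<^sup>2\<bar> \<le> 1"
            by (simp only: abs_mult abs_of_nat)
          then show "\<bar>t - real j / N\<^sup>2\<bar> \<le> 1 / N\<^sup>2" using N by (simp add: field_simps)
        qed
      qed
      have "norm ((\<theta> (rep k) - (real j / N\<^sup>2) *\<^sub>R h) - z) \<le> norm (\<theta> c - \<theta> (rep k)) + norm ((t - real j / N\<^sup>2) *\<^sub>R h)"
      proof -
        have "(\<theta> (rep k) - (real j / N\<^sup>2) *\<^sub>R h) - z = - (\<theta> c - \<theta> (rep k)) + (t - real j / N\<^sup>2) *\<^sub>R h"
          by (simp add: z algebra_simps)
        then show ?thesis by (metis norm_minus_cancel norm_triangle_ineq)
      qed
      also have "\<dots> \<le> M' * n\<^sup>2 / N\<^sup>2 + (1 / N\<^sup>2) * norm h"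
        using n1 mult_right_mono[OF j(2), of "norm h"] by simp
      also have "\<dots> = \<rho>" by (simp add: \<rho>_def B_def add_divide_distrib)
      finally have "z \<in> cball (\<theta> (rep k) - (real j / N\<^sup>2) *\<^sub>R h) \<rho>" by (simp add: dist_norm)
      then show "z \<in> T" using k j by (auto simp: T_def)
    qed
    moreover have "T \<in> lmeasurable" unfolding T_def
      by (intro fmeasurable.finite_UN finK) auto
    moreover have "measure lebesgue T \<le> D / N"
    proof -
      have mc: "measure lebesgue (cball c \<rho>) = unit_ball_vol n * \<rho> ^ n" for c :: "real^'n"
        using content_cball[OF \<rho>0, of c] by (simp add: n_def)
      have "measure lebesgue T \<le> (\<Sum>k\<in>key ` C. measure lebesgue (\<Union>j\<in>{..<N\<^sup>2}. cball (\<theta> (rep k) - (real j / N\<^sup>2) *\<^sub>R h) \<rho>))"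
        unfolding T_def by (intro measure_UNION_le finK) auto
      also have "\<dots> \<le> (\<Sum>k\<in>key ` C. \<Sum>j<N\<^sup>2. measure lebesgue (cball (\<theta> (rep k) - (real j / N\<^sup>2) *\<^sub>R h) \<rho>))"
        by (intro sum_mono measure_UNION_le) auto
      also have "\<dots> = card (key ` C) * (real (N\<^sup>2) * (unit_ball_vol n * \<rho> ^ n))"
        by (simp add: mc)
      also have "\<dots> \<le> (N * (2 * R + 4)) ^ n * (real (N\<^sup>2) * (unit_ball_vol n * \<rho> ^ n))"
        by (rule mult_right_mono[OF cardK]) (simp add: \<rho>0 unit_ball_vol_nonneg)
      also have "\<dots> \<le> D / N"
      proof -
        have N0: "real N > 0" using N by simp
        have "(real N * E) ^ n * (real (N\<^sup>2) * (v * \<rho> ^ n))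
            = E ^ n * (v * B ^ n) * (real N ^ (n + 2) / real N ^ (2 * n))" for E v :: real
        proof -
          have "\<rho> ^ n = B ^ n / real N ^ (2 * n)" by (simp add: \<rho>_def power_divide power_mult)
          moreover have "real N ^ (n + 2) = real N ^ n * real (N\<^sup>2)" by (simp add: power_add power2_eq_square)
          ultimately show ?thesis
            by (simp add: power_mult_distrib power2_eq_square)
        qed
        then have "(N * (2 * R + 4)) ^ n * (real (N\<^sup>2) * (unit_ball_vol n * \<rho> ^ n))
            = (2 * R + 4) ^ n * (unit_ball_vol n * B ^ n) * (real N ^ (n + 2) / real N ^ (2 * n))" .
        also have "real N ^ (n + 2) / real N ^ (2 * n) \<le> 1 / N"
        proof -
          have "real N ^ (n + 3) \<le> real N ^ (2 * n)"
            by (rule power_increasing) (use n N in \<open>auto simp: n_def\<close>)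
          then show ?thesis using N0 by (simp add: field_simps power_add numeral_eq_Suc)
        qed
        also have "(2 * R + 4) ^ n * (unit_ball_vol n * B ^ n) * (1 / N) \<le> D / N"
          using R B0 N0 by (simp add: D_def unit_ball_vol_nonneg field_simps)
        finally show ?thesis using R B0 by (simp add: mult_left_mono unit_ball_vol_nonneg)
      qed
      finally show ?thesis .
    qed
    ultimately show ?thesis by blast
  qed
  show ?thesis unfolding S_def[symmetric] negligible_outer_le
  proof (intro allI impI)
    fix e :: real assume e: "e > 0"
    obtain N :: nat where N: "real N > max 1 (D / e)" using reals_Archimedean2 by blast
    then obtain T where T: "S \<subseteq> T" "T \<in> lmeasurable" "measure lebesgue T \<le> D / N" using cover[of N] by auto
    have "D / N \<le> e" using N e by (simp add: field_simps)
    then show "\<exists>T. S \<subseteq> T \<and> T \<in> lmeasurable \<and> measure lebesgue T \<le> e" using T by (meson order_trans)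
  qed
qed

section \<open>Domains with continuously differentiable boundary\<close>

text \<open>The derivative is uniformly continuous on the compact convex ball, which makes
  first order Taylor expansion uniform up to the boundary.\<close>

lemma C1_on_cball_uniform:
  fixes \<Phi> :: "real^'n \<Rightarrow> real^'n" and \<Phi>' :: "real^'n \<Rightarrow> (real^'n) \<Rightarrow>\<^sub>L (real^'n)"
  assumes d: "\<And>x. x \<in> cball 0 1 \<Longrightarrow> (\<Phi> has_derivative \<Phi>' x) (at x within cball 0 1)"
    and c: "continuous_on (cball 0 1) \<Phi>'" and e: "0 < e"
  obtains \<delta> where "0 < \<delta>"
    "\<And>x y. x \<in> cball 0 1 \<Longrightarrow> y \<in> cball 0 1 \<Longrightarrow> norm (y - x) < \<delta> \<Longrightarrow>
       norm (\<Phi> y - \<Phi> x - \<Phi>' x (y - x)) \<le> e * norm (y - x)"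
proof -
  obtain \<delta> where \<delta>: "0 < \<delta>" "\<And>x y. x \<in> cball 0 1 \<Longrightarrow> y \<in> cball 0 1 \<Longrightarrow> dist y x < \<delta> \<Longrightarrow> dist (\<Phi>' y) (\<Phi>' x) < e"
    using compact_uniformly_continuous[OF c compact_cball] e unfolding uniformly_continuous_on_def by metis
  show ?thesis
  proof (rule that[OF \<delta>(1)])
    fix x y :: "real^'n" assume xy: "x \<in> cball 0 1" "y \<in> cball 0 1" "norm (y - x) < \<delta>"
    have cv: "convex (cball 0 1 \<inter> ball x \<delta>)" by (intro convex_Int convex_cball convex_ball)
    have xS: "x \<in> cball 0 1 \<inter> ball x \<delta>" and yS: "y \<in> cball 0 1 \<inter> ball x \<delta>"
      using xy \<delta>(1) by (auto simp: dist_norm norm_minus_commute)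
    have seg: "x + t *\<^sub>R (y - x) \<in> cball 0 1 \<inter> ball x \<delta>" if "t \<in> {0..1}" for t
      using convexD_alt[OF cv xS yS, of t] that by (simp add: algebra_simps)
    have dw: "(\<Phi> has_derivative \<Phi>' z) (at z within cball 0 1 \<inter> ball x \<delta>)" if "z \<in> cball 0 1 \<inter> ball x \<delta>" for z
      using d[of z] that has_derivative_subset by blast
    have on: "onorm (blinfun_apply (\<Phi>' z) - blinfun_apply (\<Phi>' x)) \<le> e" if "z \<in> cball 0 1 \<inter> ball x \<delta>" for z
    proof -
      have "norm (\<Phi>' z - \<Phi>' x) \<le> e"
        using \<delta>(2)[of x z] that xy by (simp add: dist_norm norm_minus_commute less_imp_le)
      moreover have "norm (\<Phi>' z - \<Phi>' x) = onorm (blinfun_apply (\<Phi>' z) - blinfun_apply (\<Phi>' x))"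
        by (simp add: norm_blinfun.rep_eq minus_blinfun.rep_eq fun_diff_def)
      ultimately show ?thesis by simp
    qed
    show "norm (\<Phi> y - \<Phi> x - \<Phi>' x (y - x)) \<le> e * norm (y - x)"
      using differentiable_bound_linearization[OF seg dw on xS] by (simp add: mult.commute)
  qed
qed

text \<open>The inverse chart is differentiable only within the closure of \<open>\<Omega>\<close>, which need not be
  convex, so its Lipschitz bound is obtained on the side of the ball. There the derivative of \<open>\<Phi>\<close> is bounded
  below, in the interior by the chain rule and on the sphere by continuity; this settles nearby points,
  and compactness settles distant ones.\<close>

lemma C1_domain_chart:
  fixes \<Omega> :: "(real^'n) set"
  assumes dom: "has_C1_boundary \<Omega>" and op: "open \<Omega>"
  obtains \<Phi> \<Psi> :: "real^'n \<Rightarrow> real^'n" and \<Phi>' \<Psi>' :: "real^'n \<Rightarrow> (real^'n) \<Rightarrow>\<^sub>L (real^'n)" and L :: real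
  where "homeomorphism (cball 0 1) (closure \<Omega>) \<Phi> \<Psi>" "\<Phi> ` ball 0 1 = \<Omega>" "1 \<le> L"
    "\<And>x. x \<in> cball 0 1 \<Longrightarrow> (\<Phi> has_derivative \<Phi>' x) (at x within cball 0 1)"
    "continuous_on (cball 0 1) \<Phi>'" "\<And>x. x \<in> cball 0 1 \<Longrightarrow> norm (\<Phi>' x) \<le> L"
    "\<And>p. p \<in> \<Omega> \<Longrightarrow> (\<Psi> has_derivative \<Psi>' p) (at p)" "\<And>p. p \<in> \<Omega> \<Longrightarrow> norm (\<Psi>' p) \<le> L"
    "\<And>x y. x \<in> cball 0 1 \<Longrightarrow> y \<in> cball 0 1 \<Longrightarrow> norm (\<Phi> x - \<Phi> y) \<le> L * norm (x - y)"
    "\<And>x y. x \<in> cball 0 1 \<Longrightarrow> y \<in> cball 0 1 \<Longrightarrow> norm (x - y) \<le> L * norm (\<Phi> x - \<Phi> y)"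
proof -
  obtain \<Phi> \<Psi> :: "real^'n \<Rightarrow> real^'n"
    where hom: "homeomorphism (cball 0 1) (closure \<Omega>) \<Phi> \<Psi>" and im: "\<Phi> ` ball 0 1 = \<Omega>"
    and c1: "C1_on (cball 0 1) \<Phi>" and c2: "C1_on (closure \<Omega>) \<Psi>"
    using dom unfolding has_C1_boundary_def C1_diffeomorphism_def by blast
  obtain \<Phi>' where \<Phi>': "\<And>x. x \<in> cball 0 1 \<Longrightarrow> (\<Phi> has_derivative blinfun_apply (\<Phi>' x)) (at x within cball 0 1)"
    and c\<Phi>': "continuous_on (cball 0 1) \<Phi>'"
    using c1 unfolding C1_on_def by blast
  obtain \<Psi>' where \<Psi>': "\<And>x. x \<in> closure \<Omega> \<Longrightarrow> (\<Psi> has_derivative blinfun_apply (\<Psi>' x)) (at x within closure \<Omega>)"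
    and c\<Psi>': "continuous_on (closure \<Omega>) \<Psi>'"
    using c2 unfolding C1_on_def by blast
  have c\<Phi>: "continuous_on (cball 0 1) \<Phi>" and img: "\<Phi> ` cball 0 1 = closure \<Omega>"
    and \<Psi>\<Phi>: "\<And>x. x \<in> cball 0 1 \<Longrightarrow> \<Psi> (\<Phi> x) = x"
    using hom by (auto simp: homeomorphism_def)
  have cpt: "compact (closure \<Omega>)" using compact_continuous_image[OF c\<Phi> compact_cball] img by simp
  obtain L0 where L0: "\<And>x. x \<in> cball 0 1 \<Longrightarrow> norm (\<Phi>' x) \<le> L0"
    using compact_imp_bounded[OF compact_continuous_image[OF c\<Phi>' compact_cball]]
    unfolding bounded_iff by blast
  obtain L1 where L1: "\<And>x. x \<in> closure \<Omega> \<Longrightarrow> norm (\<Psi>' x) \<le> L1"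
    using compact_imp_bounded[OF compact_continuous_image[OF c\<Psi>' cpt]]
    unfolding bounded_iff by blast
  define L2 where "L2 = max 1 L1"
  have L2: "1 \<le> L2" "\<And>x. x \<in> closure \<Omega> \<Longrightarrow> norm (\<Psi>' x) \<le> L2"
    using L1 by (auto simp: L2_def intro: max.coboundedI2)
  have \<Psi>d: "(\<Psi> has_derivative \<Psi>' p) (at p)" if "p \<in> \<Omega>" for p
  proof -
    have "(\<Psi> has_derivative \<Psi>' p) (at p within \<Omega>)"
      by (rule has_derivative_subset[OF \<Psi>' closure_subset]) (use that closure_subset in auto)
    then show ?thesis by (simp only: at_within_open[OF that op])
  qed
  have lipU: "norm (\<Phi> x - \<Phi> y) \<le> L0 * norm (x - y)" if "x \<in> cball 0 1" "y \<in> cball 0 1" for x y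
  proof (rule differentiable_bound[OF convex_cball \<Phi>' _ that])
    show "onorm (blinfun_apply (\<Phi>' z)) \<le> L0" if "z \<in> cball 0 1" for z
      using L0[OF that] by (simp only: norm_blinfun.rep_eq)
  qed
  have lower: "norm h \<le> L2 * norm (\<Phi>' x h)" if x: "x \<in> cball 0 1" for x h
  proof -
    have inner: "norm h \<le> L2 * norm (\<Phi>' y h)" if y: "y \<in> ball 0 1" for y
    proof -
      have "(\<Phi> has_derivative \<Phi>' y) (at y within ball 0 1)"
        by (rule has_derivative_subset[OF \<Phi>' ball_subset_cball]) (use y in auto)
      then have dy: "(\<Phi> has_derivative \<Phi>' y) (at y)" by (simp only: at_within_open[OF y open_ball])
      have "\<Phi> y \<in> \<Omega>" using im y by blast
      from diff_chain_at[OF dy \<Psi>d[OF this]]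
      have "((\<lambda>z. z) has_derivative (\<Psi>' (\<Phi> y) \<circ> \<Phi>' y)) (at y)"
      proof (rule has_derivative_transform_within_open[OF _ open_ball y])
        show "(\<Psi> \<circ> \<Phi>) z = z" if "z \<in> ball 0 1" for z using \<Psi>\<Phi>[of z] that by simp
      qed
      then have "blinfun_apply (\<Psi>' (\<Phi> y)) \<circ> blinfun_apply (\<Phi>' y) = (\<lambda>z. z)"
        using has_derivative_unique has_derivative_ident by blast
      then have "h = \<Psi>' (\<Phi> y) (\<Phi>' y h)" by (metis comp_apply)
      then have "norm h \<le> norm (\<Psi>' (\<Phi> y)) * norm (\<Phi>' y h)" by (metis norm_blinfun)
      also have "\<dots> \<le> L2 * norm (\<Phi>' y h)"
        using L2(2)[of "\<Phi> y"] \<open>\<Phi> y \<in> \<Omega>\<close> closure_subset by (intro mult_right_mono) auto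
      finally show ?thesis .
    qed
    have cl: "closedin (top_of_set (cball 0 1)) {y \<in> cball 0 1. norm h \<le> L2 * norm (\<Phi>' y h)}"
      using continuous_closedin_preimage_constant
      by (intro continuous_on_closed_Collect_le closed_subset) (auto intro!: continuous_intros c\<Phi>' closed_cball) 
    have "closure (ball 0 1) \<subseteq> {y \<in> cball 0 1. norm h \<le> L2 * norm (\<Phi>' y h)}"
    proof (rule closure_minimal)
      show "closed {y \<in> cball 0 1. norm h \<le> L2 * norm (\<Phi>' y h)}"
        using closedin_closed_trans[OF cl closed_cball] .
    qed (use inner in auto)
    then show ?thesis using x by auto
  qed
  define e where "e = 1 / (2 * L2)"
  have e: "0 < e" using L2 by (simp add: e_def)
  obtain \<delta> where \<delta>: "0 < \<delta>"
    "\<And>x y. x \<in> cball 0 1 \<Longrightarrow> y \<in> cball 0 1 \<Longrightarrow> norm (y - x) < \<delta> \<Longrightarrow>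
       norm (\<Phi> y - \<Phi> x - \<Phi>' x (y - x)) \<le> e * norm (y - x)"
    using C1_on_cball_uniform[OF \<Phi>' c\<Phi>' e] by metis
  have near: "norm (y - x) \<le> 2 * L2 * norm (\<Phi> y - \<Phi> x)"
    if "x \<in> cball 0 1" "y \<in> cball 0 1" "norm (y - x) < \<delta>" for x y
  proof -
    have "norm (y - x) \<le> L2 * norm (\<Phi>' x (y - x))" by (rule lower[OF that(1)])
    also have "norm (\<Phi>' x (y - x)) \<le> norm (\<Phi> y - \<Phi> x) + e * norm (y - x)"
      using \<delta>(2)[OF that] norm_triangle_sub[of "\<Phi>' x (y - x)" "\<Phi> y - \<Phi> x"] by (simp add: norm_minus_commute)
    finally have "norm (y - x) \<le> L2 * (norm (\<Phi> y - \<Phi> x) + e * norm (y - x))" using L2 by simp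
    also have "\<dots> = L2 * norm (\<Phi> y - \<Phi> x) + norm (y - x) / 2"
      using L2 by (simp add: e_def distrib_left)
    finally show ?thesis by simp
  qed
  \<comment> \<open>points at distance at least \<open>\<delta>\<close> form a compact set of pairs on which the injective \<open>\<Phi>\<close> separates\<close>
  obtain \<mu> where \<mu>: "0 < \<mu>" "\<And>x y. x \<in> cball 0 1 \<Longrightarrow> y \<in> cball 0 1 \<Longrightarrow> \<delta> \<le> norm (y - x) \<Longrightarrow> \<mu> \<le> norm (\<Phi> y - \<Phi> x)"
  proof -
    define S where "S = (cball 0 1 \<times> cball 0 1) \<inter> {z :: (real^'n) \<times> (real^'n). \<delta> \<le> norm (snd z - fst z)}"
    have "closed {z :: (real^'n) \<times> (real^'n). \<delta> \<le> norm (snd z - fst z)}"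
      by (intro closed_Collect_le continuous_intros)
    then have S: "compact S" unfolding S_def by (intro compact_Int_closed compact_Times compact_cball)
    have cS: "continuous_on S (\<lambda>z. norm (\<Phi> (snd z) - \<Phi> (fst z)))"
      by (intro continuous_intros continuous_on_compose2[OF c\<Phi>]) (auto simp: S_def)
    have mem: "(x, y) \<in> S" if "x \<in> cball 0 1" "y \<in> cball 0 1" "\<delta> \<le> norm (y - x)" for x y
      using that by (simp add: S_def)
    show ?thesis
    proof (cases "S = {}")
      case True
      show ?thesis by (rule that[of 1], simp, metis True empty_iff mem)
    next
      case False
      then obtain z where z: "z \<in> S" "\<And>w. w \<in> S \<Longrightarrow> norm (\<Phi> (snd z) - \<Phi> (fst z)) \<le> norm (\<Phi> (snd w) - \<Phi> (fst w))"
        using continuous_attains_inf[OF S False cS] by blast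
      have "\<Phi> (snd z) \<noteq> \<Phi> (fst z)"
      proof
        assume "\<Phi> (snd z) = \<Phi> (fst z)"
        then have "\<Psi> (\<Phi> (snd z)) = \<Psi> (\<Phi> (fst z))" by simp
        moreover have "fst z \<in> cball 0 1" "snd z \<in> cball 0 1"
          using z(1) by (simp_all add: S_def mem_Times_iff)
        ultimately have "snd z = fst z" by (simp only: \<Psi>\<Phi>)
        then show False using z(1) \<delta>(1) by (simp add: S_def)
      qed
      then show ?thesis
        using z(2)[OF mem] by (intro that[of "norm (\<Phi> (snd z) - \<Phi> (fst z))"]) auto
    qed
  qed
  have lipL: "norm (x - y) \<le> max (2 * L2) (2 / \<mu>) * norm (\<Phi> x - \<Phi> y)" if xy: "x \<in> cball 0 1" "y \<in> cball 0 1" for x y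
  proof (cases "norm (x - y) < \<delta>")
    case True
    have "norm (x - y) \<le> 2 * L2 * norm (\<Phi> x - \<Phi> y)" using near[of y x] True xy by simp
    also have "\<dots> \<le> max (2 * L2) (2 / \<mu>) * norm (\<Phi> x - \<Phi> y)" by (intro mult_right_mono) auto
    finally show ?thesis .
  next
    case False
    have "norm (x - y) \<le> 2" using norm_triangle_ineq4[of x y] xy by simp
    also have "2 \<le> (2 / \<mu>) * norm (\<Phi> x - \<Phi> y)" using \<mu>(2)[of y x] \<mu>(1) False xy by (simp add: field_simps)
    also have "\<dots> \<le> max (2 * L2) (2 / \<mu>) * norm (\<Phi> x - \<Phi> y)" by (intro mult_right_mono) auto
    finally show ?thesis .
  qed
  define L where "L = max L0 (max (2 * L2) (2 / \<mu>))"
  show ?thesis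
  proof (rule that[OF hom im _ \<Phi>' c\<Phi>' _ \<Psi>d])
    show "1 \<le> L" using L2 by (simp add: L_def)
    show "norm (\<Phi>' x) \<le> L" if "x \<in> cball 0 1" for x using L0[OF that] by (simp add: L_def)
    show "norm (\<Psi>' p) \<le> L" if "p \<in> \<Omega>" for p
      using L2(2)[of p] L2(1) that closure_subset[of \<Omega>] by (auto simp: L_def)
    show "norm (\<Phi> x - \<Phi> y) \<le> L * norm (x - y)" if "x \<in> cball 0 1" "y \<in> cball 0 1" for x y
      using lipU[OF that] mult_right_mono[of L0 L "norm (x - y)"] by (simp add: L_def)
    show "norm (x - y) \<le> L * norm (\<Phi> x - \<Phi> y)" if "x \<in> cball 0 1" "y \<in> cball 0 1" for x y
      using lipL[OF that] mult_right_mono[of "max (2 * L2) (2 / \<mu>)" L "norm (\<Phi> x - \<Phi> y)"] by (simp add: L_def)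
  qed
qed

text \<open>The unit vector \<open>v\<close> is a normal of the image of the tangent hyperplane under the
  derivative of the chart. A chord of the sphere is tangential up to a radial part that is quadratic in
  its length, so the image of a short chord has only a small component along \<open>v\<close>.\<close>

lemma C1_boundary_flat:
  fixes \<Omega> :: "(real^'n) set"
  assumes dom: "has_C1_boundary \<Omega>" and op: "open \<Omega>" and e: "0 < e"
  obtains \<rho> where "0 < \<rho>"
    "\<And>q. q \<in> frontier \<Omega> \<Longrightarrow> \<exists>v. norm v = 1 \<and>
       (\<forall>p\<in>frontier \<Omega>. norm (p - q) < \<rho> \<longrightarrow> \<bar>(p - q) \<bullet> v\<bar> \<le> e * norm (p - q))"
proof -
  obtain \<Phi> \<Psi> :: "real^'n \<Rightarrow> real^'n" and \<Phi>' \<Psi>' :: "real^'n \<Rightarrow> (real^'n) \<Rightarrow>\<^sub>L (real^'n)" and L :: real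
    where hom: "homeomorphism (cball 0 1) (closure \<Omega>) \<Phi> \<Psi>" and im: "\<Phi> ` ball 0 1 = \<Omega>" and L: "1 \<le> L"
    and \<Phi>': "\<And>x. x \<in> cball 0 1 \<Longrightarrow> (\<Phi> has_derivative blinfun_apply (\<Phi>' x)) (at x within cball 0 1)"
    and c\<Phi>': "continuous_on (cball 0 1) \<Phi>'" and n\<Phi>': "\<And>x. x \<in> cball 0 1 \<Longrightarrow> norm (\<Phi>' x) \<le> L"
    and lip: "\<And>x y. x \<in> cball 0 1 \<Longrightarrow> y \<in> cball 0 1 \<Longrightarrow> norm (x - y) \<le> L * norm (\<Phi> x - \<Phi> y)"
    by (rule C1_domain_chart[OF dom op]) (rule that; assumption)
  have img: "\<Phi> ` cball 0 1 = closure \<Omega>" using hom by (auto simp: homeomorphism_def)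
  have fr: "frontier \<Omega> \<subseteq> \<Phi> ` sphere 0 1"
  proof
    fix p assume "p \<in> frontier \<Omega>"
    then have "p \<in> closure \<Omega>" "p \<notin> \<Omega>" using op by (auto simp: frontier_def interior_open)
    then obtain x where "x \<in> cball 0 1" "p = \<Phi> x" "x \<notin> ball 0 1" using img im by blast
    then show "p \<in> \<Phi> ` sphere 0 1" by auto
  qed
  define e1 where "e1 = e / (2 * L)"
  have e1: "0 < e1" using e L by (simp add: e1_def)
  obtain \<delta> where \<delta>: "0 < \<delta>"
    "\<And>x y. x \<in> cball 0 1 \<Longrightarrow> y \<in> cball 0 1 \<Longrightarrow> norm (y - x) < \<delta> \<Longrightarrow>
       norm (\<Phi> y - \<Phi> x - \<Phi>' x (y - x)) \<le> e1 * norm (y - x)"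
    using C1_on_cball_uniform[OF \<Phi>' c\<Phi>' e1] by metis
  define \<rho> where "\<rho> = min \<delta> (2 * e1 / L) / L"
  have \<rho>: "0 < \<rho>" using \<delta>(1) e1 L by (simp add: \<rho>_def)
  show ?thesis
  proof (rule that[OF \<rho>])
    fix q assume "q \<in> frontier \<Omega>"
    then obtain \<xi> where \<xi>: "norm \<xi> = 1" "q = \<Phi> \<xi>" using fr by auto
    have \<xi>c: "\<xi> \<in> cball 0 1" using \<xi> by simp
    have \<xi>\<xi>: "\<xi> \<bullet> \<xi> = 1" using \<xi> by (simp add: dot_square_norm)
    define H where "H = {k. \<xi> \<bullet> k = 0}"
    have "dim (\<Phi>' \<xi> ` H) \<le> dim H"
      by (rule dim_image_le) (rule bounded_linear.linear[OF blinfun.bounded_linear_right])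
    also have "dim H < DIM(real^'n)"
      unfolding H_def using \<xi> by (subst dim_hyperplane) auto
    finally obtain v0 where v0: "v0 \<noteq> 0" "\<And>y. y \<in> span (\<Phi>' \<xi> ` H) \<Longrightarrow> orthogonal v0 y"
      using orthogonal_to_subspace_exists by blast
    define v where "v = (1 / norm v0) *\<^sub>R v0"
    have nv: "norm v = 1" using v0 by (simp add: v_def)
    have vH: "\<Phi>' \<xi> k \<bullet> v = 0" if "\<xi> \<bullet> k = 0" for k
      using v0(2)[of "\<Phi>' \<xi> k"] that span_superset by (auto simp: v_def H_def orthogonal_def inner_commute span_base)
    show "\<exists>v. norm v = 1 \<and> (\<forall>p\<in>frontier \<Omega>. norm (p - q) < \<rho> \<longrightarrow> \<bar>(p - q) \<bullet> v\<bar> \<le> e * norm (p - q))"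
    proof (intro exI[of _ v] conjI ballI impI)
      show "norm v = 1" by (rule nv)
      fix p assume "p \<in> frontier \<Omega>" and pq: "norm (p - q) < \<rho>"
      then obtain \<eta> where \<eta>: "norm \<eta> = 1" "p = \<Phi> \<eta>" using fr by auto
      have \<eta>c: "\<eta> \<in> cball 0 1" using \<eta> by simp
      have \<eta>\<eta>: "\<eta> \<bullet> \<eta> = 1" using \<eta> by (simp add: dot_square_norm)
      define r where "r = norm (\<eta> - \<xi>)"
      have rle: "r \<le> L * norm (p - q)" using lip[OF \<eta>c \<xi>c] by (simp add: r_def \<eta> \<xi>)
      also have "\<dots> < L * \<rho>" using pq L by simp
      finally have r: "r < \<delta>" "r < 2 * e1 / L" using L by (auto simp: \<rho>_def)
      \<comment> \<open>\<open>s\<close> is the radial part of the chord from \<open>\<xi>\<close> to \<open>\<eta>\<close>, and \<open>k\<close> its tangential part\<close>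
      define s where "s = r\<^sup>2 / 2"
      define k where "k = (\<eta> - \<xi>) + s *\<^sub>R \<xi>"
      have "r\<^sup>2 = 2 - 2 * (\<eta> \<bullet> \<xi>)"
        unfolding r_def power2_norm_eq_inner
        by (simp add: inner_diff_left inner_diff_right inner_commute[of \<xi> \<eta>] \<xi>\<xi> \<eta>\<eta>)
      then have "\<xi> \<bullet> k = 0"
        by (simp add: k_def s_def inner_add_right inner_diff_right \<xi>\<xi> inner_commute diff_divide_distrib)
      then have "\<Phi>' \<xi> k \<bullet> v = 0" by (rule vH)
      then have "\<Phi>' \<xi> (\<eta> - \<xi>) \<bullet> v = - s * (\<Phi>' \<xi> \<xi> \<bullet> v)"
        by (simp add: k_def blinfun.add_right blinfun.scaleR_right inner_add_left)
      moreover have "\<bar>\<Phi>' \<xi> \<xi> \<bullet> v\<bar> \<le> L"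
      proof -
        have "\<bar>\<Phi>' \<xi> \<xi> \<bullet> v\<bar> \<le> norm (\<Phi>' \<xi> \<xi>) * norm v" by (rule Cauchy_Schwarz_ineq2)
        also have "\<dots> \<le> norm (\<Phi>' \<xi>)" using norm_blinfun[of "\<Phi>' \<xi>" \<xi>] nv \<xi> by simp
        finally show ?thesis using n\<Phi>'[OF \<xi>c] by simp
      qed
      ultimately have "\<bar>\<Phi>' \<xi> (\<eta> - \<xi>) \<bullet> v\<bar> \<le> s * L"
        by (simp add: abs_mult s_def mult_left_mono)
      also have "\<dots> = r * (r * L / 2)" by (simp add: s_def power2_eq_square)
      also have "\<dots> \<le> r * e1"
      proof (rule mult_left_mono)
        show "r * L / 2 \<le> e1" using r(2) L by (simp add: field_simps)
        show "0 \<le> r" by (simp add: r_def)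
      qed
      finally have t1: "\<bar>\<Phi>' \<xi> (\<eta> - \<xi>) \<bullet> v\<bar> \<le> e1 * r" by (simp add: mult.commute)
      have t2: "\<bar>(\<Phi> \<eta> - \<Phi> \<xi> - \<Phi>' \<xi> (\<eta> - \<xi>)) \<bullet> v\<bar> \<le> e1 * r"
        using Cauchy_Schwarz_ineq2[of "\<Phi> \<eta> - \<Phi> \<xi> - \<Phi>' \<xi> (\<eta> - \<xi>)" v] \<delta>(2)[OF \<xi>c \<eta>c] r(1) nv
        by (simp add: r_def)
      have "(p - q) \<bullet> v = \<Phi>' \<xi> (\<eta> - \<xi>) \<bullet> v + (\<Phi> \<eta> - \<Phi> \<xi> - \<Phi>' \<xi> (\<eta> - \<xi>)) \<bullet> v"
        by (simp add: \<eta> \<xi> inner_diff_left)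
      then have "\<bar>(p - q) \<bullet> v\<bar> \<le> 2 * e1 * r" using t1 t2 by linarith
      also have "\<dots> \<le> 2 * e1 * (L * norm (p - q))" using rle e1 by (intro mult_left_mono) auto
      also have "\<dots> = e * norm (p - q)" using L by (simp add: e1_def)
      finally show "\<bar>(p - q) \<bullet> v\<bar> \<le> e * norm (p - q)" .
    qed
  qed
qed

section \<open>Harmonic quasiconformal mappings of the ball\<close>

lemma ball_subset_unit_ball: "x \<in> ball 0 1 \<Longrightarrow> r \<le> 1 - norm x \<Longrightarrow> ball x r \<subseteq> (ball 0 1 :: (real^'n) set)"
proof
  fix z assume "r \<le> 1 - norm x" "z \<in> ball x r"
  then show "z \<in> ball 0 1"
    using norm_triangle_ineq2[of z x] by (simp add: dist_norm norm_minus_commute)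
qed

text \<open>The number \<open>Q\<close> serves only to say that the derivative is bounded; the constants in the uniform
  estimates below do not involve it. The derivative may vanish at some points, so the distortion
  inequality is stated for the derivative itself rather than for its inverse.\<close>

locale harmonic_qc =
  fixes \<Omega> :: "(real^'n) set" and f g :: "real^'n \<Rightarrow> real^'n" and f' :: "real^'n \<Rightarrow> real^'n \<Rightarrow> real^'n"
    and K Q :: real
  assumes open_image: "open \<Omega>" and hom: "homeomorphism (ball 0 1) \<Omega> f g"
    and harm: "harmonic_with_derivative (ball 0 1) f f'"
    and K: "1 \<le> K"
    and qc: "\<And>x h. x \<in> ball 0 1 \<Longrightarrow> onorm (f' x) * norm h \<le> K * norm (f' x h)"
    and Q: "\<And>x. x \<in> ball 0 1 \<Longrightarrow> onorm (f' x) \<le> Q"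
begin

abbreviation G :: "real^'n \<Rightarrow> real" where "G x \<equiv> onorm (f' x)"

lemma deriv: "x \<in> ball 0 1 \<Longrightarrow> (f has_derivative f' x) (at x)"
  using harm by (auto simp: harmonic_with_derivative_def)

lemma deriv_bl: "x \<in> ball 0 1 \<Longrightarrow> bounded_linear (f' x)"
  using deriv has_derivative_bounded_linear by blast

lemma G_bound: "x \<in> ball 0 1 \<Longrightarrow> norm (f' x h) \<le> G x * norm h"
  by (rule onorm[OF deriv_bl])

lemma G_nonneg: "x \<in> ball 0 1 \<Longrightarrow> 0 \<le> G x"
  by (rule onorm_pos_le[OF deriv_bl])

lemma f_im: "f ` ball 0 1 = \<Omega>" and g_im: "g ` \<Omega> = ball 0 1"
  and gf: "x \<in> ball 0 1 \<Longrightarrow> g (f x) = x" and fg: "y \<in> \<Omega> \<Longrightarrow> f (g y) = y"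
  and f_cont: "continuous_on (ball 0 1) f" and g_cont: "continuous_on \<Omega> g"
  using hom by (auto simp: homeomorphism_def)

lemma f_inj: "inj_on f (ball 0 1)"
  by (metis gf inj_onI)

lemma harm_sub: "U \<subseteq> ball 0 1 \<Longrightarrow> harmonic_with_derivative U f f'"
  using harm by (auto simp: harmonic_with_derivative_def)

lemma derivative_inj:
  assumes x: "x \<in> ball 0 1" and G: "0 < G x"
  shows "inj (f' x)"
proof (rule injI)
  fix k l assume "f' x k = f' x l"
  then have "f' x (k - l) = 0"
    by (simp add: linear_diff[OF bounded_linear.linear[OF deriv_bl[OF x]]])
  then have "G x * norm (k - l) \<le> 0" using qc[OF x, of "k - l"] by simp
  then show "k = l" using G by (simp add: mult_le_0_iff)
qed

lemma Q_bound: "x \<in> ball 0 1 \<Longrightarrow> norm (f' x h) \<le> Q * norm h"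
  using G_bound[of x h] mult_right_mono[OF Q norm_ge_zero, of x h] by linarith

lemma G_local_lipschitz:
  assumes x: "x \<in> ball 0 1" and r: "0 < r" "r \<le> 1 - norm x" and h: "norm h < r / 2"
  shows "\<bar>G (x + h) - G x\<bar> \<le> 4 * (real CARD('n))\<^sup>2 * Q / r * norm h"
proof -
  have sub: "ball x r \<subseteq> ball 0 1" by (rule ball_subset_unit_ball[OF x r(2)])
  have "x + h \<in> ball x r" using h norm_ge_zero[of h] r(1) by (simp add: dist_norm)
  then have xh: "x + h \<in> ball 0 1" using sub by blast
  have Q0: "0 \<le> Q" using Q[OF x] G_nonneg[OF x] by simp
  have dl: "norm (f' (x + h) k - f' x k) \<le> 4 * (real CARD('n))\<^sup>2 * Q / r * norm h * norm k" for k
  proof (rule derivative_lipschitz[OF r(1) harm_sub[OF sub] _ h])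
    show "norm (f' z k) \<le> Q * norm k" if "z \<in> ball x r" for z k
      by (rule Q_bound) (use that sub in blast)
  qed
  have "G (x + h) \<le> G x + 4 * (real CARD('n))\<^sup>2 * Q / r * norm h"
  proof (rule onorm_le)
    fix k
    have "norm (f' (x + h) k) \<le> norm (f' x k) + norm (f' (x + h) k - f' x k)"
      by (metis add.commute diff_add_cancel norm_triangle_ineq)
    also have "\<dots> \<le> G x * norm k + 4 * (real CARD('n))\<^sup>2 * Q / r * norm h * norm k"
      by (intro add_mono G_bound x dl)
    finally show "norm (f' (x + h) k) \<le> (G x + 4 * (real CARD('n))\<^sup>2 * Q / r * norm h) * norm k"
      by (simp add: distrib_right)
  qed
  moreover have "G x \<le> G (x + h) + 4 * (real CARD('n))\<^sup>2 * Q / r * norm h"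
  proof (rule onorm_le)
    fix k
    have "norm (f' x k) \<le> norm (f' (x + h) k) + norm (f' (x + h) k - f' x k)"
      by (metis add.commute diff_add_cancel norm_minus_commute norm_triangle_ineq)
    also have "\<dots> \<le> G (x + h) * norm k + 4 * (real CARD('n))\<^sup>2 * Q / r * norm h * norm k"
      by (intro add_mono G_bound xh dl)
    finally show "norm (f' x k) \<le> (G (x + h) + 4 * (real CARD('n))\<^sup>2 * Q / r * norm h) * norm k"
      by (simp add: distrib_right)
  qed
  ultimately show ?thesis by linarith
qed

lemma G_cont: "continuous_on (ball 0 1) G"
  unfolding continuous_on_iff
proof (intro ballI allI impI)
  fix x :: "real^'n" and e :: real assume x: "x \<in> ball 0 1" and e: "0 < e"
  define r where "r = 1 - norm x"
  have r: "0 < r" using x by (simp add: r_def)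
  define c where "c = 4 * (real CARD('n))\<^sup>2 * Q / r"
  have c: "0 \<le> c" using Q[OF x] G_nonneg[OF x] r by (simp add: c_def)
  define d where "d = min (r/2) (e / (c + 1))"
  have d: "0 < d" using r e c by (simp add: d_def)
  show "\<exists>d>0. \<forall>x'\<in>ball 0 1. dist x' x < d \<longrightarrow> dist (G x') (G x) < e"
  proof (intro exI[of _ d] conjI d ballI impI)
    fix z assume "dist z x < d"
    then have n: "norm (z - x) < r/2" "norm (z - x) < e / (c + 1)" by (auto simp: dist_norm d_def)
    have "\<bar>G (x + (z - x)) - G x\<bar> \<le> c * norm (z - x)"
      unfolding c_def by (rule G_local_lipschitz[OF x r _ n(1)]) (simp add: r_def)
    also have "\<dots> \<le> (c + 1) * norm (z - x)" by (simp add: mult_right_mono)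
    also have "\<dots> < e" using n(2) c by (simp add: field_simps)
    finally show "dist (G z) (G x) < e" by (simp add: dist_real_def)
  qed
qed

text \<open>For a quasiconformal mapping the power \<open>n\<close> of the norm of the derivative is at most a multiple of the
  Jacobian, and the Jacobian integrates to the volume of the image.\<close>

lemma energy_le:
  assumes h: "h \<in> borel_measurable borel" "\<And>y. 0 \<le> h y" "continuous_on \<Omega> h"
  shows "(\<integral>\<^sup>+x. ennreal (G x ^ CARD('n) * h (f x)) * indicator (ball 0 1) x \<partial>lborel)
    \<le> ennreal (fact CARD('n) * K ^ CARD('n)) * (\<integral>\<^sup>+y. ennreal (h y) * indicator \<Omega> y \<partial>lborel)"
proof -
  define l where "l x = (if x \<in> ball 0 1 then G x / K else 0)" for x
  have cl: "continuous_on (ball 0 1) (\<lambda>x. l x ^ CARD('n) * h (f x))"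
  proof (rule continuous_on_eq)
    show "continuous_on (ball 0 1) (\<lambda>x. (G x / K) ^ CARD('n) * h (f x))"
      using K f_im by (intro continuous_intros G_cont continuous_on_compose2[OF h(3) f_cont]) auto
  qed (simp add: l_def)
  have m: "(\<lambda>x. ennreal (l x ^ CARD('n) * h (f x)) * indicator (ball 0 1) x) \<in> borel_measurable borel"
    by (rule borel_measurable_continuous_restricted[OF open_ball cl])
  have base: "(\<integral>\<^sup>+x. ennreal (l x ^ CARD('n) * h (f x)) * indicator (ball 0 1) x \<partial>lborel)
       \<le> ennreal (fact CARD('n)) * (\<integral>\<^sup>+y. ennreal (h y) * indicator (f ` ball 0 1) y \<partial>lborel)"
  proof (rule nn_integral_image_ge[OF open_ball _ deriv f_inj h(1,2) m])
    show "open (f ` ball 0 1)" using f_im open_image by simp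
    show "l x * norm k \<le> norm (f' x k)" if "x \<in> ball 0 1" for x k
      using qc[OF that, of k] K that by (simp add: l_def field_simps)
    show "0 \<le> l x" for x using G_nonneg K by (simp add: l_def)
  qed
  have "(\<integral>\<^sup>+x. ennreal (G x ^ CARD('n) * h (f x)) * indicator (ball 0 1) x \<partial>lborel)
     = (\<integral>\<^sup>+x. ennreal (K ^ CARD('n)) * (ennreal (l x ^ CARD('n) * h (f x)) * indicator (ball 0 1) x) \<partial>lborel)"
  proof (rule nn_integral_cong)
    fix x :: "real^'n"
    have "ennreal (G x ^ CARD('n) * h (f x)) = ennreal (K ^ CARD('n)) * ennreal (l x ^ CARD('n) * h (f x))" if "x \<in> ball 0 1"
      using that K by (subst ennreal_mult'[symmetric]) (auto simp: l_def power_divide)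
    then show "ennreal (G x ^ CARD('n) * h (f x)) * indicator (ball 0 1) x =
        ennreal (K ^ CARD('n)) * (ennreal (l x ^ CARD('n) * h (f x)) * indicator (ball 0 1) x)"
      by (auto simp: indicator_def)
  qed
  also have "\<dots> = ennreal (K ^ CARD('n)) * (\<integral>\<^sup>+x. ennreal (l x ^ CARD('n) * h (f x)) * indicator (ball 0 1) x \<partial>lborel)"
    using m by (simp add: nn_integral_cmult)
  also have "\<dots> \<le> ennreal (K ^ CARD('n)) * (ennreal (fact CARD('n)) * (\<integral>\<^sup>+y. ennreal (h y) * indicator \<Omega> y \<partial>lborel))"
    using base f_im by (intro mult_left_mono) auto
  also have "\<dots> = ennreal (fact CARD('n) * K ^ CARD('n)) * (\<integral>\<^sup>+y. ennreal (h y) * indicator \<Omega> y \<partial>lborel)"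
    using K by (subst ennreal_mult) (auto simp: mult_ac)
  finally show ?thesis .
qed

text \<open>On the sphere of radius \<open>\<rho>\<close> around \<open>x\<close> the linear part of \<open>f\<close> is at least
  \<open>G x * \<rho> / K\<close>, and \<open>\<rho>\<close> is chosen so that the quadratic remainder is at most half of that. Hence the image of
  the sphere stays away from \<open>f x\<close>. A ball around \<open>f x\<close> that misses the image of the sphere lies in the
  image of the ball, by connectedness.\<close>

lemma image_contains_ball:
  fixes P r :: real
  assumes x: "x \<in> ball 0 1" and r: "0 < r" "r \<le> 1 - norm x" and P: "1 \<le> P"
    and le: "\<And>z. z \<in> ball x r \<Longrightarrow> G z \<le> P * G x"
  shows "ball (f x) (G x * r / (16 * (real CARD('n))\<^sup>2 * P * K\<^sup>2)) \<subseteq> f ` ball x r"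
proof (cases "G x = 0")
  case False
  define n where "n = real CARD('n)"
  have n: "1 \<le> n" unfolding n_def using zero_less_card_finite[where 'a='n] by linarith
  have G: "0 < G x" using False G_nonneg[OF x] by simp
  have sub: "ball x r \<subseteq> ball 0 1" by (rule ball_subset_unit_ball[OF x r(2)])
  define \<rho> where "\<rho> = r / (8 * n\<^sup>2 * P * K)"
  have big: "8 \<le> 8 * n\<^sup>2 * P * K"
  proof -
    have "1 \<le> n\<^sup>2" using n by simp
    then have "1 * 1 \<le> n\<^sup>2 * P" using P by (intro mult_mono) auto
    then have "1 * 1 * 1 \<le> n\<^sup>2 * P * K" by (rule mult_mono) (use K P in auto)
    then show ?thesis by simp
  qed
  have \<rho>: "0 < \<rho>" "\<rho> < r / 2" using r big by (auto simp: \<rho>_def field_simps)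
  define s where "s = G x * \<rho> / (2 * K)"
  have s: "s = G x * r / (16 * n\<^sup>2 * P * K\<^sup>2)"
    by (simp add: s_def \<rho>_def power2_eq_square)
  have far: "s \<le> norm (f (x + h) - f x)" if h: "norm h = \<rho>" for h
  proof -
    have "norm (f (x + h) - f x - f' x h) \<le> 4 * (real CARD('n))\<^sup>2 * (P * G x) / r * (norm h)\<^sup>2"
    proof (rule taylor_bound[OF r(1) harm_sub[OF sub]])
      show "norm (f' z k) \<le> P * G x * norm k" if "z \<in> ball x r" for z k
        using G_bound[of z k] le[OF that] that sub mult_right_mono[of "G z" "P * G x" "norm k"] by fastforce
    qed (use h \<rho> in simp)
    also have "\<dots> = G x * \<rho> / (2 * K)"
      using r P K n by (simp add: h \<rho>_def n_def[symmetric] field_simps power2_eq_square)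
    finally have "norm (f (x + h) - f x - f' x h) \<le> G x * \<rho> / (2 * K)" .
    moreover have "G x * \<rho> / K \<le> norm (f' x h)" using qc[OF x, of h] h K by (simp add: field_simps)
    moreover have "norm (f' x h) \<le> norm (f (x + h) - f x) + norm (f (x + h) - f x - f' x h)"
      using norm_triangle_ineq4[of "f (x + h) - f x" "f (x + h) - f x - f' x h"] by simp
    ultimately show ?thesis by (simp add: s_def field_simps)
  qed
  have cb: "cball x \<rho> \<subseteq> ball x r" using \<rho> by auto
  define B where "B = ball (f x) s"
  have op: "open (f ` ball x \<rho>)"
  proof -
    have "f ` ball x \<rho> = \<Omega> \<inter> g -` ball x \<rho>"
    proof (intro equalityI subsetI)
      fix y assume "y \<in> f ` ball x \<rho>"
      then obtain z where z: "z \<in> ball x \<rho>" "y = f z" by blast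
      then have "z \<in> ball 0 1" using cb sub ball_subset_cball by blast
      then show "y \<in> \<Omega> \<inter> g -` ball x \<rho>" using z gf f_im by auto
    next
      fix y assume "y \<in> \<Omega> \<inter> g -` ball x \<rho>"
      then show "y \<in> f ` ball x \<rho>" using fg[of y] image_eqI[of y f "g y" "ball x \<rho>"] by auto
    qed
    then show ?thesis using continuous_open_preimage[OF g_cont open_image open_ball] by simp
  qed
  have cl: "closed (f ` cball x \<rho>)"
    by (intro compact_imp_closed compact_continuous_image continuous_on_subset[OF f_cont] compact_cball) (use cb sub in auto)
  have "B \<inter> f ` cball x \<rho> \<subseteq> f ` ball x \<rho>"
  proof
    fix y assume "y \<in> B \<inter> f ` cball x \<rho>"
    then obtain z where z: "z \<in> cball x \<rho>" "y = f z" "y \<in> B" by auto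
    have "norm (z - x) \<noteq> \<rho>" using far[of "z - x"] z by (auto simp: B_def dist_norm norm_minus_commute)
    then show "y \<in> f ` ball x \<rho>" using z by (auto simp: dist_norm norm_minus_commute)
  qed
  have "connected B" unfolding B_def by (rule connected_ball)
  moreover have "B \<inter> f ` ball x \<rho> \<noteq> {}"
  proof -
    have "0 < s" using \<rho> G K by (simp add: s_def)
    then have "f x \<in> B \<inter> f ` ball x \<rho>" using \<rho> by (simp add: B_def)
    then show ?thesis by blast
  qed
  moreover have "f ` ball x \<rho> \<inter> - (f ` cball x \<rho>) \<inter> B = {}" by auto
  moreover have "B \<subseteq> f ` ball x \<rho> \<union> - (f ` cball x \<rho>)"
    using \<open>B \<inter> f ` cball x \<rho> \<subseteq> f ` ball x \<rho>\<close> by blast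
  ultimately have "- (f ` cball x \<rho>) \<inter> B = {}"
    using connectedD[of B "f ` ball x \<rho>" "- (f ` cball x \<rho>)"] op cl by blast
  then have "B \<subseteq> f ` ball x \<rho>"
    using \<open>B \<inter> f ` cball x \<rho> \<subseteq> f ` ball x \<rho>\<close> by blast
  also have "\<dots> \<subseteq> f ` ball x r" using \<rho> by (intro image_mono) auto
  finally show ?thesis by (simp add: B_def s n_def)
qed simp

text \<open>Suppose that \<open>f\<close> maps the half ball into a tiny ball around \<open>f 0\<close>. On
  each ray from the half ball towards the unit sphere, \<open>ln (|f - f 0|\<^sup>2 + s\<^sup>2)\<close> grows by at least the left hand
  side. The energy of this function is bounded by the logarithmic energy in \<open>\<Omega>\<close>, which
  is linear in \<open>k\<close>, while the growth is about \<open>2 * k * ln 2\<close> when \<open>s\<close> is of the size \<open>2 ^ (- k)\<close>.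
  The parameter \<open>\<tau>\<close> is at disposal to make the coefficient of \<open>k\<close> on the right as small as needed.\<close>

lemma half_ball_image_inequality:
  fixes c s \<tau> :: real and k :: nat
  assumes s: "0 < s" and c: "0 < c" and cb: "ball (f 0) c \<subseteq> \<Omega>"
    and k: "\<Omega> \<subseteq> ball (f 0) (2 ^ k * s)"
    and small: "\<And>x. x \<in> ball 0 (1/2) \<Longrightarrow> norm (f x - f 0) < s" and \<tau>: "0 < \<tau>"
  shows "ln (c\<^sup>2 / (8 * s\<^sup>2)) \<le>
     2 ^ (CARD('n) + 1) * (4 ^ CARD('n) * fact CARD('n) * K ^ CARD('n) * real (k + 1) / \<tau> ^ (CARD('n) - 1) + \<tau>)"
    (is "?\<Lambda> \<le> ?R")
proof (cases "?\<Lambda> \<le> 0")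
  case True
  moreover have "0 \<le> ?R" using K \<tau> by simp
  ultimately show ?thesis by linarith
next
  case False
  define n where "n = CARD('n)"
  define \<omega> where "\<omega> = unit_ball_vol (real CARD('n))"
  have \<omega>: "0 < \<omega>" by (simp add: \<omega>_def unit_ball_vol_pos)
  have n1: "1 \<le> n" unfolding n_def using zero_less_card_finite[where 'a='n] by linarith
  define b where "b = f 0"
  obtain e :: "real^'n" where e: "norm e = 1" using vector_choose_size[of 1] by auto
  define q where "q y = sqrt ((norm (y - b))\<^sup>2 + s\<^sup>2)" for y
  have q0: "0 < q y" for y using s by (simp add: q_def add_nonneg_pos)
  have qsq: "(q y)\<^sup>2 = (norm (y - b))\<^sup>2 + s\<^sup>2" for y by (simp add: q_def)
  have qge: "norm (y - b) \<le> q y" for y unfolding q_def by (rule real_le_rsqrt) simp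
  have q_cont: "continuous_on A q" for A unfolding q_def[abs_def] by (intro continuous_intros)
  define F where "F x = 2 * G x / q (f x)" for x
  have F_cont: "continuous_on (ball 0 1) F"
    unfolding F_def[abs_def]
    by (intro continuous_intros G_cont continuous_on_compose2[OF q_cont f_cont])
       (use q0 in \<open>auto simp: less_imp_neq[symmetric]\<close>)
  have F0: "0 \<le> F x" if "x \<in> ball 0 1" for x
    using G_nonneg[OF that] q0[of "f x"] by (simp add: F_def)
  \<comment> \<open>outside the ball of radius \<open>R\<close> the mapping stays at distance at least \<open>c/2\<close> from \<open>b\<close>\<close>
  obtain R where R: "1/2 \<le> R" "R < 1" "\<And>y. y \<in> cball b (c/2) \<Longrightarrow> norm (g y) < R"
  proof -
    have sub: "cball b (c/2) \<subseteq> \<Omega>" using cb c by (auto simp: b_def)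
    have cg: "continuous_on (cball b (c/2)) (\<lambda>y. norm (g y))"
      by (intro continuous_intros continuous_on_subset[OF g_cont sub])
    have "cball b (c/2) \<noteq> {}" using c by simp
    then obtain m where m: "m \<in> cball b (c/2)" "\<And>y. y \<in> cball b (c/2) \<Longrightarrow> norm (g y) \<le> norm (g m)"
      using continuous_attains_sup[OF compact_cball _ cg] by blast
    have "g m \<in> ball 0 1" using m(1) sub g_im by blast
    then have "norm (g m) < 1" by simp
    then show ?thesis using m(2)
      by (intro that[of "(1 + max (1/2) (norm (g m))) / 2"]) (force simp: max_def)+
  qed
  define H where "H z = ennreal (F z) * indicator (ball 0 1) z" for z
  have Hm: "H \<in> borel_measurable borel"
    unfolding H_def[abs_def] by (rule borel_measurable_continuous_restricted[OF open_ball F_cont])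
  have line: "ennreal ?\<Lambda> \<le> (\<integral>\<^sup>+t. H (x + t *\<^sub>R e) * indicator {0..2} t \<partial>lborel)"
    if x: "x \<in> ball 0 (1/2)" for x
  proof -
    have "\<exists>T. 0 \<le> T \<and> T \<le> 2 \<and> norm (x + T *\<^sub>R e) = R"
    proof (rule IVT')
      show "norm (x + 0 *\<^sub>R e) \<le> R" using x R by simp
      have "norm (2 *\<^sub>R e) - norm x \<le> norm (x + 2 *\<^sub>R e)"
        by (metis add.commute norm_diff_ineq)
      then show "R \<le> norm (x + 2 *\<^sub>R e)" using x R e by simp
    qed (auto intro!: continuous_intros)
    then obtain T where T: "0 \<le> T" "T \<le> 2" "norm (x + T *\<^sub>R e) = R" by blast
    have T0: "0 < T" using T x R by (cases "T = 0") auto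
    have inB: "x + t *\<^sub>R e \<in> ball 0 1" if t: "t \<in> {0..T}" for t
    proof -
      have "(1 - t / T) *\<^sub>R x + (t / T) *\<^sub>R (x + T *\<^sub>R e) \<in> cball 0 R"
        by (rule convexD_alt[OF convex_cball]) (use x R T t T0 in auto)
      moreover have "(1 - t / T) *\<^sub>R x + (t / T) *\<^sub>R (x + T *\<^sub>R e) = x + t *\<^sub>R e"
        using T0 by (simp add: algebra_simps)
      ultimately show ?thesis using R by simp
    qed
    \<comment> \<open>increment of the logarithm along the ray, bounded by the integral of its gradient\<close>
    define w where "w t = ln ((norm (f (x + t *\<^sub>R e) - b))\<^sup>2 + s\<^sup>2)" for t
    have wq: "w t = ln ((q (f (x + t *\<^sub>R e)))\<^sup>2)" for t by (simp add: w_def qsq)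
    have "\<exists>w'. (w has_real_derivative w') (at t) \<and> \<bar>w'\<bar> \<le> F (x + t *\<^sub>R e)" if t: "t \<in> {0..T}" for t
    proof -
      let ?z = "x + t *\<^sub>R e"
      have "((\<lambda>t. x + t *\<^sub>R e) has_derivative (\<lambda>t. t *\<^sub>R e)) (at t)" by (auto intro!: derivative_eq_intros)
      from diff_chain_at[OF this deriv[OF inB[OF t]]]
      have "((\<lambda>t. f (x + t *\<^sub>R e)) has_derivative (\<lambda>h. h *\<^sub>R f' ?z e)) (at t)"
        using linear_cmul[OF bounded_linear.linear[OF deriv_bl[OF inB[OF t]]]] by (simp add: o_def)
      then obtain w' where w': "(w has_real_derivative w') (at t)" "\<bar>w'\<bar> \<le> 2 * norm (f' ?z e) / q (f ?z)"
        unfolding w_def[abs_def] q_def using log_distance_derivative[OF _ s] by blast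
      have "2 * norm (f' ?z e) / q (f ?z) \<le> F ?z"
        using G_bound[OF inB[OF t], of e] e q0[of "f ?z"] unfolding F_def by (intro divide_right_mono) auto
      then show ?thesis using w' by force
    qed
    then obtain w' where dw: "\<And>t. t \<in> {0..T} \<Longrightarrow> (w has_real_derivative w' t) (at t)"
      and w'F: "\<And>t. t \<in> {0..T} \<Longrightarrow> \<bar>w' t\<bar> \<le> F (x + t *\<^sub>R e)" by metis
    have "ennreal \<bar>w T - w 0\<bar> \<le> (\<integral>\<^sup>+t. ennreal (F (x + t *\<^sub>R e)) * indicator {0..T} t \<partial>lborel)"
    proof (rule increment_le_nn_integral[OF T(1) dw _ w'F])
      show "continuous_on {0..T} (\<lambda>t. F (x + t *\<^sub>R e))"
        by (rule continuous_on_compose2[OF F_cont]) (use inB in \<open>auto intro!: continuous_intros\<close>)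
    qed
    also have "\<dots> \<le> (\<integral>\<^sup>+t. H (x + t *\<^sub>R e) * indicator {0..2} t \<partial>lborel)"
      by (rule nn_integral_mono) (use inB T in \<open>auto simp: H_def indicator_def\<close>)
    also have "?\<Lambda> \<le> \<bar>w T - w 0\<bar>"
    proof -
      have "c / 2 \<le> norm (f (x + T *\<^sub>R e) - b)"
      proof (rule ccontr)
        assume "\<not> ?thesis"
        then have "f (x + T *\<^sub>R e) \<in> cball b (c/2)" by (simp add: dist_norm norm_minus_commute)
        from R(3)[OF this] show False using gf[OF inB[of T]] T by simp
      qed
      then have "(c/2)\<^sup>2 \<le> (q (f (x + T *\<^sub>R e)))\<^sup>2"
        using c qge[of "f (x + T *\<^sub>R e)"] by (intro power_mono) auto
      then have a1: "ln ((c/2)\<^sup>2) \<le> w T" unfolding wq using c q0 by (subst ln_le_cancel_iff) auto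
      have "(norm (f x - b))\<^sup>2 \<le> s\<^sup>2" using small[OF x] by (intro power_mono) (auto simp: b_def)
      then have "(q (f x))\<^sup>2 \<le> 2 * s\<^sup>2" by (simp add: qsq)
      then have a2: "w 0 \<le> ln (2 * s\<^sup>2)" unfolding wq using s q0[of "f x"] by (simp add: ln_le_cancel_iff)
      have "c\<^sup>2 / (8 * s\<^sup>2) = (c/2)\<^sup>2 / (2 * s\<^sup>2)" by (simp add: power_divide)
      then have "?\<Lambda> = ln ((c/2)\<^sup>2) - ln (2 * s\<^sup>2)"
        using c s ln_divide_pos[of "(c/2)\<^sup>2" "2 * s\<^sup>2"] by simp
      then show ?thesis using a1 a2 by linarith
    qed
    ultimately show ?thesis by (meson ennreal_leI order_trans)
  qed
  have em: "emeasure lborel (ball (0::real^'n) (1/2)) = ennreal (\<omega> * (1/2) ^ n)"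
    using emeasure_ball[of "1/2" "0::real^'n"] by (simp add: \<omega>_def n_def)
  have "ennreal ?\<Lambda> * ennreal (\<omega> * (1/2) ^ n) = (\<integral>\<^sup>+x. ennreal ?\<Lambda> * indicator (ball (0::real^'n) (1/2)) x \<partial>lborel)"
    using em by (simp add: nn_integral_cmult_indicator)
  also have "\<dots> \<le> (\<integral>\<^sup>+x. (\<integral>\<^sup>+t. H (x + t *\<^sub>R e) * indicator {0..2} t \<partial>lborel) \<partial>lborel)"
    by (rule nn_integral_mono) (use line in \<open>auto simp: indicator_def\<close>)
  also have "\<dots> = ennreal 2 * (\<integral>\<^sup>+z. H z \<partial>lborel)"
    by (rule nn_integral_segments[OF Hm]) simp
  finally have main: "ennreal ?\<Lambda> * ennreal (\<omega> * (1/2) ^ n) \<le> ennreal 2 * (\<integral>\<^sup>+z. H z \<partial>lborel)" .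
  define h where "h y = (1 / q y) ^ n" for y
  have h0: "0 \<le> h y" for y using q0[of y] by (simp add: h_def)
  have hc: "continuous_on A h" for A
    unfolding h_def[abs_def] by (intro continuous_intros q_cont) (use q0 in \<open>auto simp: less_imp_neq[symmetric]\<close>)
  have hm: "h \<in> borel_measurable borel" by (rule borel_measurable_continuous_onI[OF hc])
  define E where "E x = ennreal (G x ^ n * h (f x)) * indicator (ball 0 1) x" for x
  have Em: "E \<in> borel_measurable borel"
    unfolding E_def[abs_def]
    by (intro borel_measurable_continuous_restricted open_ball continuous_intros G_cont
        continuous_on_compose2[OF hc f_cont]) auto
  have "(\<integral>\<^sup>+z. H z \<partial>lborel) \<le> (\<integral>\<^sup>+z. ennreal (2 ^ n / \<tau> ^ (n - 1)) * E z + ennreal \<tau> * indicator (ball 0 1) z \<partial>lborel)"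
  proof (rule nn_integral_mono)
    fix z :: "real^'n"
    show "H z \<le> ennreal (2 ^ n / \<tau> ^ (n - 1)) * E z + ennreal \<tau> * indicator (ball 0 1) z"
    proof (cases "z \<in> ball 0 1")
      case True
      have "F z * 1 ^ (n - 1) \<le> F z ^ n / \<tau> ^ (n - 1) + \<tau> * 1 ^ n"
        by (rule young_product[OF F0[OF True] _ \<tau> n1]) simp
      also have "F z ^ n = 2 ^ n * (G z ^ n * h (f z))"
        by (simp add: F_def h_def power_divide power_mult_distrib)
      finally have "F z \<le> 2 ^ n / \<tau> ^ (n - 1) * (G z ^ n * h (f z)) + \<tau>" by simp
      then have "ennreal (F z) \<le> ennreal (2 ^ n / \<tau> ^ (n - 1) * (G z ^ n * h (f z)) + \<tau>)" by (rule ennreal_leI)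
      also have "\<dots> = ennreal (2 ^ n / \<tau> ^ (n - 1)) * ennreal (G z ^ n * h (f z)) + ennreal \<tau>"
        using \<tau> h0[of "f z"] G_nonneg[OF True] by (simp add: ennreal_mult'[symmetric])
      finally show ?thesis using True by (simp add: H_def E_def)
    qed (simp add: H_def)
  qed
  also have "\<dots> = ennreal (2 ^ n / \<tau> ^ (n - 1)) * (\<integral>\<^sup>+z. E z \<partial>lborel) + ennreal (\<tau> * \<omega>)"
    using Em \<tau> emeasure_ball[of 1 "0::real^'n"] \<omega>
    by (subst nn_integral_add)
       (auto simp: nn_integral_cmult nn_integral_cmult_indicator \<omega>_def ennreal_mult'
             intro!: borel_measurable_times_ennreal borel_measurable_indicator)
  also have "(\<integral>\<^sup>+z. E z \<partial>lborel) \<le> ennreal (fact n * K ^ n) * (\<integral>\<^sup>+y. ennreal (h y) * indicator \<Omega> y \<partial>lborel)"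
    unfolding E_def n_def by (rule energy_le[OF hm h0 hc])
  also have "(\<integral>\<^sup>+y. ennreal (h y) * indicator \<Omega> y \<partial>lborel) \<le> (\<integral>\<^sup>+y. ennreal (h y) * indicator (ball b (2 ^ k * s)) y \<partial>lborel)"
    by (intro nn_integral_mono mult_left_mono) (use k in \<open>auto simp: indicator_def b_def\<close>)
  also have "\<dots> \<le> ennreal (real (k + 1) * 2 ^ n * \<omega>)"
    using log_energy[OF s, of b k] by (simp add: h_def q_def n_def \<omega>_def)
  finally have I: "(\<integral>\<^sup>+z. H z \<partial>lborel) \<le> ennreal (2 ^ n / \<tau> ^ (n - 1)) * (ennreal (fact n * K ^ n) * ennreal (real (k + 1) * 2 ^ n * \<omega>)) + ennreal (\<tau> * \<omega>)"
    by (simp add: add_right_mono mult_left_mono)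
  define J where "J = 2 ^ n / \<tau> ^ (n - 1) * (fact n * K ^ n * (real (k + 1) * 2 ^ n * \<omega>)) + \<tau> * \<omega>"
  have J0: "0 \<le> J" using \<tau> K \<omega> by (simp add: J_def)
  have "ennreal (2 ^ n / \<tau> ^ (n - 1)) * (ennreal (fact n * K ^ n) * ennreal (real (k + 1) * 2 ^ n * \<omega>)) + ennreal (\<tau> * \<omega>) = ennreal J"
    using \<tau> K \<omega> by (simp add: J_def ennreal_mult'[symmetric] ennreal_plus[symmetric] del: ennreal_plus)
  with I have "(\<integral>\<^sup>+z. H z \<partial>lborel) \<le> ennreal J" by simp
  then have "ennreal 2 * (\<integral>\<^sup>+z. H z \<partial>lborel) \<le> ennreal 2 * ennreal J" by (rule mult_left_mono) simp
  with main have "ennreal ?\<Lambda> * ennreal (\<omega> * (1/2) ^ n) \<le> ennreal 2 * ennreal J" by (rule order_trans)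
  moreover have "ennreal ?\<Lambda> * ennreal (\<omega> * (1/2) ^ n) = ennreal (?\<Lambda> * (\<omega> * (1/2) ^ n))"
    by (rule ennreal_mult'[symmetric]) (use False in simp)
  moreover have "ennreal 2 * ennreal J = ennreal (2 * J)"
    by (rule ennreal_mult'[symmetric]) simp
  ultimately have "ennreal (?\<Lambda> * (\<omega> * (1/2) ^ n)) \<le> ennreal (2 * J)" by (simp only:)
  then have fin: "?\<Lambda> * (\<omega> * (1/2) ^ n) \<le> 2 * J" using J0 by (simp add: ennreal_le_iff)
  have "?\<Lambda> = (?\<Lambda> * (\<omega> * (1/2) ^ n)) * (2 ^ n / \<omega>)"
    using \<omega> by (simp add: power_divide)
  also have "\<dots> \<le> 2 * J * (2 ^ n / \<omega>)" using fin \<omega> by (intro mult_right_mono) auto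
  also have "\<dots> = 2 ^ (n + 1) * (4 ^ n * fact n * K ^ n * real (k + 1) / \<tau> ^ (n - 1) + \<tau>)"
  proof -
    have "(4::real) ^ n = 2 ^ n * 2 ^ n" by (simp add: power_mult_distrib[symmetric])
    then show ?thesis using \<omega> by (simp add: J_def field_simps)
  qed
  finally show ?thesis by (simp only: n_def)
qed

end

section \<open>The energy of the inverse mapping\<close>

context harmonic_qc
begin

text \<open>At a critical point the Taylor formula leaves only the quadratic term. Its
  coefficient degenerates at the unit sphere, so the critical points are exhausted by sets that keep a
  positive distance from it.\<close>

lemma critical_shadow_negligible:
  fixes \<Psi> :: "real^'n \<Rightarrow> real^'n"
  assumes n: "3 \<le> CARD('n)" and bd: "bounded \<Omega>"
    and lip: "\<And>p q. p \<in> \<Omega> \<Longrightarrow> q \<in> \<Omega> \<Longrightarrow> norm (\<Psi> p - \<Psi> q) \<le> L * norm (p - q)" and L: "0 \<le> L"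
  shows "negligible {\<Psi> (f c) - t *\<^sub>R h | c t. (c \<in> ball 0 1 \<and> G c = 0) \<and> t \<in> {0..1::real}}"
proof -
  define S where "S C = {\<Psi> (f c) - t *\<^sub>R h | c t. c \<in> C \<and> t \<in> {0..1::real}}" for C
  define C where "C m = {c \<in> ball 0 1. G c = 0 \<and> norm c \<le> 1 - 1 / real (Suc m)}" for m
  obtain D where D: "0 < D" "\<And>p. p \<in> \<Omega> \<Longrightarrow> norm p \<le> D" using bd unfolding bounded_pos by blast
  have "negligible (S (C m))" for m
  proof -
    define r where "r = 1 / real (Suc m)"
    have r: "0 < r" by (simp add: r_def)
    define M where "M = max (4 * (real CARD('n))\<^sup>2 * Q / r) (2 * D / (r/2)\<^sup>2)"
    show ?thesis unfolding S_def
    proof (rule negligible_shadow[OF n, where \<theta> = "\<lambda>c. \<Psi> (f c)" and M = "L * M"])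
      show "bounded (C m)" by (rule bounded_subset[of "ball 0 1"]) (auto simp: C_def)
      fix x c assume "x \<in> C m" "c \<in> C m"
      then have x: "x \<in> ball 0 1" and c: "c \<in> ball 0 1" "G c = 0" "r \<le> 1 - norm c" by (auto simp: C_def r_def)
      have fx: "f x \<in> \<Omega>" "f c \<in> \<Omega>" using x c f_im by auto
      have "norm (f x - f c) \<le> M * (norm (x - c))\<^sup>2"
      proof (cases "norm (x - c) < r / 2")
        case True
        have sub: "ball c r \<subseteq> ball 0 1" by (rule ball_subset_unit_ball[OF c(1,3)])
        have "norm (f (c + (x - c)) - f c - f' c (x - c)) \<le> 4 * (real CARD('n))\<^sup>2 * Q / r * (norm (x - c))\<^sup>2"
        proof (rule taylor_bound[OF r harm_sub[OF sub] _ True])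
          show "norm (f' z k) \<le> Q * norm k" if "z \<in> ball c r" for z k
            by (rule Q_bound) (use that sub in blast)
        qed
        moreover have "f' c (x - c) = 0" using G_bound[OF c(1), of "x - c"] c(2) by simp
        ultimately have "norm (f x - f c) \<le> 4 * (real CARD('n))\<^sup>2 * Q / r * (norm (x - c))\<^sup>2" by simp
        also have "\<dots> \<le> M * (norm (x - c))\<^sup>2" by (rule mult_right_mono) (simp_all add: M_def)
        finally show ?thesis .
      next
        case False
        have "norm (f x - f c) \<le> 2 * D" using D(2)[OF fx(1)] D(2)[OF fx(2)] norm_triangle_ineq4[of "f x" "f c"] by linarith
        also have "\<dots> = (2 * D / (r/2)\<^sup>2) * (r/2)\<^sup>2" using r by simp
        also have "\<dots> \<le> M * (norm (x - c))\<^sup>2"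
          using False r D(1) by (intro mult_mono power_mono) (auto simp: M_def le_max_iff_disj)
        finally show ?thesis .
      qed
      then have "L * norm (f x - f c) \<le> L * (M * (norm (x - c))\<^sup>2)" using L by (rule mult_left_mono)
      with lip[OF fx] show "norm (\<Psi> (f x) - \<Psi> (f c)) \<le> L * M * (norm (x - c))\<^sup>2" by simp
    qed
  qed
  then have "negligible (\<Union>m. S (C m))" by (intro negligible_countable_Union) auto
  moreover have "{\<Psi> (f c) - t *\<^sub>R h | c t. (c \<in> ball 0 1 \<and> G c = 0) \<and> t \<in> {0..1::real}} \<subseteq> (\<Union>m. S (C m))"
  proof
    fix z assume "z \<in> {\<Psi> (f c) - t *\<^sub>R h | c t. (c \<in> ball 0 1 \<and> G c = 0) \<and> t \<in> {0..1::real}}"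
    then obtain c t where c: "c \<in> ball 0 1" "G c = 0" and t: "t \<in> {0..1}" "z = \<Psi> (f c) - t *\<^sub>R h" by blast
    have "0 < 1 - norm c" using c by simp
    then obtain m where "1 / real (Suc m) < 1 - norm c" using nat_approx_posE by blast
    then have "c \<in> C m" using c by (simp add: C_def)
    then have "z \<in> S (C m)" using t unfolding S_def by blast
    then show "z \<in> (\<Union>m. S (C m))" by blast
  qed
  ultimately show ?thesis by (rule negligible_subset)
qed

lemma inverse_derivative:
  assumes x: "x \<in> ball 0 1" and G: "0 < G x"
  obtains g' where "(g has_derivative g') (at (f x))" "\<And>k. norm (g' k) \<le> K / G x * norm k"
proof -
  have lin: "linear (f' x)" using deriv_bl[OF x] bounded_linear.linear by blast
  have inj: "inj (f' x)" by (rule derivative_inj[OF x G])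
  obtain g' where g': "linear g'" "g' \<circ> f' x = id" using linear_injective_left_inverse[OF lin inj] by blast
  have surj: "f' x (g' k) = k" for k
    using linear_injective_imp_surjective[OF lin inj] g'(2) by (metis comp_apply id_apply surjD)
  have bg: "bounded_linear g'" using g'(1) by (simp add: linear_conv_bounded_linear)
  have "(g has_derivative g') (at (f x))"
  proof (rule has_derivative_inverse_dieudonne[OF open_ball _ f_cont _ _ x deriv[OF x] bg g'(2)])
    show "open (f ` ball 0 1)" using f_im open_image by simp
    show "continuous_on (f ` ball 0 1) g" using f_im g_cont by simp
  qed (rule gf)
  moreover have "norm (g' k) \<le> K / G x * norm k" for k
    using qc[OF x, of "g' k"] G by (simp add: surj field_simps)
  ultimately show ?thesis using that by blast
qed

text \<open>The two balls \<open>ball p\<^sub>1 s\<close> and \<open>ball p\<^sub>2 s\<close> live in the chart. The composition of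
  \<open>ln (|z - a|\<^sup>2 + d\<^sup>2)\<close> with the inverse of \<open>f\<close> increases by at least \<open>ln (1 / (128 * d\<^sup>2))\<close> along the segments
  that translate the first ball onto the second. Almost all of these segments avoid the images of
  critical points. The integral of the gradient of the composition is transformed back to the
  unit ball, where it becomes the integral of \<open>G x ^ (n - 1) / q x\<close>; Young's inequality splits
  it into the logarithmic energy and the energy of \<open>f\<close>.\<close>

lemma separation_inequality:
  fixes \<Phi> \<Psi> :: "real^'n \<Rightarrow> real^'n" and \<Phi>' \<Psi>' :: "real^'n \<Rightarrow> (real^'n) \<Rightarrow>\<^sub>L (real^'n)"
    and L s d \<tau> :: real and k :: nat
  assumes n: "3 \<le> CARD('n)" and bd: "bounded \<Omega>"
    and \<Phi>\<Psi>: "homeomorphism (cball 0 1) (closure \<Omega>) \<Phi> \<Psi>" and im: "\<Phi> ` ball 0 1 = \<Omega>" and L: "1 \<le> L"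
    and d\<Phi>: "\<And>z. z \<in> cball 0 1 \<Longrightarrow> (\<Phi> has_derivative \<Phi>' z) (at z within cball 0 1)"
    and n\<Phi>: "\<And>z. z \<in> cball 0 1 \<Longrightarrow> norm (\<Phi>' z) \<le> L"
    and d\<Psi>: "\<And>p. p \<in> \<Omega> \<Longrightarrow> (\<Psi> has_derivative \<Psi>' p) (at p)"
    and n\<Psi>: "\<And>p. p \<in> \<Omega> \<Longrightarrow> norm (\<Psi>' p) \<le> L"
    and lip: "\<And>x y. x \<in> cball 0 1 \<Longrightarrow> y \<in> cball 0 1 \<Longrightarrow> norm (x - y) \<le> L * norm (\<Phi> x - \<Phi> y)"
    and a: "a \<in> ball 0 1" and d: "0 < d" and k: "2 \<le> 2 ^ k * d" and s: "0 < s" and \<tau>: "0 < \<tau>"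
    and B1: "ball p\<^sub>1 s \<subseteq> ball 0 1" and B2: "ball p\<^sub>2 s \<subseteq> ball 0 1"
    and near: "\<And>y. y \<in> ball p\<^sub>1 s \<Longrightarrow> norm (g (\<Phi> y) - a) < d"
    and far: "\<And>y. y \<in> ball p\<^sub>2 s \<Longrightarrow> 1/8 \<le> norm (g (\<Phi> y) - a)"
  shows "ln (1 / (128 * d\<^sup>2)) * unit_ball_vol CARD('n) * s ^ CARD('n) \<le>
     4 * L ^ (CARD('n) + 1) * fact CARD('n) * K *
       (real (k + 1) * 2 ^ CARD('n) * unit_ball_vol CARD('n) / \<tau> ^ (CARD('n) - 1)
        + \<tau> * (fact CARD('n) * K ^ CARD('n) * measure lborel \<Omega>))"
    (is "?\<Lambda> * _ * _ \<le> ?R")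
proof (cases "?\<Lambda> \<le> 0")
  case True
  have "0 \<le> ?R" using K \<tau> L by (intro mult_nonneg_nonneg add_nonneg_nonneg) (auto simp: unit_ball_vol_nonneg)
  moreover have "?\<Lambda> * (unit_ball_vol CARD('n) * s ^ CARD('n)) \<le> 0"
    using True s by (intro mult_nonpos_nonneg) (auto simp: unit_ball_vol_nonneg)
  ultimately have "?\<Lambda> * (unit_ball_vol CARD('n) * s ^ CARD('n)) \<le> ?R" by linarith
  then show ?thesis by (simp only: mult.assoc)
next
  case False
  define n where "n = CARD('n)"
  define \<omega> where "\<omega> = unit_ball_vol (real CARD('n))"
  have \<omega>: "0 < \<omega>" by (simp add: \<omega>_def unit_ball_vol_pos)
  have n1: "1 \<le> n" using n by (simp add: n_def)
  define q where "q x = sqrt ((norm (x - a))\<^sup>2 + d\<^sup>2)" for x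
  have q0: "0 < q x" for x using d by (simp add: q_def add_nonneg_pos)
  have qn: "q x \<noteq> 0" for x using q0[of x] by simp
  have qsq: "(q x)\<^sup>2 = (norm (x - a))\<^sup>2 + d\<^sup>2" for x by (simp add: q_def)
  have qge: "norm (x - a) \<le> q x" for x unfolding q_def by (rule real_le_rsqrt) simp
  have q_cont: "continuous_on A q" for A unfolding q_def[abs_def] by (intro continuous_intros)
  have \<Psi>\<Phi>: "\<Psi> (\<Phi> z) = z" if "z \<in> cball 0 1" for z using \<Phi>\<Psi> that by (simp add: homeomorphism_def)
  have \<Phi>\<Psi>': "\<Phi> (\<Psi> p) = p" if "p \<in> \<Omega>" for p
    using \<Phi>\<Psi> subsetD[OF closure_subset that] by (simp add: homeomorphism_def)
  have \<Psi>im: "\<Psi> p \<in> ball 0 1" if p: "p \<in> \<Omega>" for p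
  proof -
    obtain z where "z \<in> ball 0 1" "p = \<Phi> z" using im p by blast
    then show ?thesis using \<Psi>\<Phi>[of z] by auto
  qed
  have d\<Phi>i: "(\<Phi> has_derivative \<Phi>' z) (at z)" if "z \<in> ball 0 1" for z
    using has_derivative_subset[OF d\<Phi>[OF subsetD[OF ball_subset_cball that]] ball_subset_cball]
    by (simp only: at_within_open[OF that open_ball])
  have c\<Phi>: "continuous_on (ball 0 1) \<Phi>"
  proof (rule continuous_on_subset[OF _ ball_subset_cball])
    show "continuous_on (cball 0 1) \<Phi>" using \<Phi>\<Psi> by (simp add: homeomorphism_def)
  qed
  define \<gamma> where "\<gamma> z = g (\<Phi> z)" for z
  have \<gamma>im: "\<gamma> z \<in> ball 0 1" if "z \<in> ball 0 1" for z
    unfolding \<gamma>_def using im g_im that by blast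
  have c\<gamma>: "continuous_on (ball 0 1) \<gamma>"
    unfolding \<gamma>_def by (rule continuous_on_compose2[OF g_cont c\<Phi>]) (use im in auto)
  define U where "U = {z \<in> ball 0 1. G (\<gamma> z) \<noteq> 0}"
  have c\<gamma>U: "continuous_on U \<gamma>" by (rule continuous_on_subset[OF c\<gamma>]) (auto simp: U_def)
  have cG\<gamma>: "continuous_on (ball 0 1) (\<lambda>z. G (\<gamma> z))"
    by (rule continuous_on_compose2[OF G_cont c\<gamma>]) (use \<gamma>im in auto)
  have openU: "open U"
  proof -
    have "open (ball 0 1 \<inter> (\<lambda>z. G (\<gamma> z)) -` (- {0}))"
      by (rule continuous_open_preimage[OF cG\<gamma> open_ball]) auto
    also have "ball 0 1 \<inter> (\<lambda>z. G (\<gamma> z)) -` (- {0}) = U" by (auto simp: U_def)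
    finally show ?thesis .
  qed
  have GU: "0 < G (\<gamma> z)" if "z \<in> U" for z using that G_nonneg[OF \<gamma>im, of z] by (auto simp: U_def less_le)
  \<comment> \<open>\<open>A\<close> bounds the gradient of the logarithm of \<open>q\<close> squared composed with the inverse of \<open>f\<close>\<close>
  define A where "A z = 2 * K / (q (\<gamma> z) * G (\<gamma> z))" for z
  have A_cont: "continuous_on U A"
    unfolding A_def[abs_def]
    by (intro continuous_intros continuous_on_compose2[OF q_cont c\<gamma>U] continuous_on_subset[OF cG\<gamma>])
       (use qn in \<open>auto simp: U_def\<close>)
  have A0: "0 \<le> A z" if "z \<in> U" for z
    using GU[OF that] q0[of "\<gamma> z"] K by (simp add: A_def)
  define h where "h z = indicator U z *\<^sub>R A z" for z
  have hm: "h \<in> borel_measurable borel"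
    unfolding h_def[abs_def] by (rule borel_measurable_continuous_on_indicator[OF _ A_cont]) (use openU in simp)
  have h0: "0 \<le> h z" for z using A0 by (auto simp: h_def indicator_def)
  define v where "v = p\<^sub>2 - p\<^sub>1"
  have inB: "y + t *\<^sub>R v \<in> ball 0 1" if "y \<in> ball p\<^sub>1 s" "t \<in> {0..1}" for y t
  proof -
    have "y + v \<in> ball p\<^sub>2 s" using that(1) by (simp add: v_def dist_norm algebra_simps)
    then have "y + v \<in> ball 0 1" "y \<in> ball 0 1" using B1 B2 that(1) by blast+
    then have "(1 - t) *\<^sub>R y + t *\<^sub>R (y + v) \<in> ball 0 1"
      by (intro convexD_alt[OF convex_ball]) (use that(2) in auto)
    then show ?thesis by (simp add: algebra_simps)
  qed
  have nv: "norm v \<le> 2"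
  proof -
    have "p\<^sub>1 \<in> ball 0 1" "p\<^sub>2 \<in> ball 0 1" using B1 B2 s centre_in_ball by blast+
    then show ?thesis using norm_triangle_ineq4[of p\<^sub>2 p\<^sub>1] by (simp add: v_def)
  qed
  \<comment> \<open>starting points of segments that meet the image of a critical point\<close>
  define N where "N = {\<Psi> (f c) - t *\<^sub>R v | c t. (c \<in> ball 0 1 \<and> G c = 0) \<and> t \<in> {0..1::real}}"
  have negN: "negligible N"
    unfolding N_def
  proof (rule critical_shadow_negligible[OF n bd])
    show "norm (\<Psi> p - \<Psi> p') \<le> L * norm (p - p')" if "p \<in> \<Omega>" "p' \<in> \<Omega>" for p p'
      using lip[OF subsetD[OF ball_subset_cball \<Psi>im[OF that(1)]] subsetD[OF ball_subset_cball \<Psi>im[OF that(2)]]]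
      by (simp only: \<Phi>\<Psi>' that)
  qed (use L in simp)
  have segU: "y + t *\<^sub>R v \<in> U" if y: "y \<in> ball p\<^sub>1 s" "y \<notin> N" and t: "t \<in> {0..1}" for y t
  proof (rule ccontr)
    assume "y + t *\<^sub>R v \<notin> U"
    moreover have b: "y + t *\<^sub>R v \<in> ball 0 1" by (rule inB[OF y(1) t])
    ultimately have z: "G (\<gamma> (y + t *\<^sub>R v)) = 0" by (simp add: U_def)
    have "f (\<gamma> (y + t *\<^sub>R v)) = \<Phi> (y + t *\<^sub>R v)" unfolding \<gamma>_def using b im by (intro fg) blast
    then have "\<Psi> (f (\<gamma> (y + t *\<^sub>R v))) = y + t *\<^sub>R v" using \<Psi>\<Phi>[OF subsetD[OF ball_subset_cball b]] by simp
    then have "y = \<Psi> (f (\<gamma> (y + t *\<^sub>R v))) - t *\<^sub>R v" by simp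
    then have "y \<in> N" using \<gamma>im[OF b] z t unfolding N_def by blast
    then show False using y by simp
  qed
  have line: "ennreal ?\<Lambda> \<le> (\<integral>\<^sup>+t. ennreal (2 * L * h (y + t *\<^sub>R v)) * indicator {0..1} t \<partial>lborel)"
    if y: "y \<in> ball p\<^sub>1 s" "y \<notin> N" for y
  proof -
    define w where "w t = ln ((norm (\<gamma> (y + t *\<^sub>R v) - a))\<^sup>2 + d\<^sup>2)" for t
    have wq: "w t = ln ((q (\<gamma> (y + t *\<^sub>R v)))\<^sup>2)" for t by (simp add: w_def qsq)
    have "\<exists>w'. (w has_real_derivative w') (at t) \<and> \<bar>w'\<bar> \<le> 2 * L * A (y + t *\<^sub>R v)" if t: "t \<in> {0..1}" for t
    proof -
      let ?z = "y + t *\<^sub>R v"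
      have zU: "?z \<in> U" by (rule segU[OF y t])
      then have zB: "?z \<in> ball 0 1" by (simp add: U_def)
      have fz: "f (\<gamma> ?z) = \<Phi> ?z" unfolding \<gamma>_def using zB im by (intro fg) blast
      obtain g' where g': "(g has_derivative g') (at (f (\<gamma> ?z)))" "\<And>k. norm (g' k) \<le> K / G (\<gamma> ?z) * norm k"
        using inverse_derivative[OF \<gamma>im[OF zB] GU[OF zU]] by blast
      have "((\<lambda>t. y + t *\<^sub>R v) has_derivative (\<lambda>t. t *\<^sub>R v)) (at t)" by (auto intro!: derivative_eq_intros)
      from diff_chain_at[OF diff_chain_at[OF this d\<Phi>i[OF zB]], of g g'] g'(1)[unfolded fz]
      have d\<gamma>: "((\<lambda>t. \<gamma> (y + t *\<^sub>R v)) has_derivative (\<lambda>h. h *\<^sub>R g' (\<Phi>' ?z v))) (at t)"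
        using linear_cmul[OF has_derivative_linear[OF g'(1)]]
        by (simp add: o_def \<gamma>_def blinfun.scaleR_right)
      then obtain w' where dw: "(w has_real_derivative w') (at t)" "\<bar>w'\<bar> \<le> 2 * norm (g' (\<Phi>' ?z v)) / q (\<gamma> ?z)"
        unfolding w_def[abs_def] q_def using log_distance_derivative[OF _ d] by blast
      have "norm (\<Phi>' ?z v) \<le> norm (\<Phi>' ?z) * norm v" by (rule norm_blinfun)
      also have "\<dots> \<le> L * 2" using n\<Phi>[of ?z] zB nv L by (intro mult_mono) auto
      finally have n1: "norm (\<Phi>' ?z v) \<le> 2 * L" by simp
      have "norm (g' (\<Phi>' ?z v)) \<le> K / G (\<gamma> ?z) * norm (\<Phi>' ?z v)" by (rule g'(2))
      also have "\<dots> \<le> K / G (\<gamma> ?z) * (2 * L)" using n1 K GU[OF zU] by (intro mult_left_mono) auto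
      finally have n2: "norm (g' (\<Phi>' ?z v)) \<le> K / G (\<gamma> ?z) * (2 * L)" .
      then have "2 * norm (g' (\<Phi>' ?z v)) / q (\<gamma> ?z) \<le> 2 * (K / G (\<gamma> ?z) * (2 * L)) / q (\<gamma> ?z)"
        using q0[of "\<gamma> ?z"] by (intro divide_right_mono mult_left_mono) auto
      also have "\<dots> = 2 * L * A ?z" by (simp add: A_def mult_ac)
      finally show ?thesis using dw by force
    qed
    then obtain w' where w': "\<And>t. t \<in> {0..1} \<Longrightarrow> (w has_real_derivative w' t) (at t)"
      "\<And>t. t \<in> {0..1} \<Longrightarrow> \<bar>w' t\<bar> \<le> 2 * L * A (y + t *\<^sub>R v)" by metis
    have "ennreal \<bar>w 1 - w 0\<bar> \<le> (\<integral>\<^sup>+t. ennreal (2 * L * A (y + t *\<^sub>R v)) * indicator {0..1} t \<partial>lborel)"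
    proof (rule increment_le_nn_integral[OF _ w'(1) _ w'(2)])
      have "continuous_on {0..1} (\<lambda>t. A (y + t *\<^sub>R v))"
        by (rule continuous_on_compose2[OF A_cont]) (use segU[OF y] in \<open>auto intro!: continuous_intros\<close>)
      then show "continuous_on {0..1} (\<lambda>t. 2 * L * A (y + t *\<^sub>R v))" by (intro continuous_intros)
    qed simp_all
    also have "\<dots> = (\<integral>\<^sup>+t. ennreal (2 * L * h (y + t *\<^sub>R v)) * indicator {0..1} t \<partial>lborel)"
      by (rule nn_integral_cong) (use segU[OF y] in \<open>auto simp: h_def indicator_def\<close>)
    also have "?\<Lambda> \<le> \<bar>w 1 - w 0\<bar>"
    proof -
      have "y + v \<in> ball p\<^sub>2 s" using y(1) by (simp add: v_def dist_norm algebra_simps)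
      then have "1/8 \<le> norm (\<gamma> (y + v) - a)" unfolding \<gamma>_def by (rule far)
      then have "(1/8)\<^sup>2 \<le> (q (\<gamma> (y + v)))\<^sup>2" using qge[of "\<gamma> (y + v)"] by (intro power_mono) auto
      then have a1: "ln ((1/8)\<^sup>2) \<le> w 1" unfolding wq using q0 by (subst ln_le_cancel_iff) auto
      have "(norm (\<gamma> y - a))\<^sup>2 \<le> d\<^sup>2" using near[OF y(1)] by (intro power_mono) (auto simp: \<gamma>_def)
      then have "(q (\<gamma> y))\<^sup>2 \<le> 2 * d\<^sup>2" by (simp add: qsq)
      then have a2: "w 0 \<le> ln (2 * d\<^sup>2)" unfolding wq using d q0[of "\<gamma> y"] by (simp add: ln_le_cancel_iff)
      have "1 / (128 * d\<^sup>2) = (1/8)\<^sup>2 / (2 * d\<^sup>2)" by (simp add: power_divide)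
      then have "?\<Lambda> = ln ((1/8)\<^sup>2) - ln (2 * d\<^sup>2)"
        using d ln_divide_pos[of "(1/8)\<^sup>2" "2 * d\<^sup>2"] by simp
      then show ?thesis using a1 a2 by linarith
    qed
    ultimately show ?thesis by (meson ennreal_leI order_trans)
  qed
  have em: "emeasure lborel (ball p\<^sub>1 s) = ennreal (\<omega> * s ^ n)"
    using emeasure_ball[of s p\<^sub>1] s by (simp add: \<omega>_def n_def)
  have hm2: "(\<lambda>z. ennreal (2 * L * h z)) \<in> borel_measurable borel" using hm by measurable
  have "ennreal ?\<Lambda> * ennreal (\<omega> * s ^ n) = (\<integral>\<^sup>+y. ennreal ?\<Lambda> * indicator (ball p\<^sub>1 s) y \<partial>lebesgue)"
    unfolding nn_integral_completion using em by (simp add: nn_integral_cmult_indicator)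
  also have "\<dots> \<le> (\<integral>\<^sup>+y. (\<integral>\<^sup>+t. ennreal (2 * L * h (y + t *\<^sub>R v)) * indicator {0..1} t \<partial>lborel) \<partial>lebesgue)"
  proof (rule nn_integral_mono_AE)
    have "AE y in lebesgue. y \<notin> N" using negN by (simp add: negligible_iff_null_sets AE_not_in)
    then show "AE y in lebesgue. ennreal ?\<Lambda> * indicator (ball p\<^sub>1 s) y \<le> (\<integral>\<^sup>+t. ennreal (2 * L * h (y + t *\<^sub>R v)) * indicator {0..1} t \<partial>lborel)"
      by eventually_elim (use line in \<open>auto simp: indicator_def\<close>)
  qed
  also have "\<dots> = (\<integral>\<^sup>+z. ennreal (2 * L * h z) \<partial>lborel)"
    unfolding nn_integral_completion using nn_integral_segments[OF hm2, of 1 v] by simp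
  also have "\<dots> = ennreal (2 * L) * (\<integral>\<^sup>+z. ennreal (h z) * indicator U z \<partial>lborel)"
  proof -
    have "ennreal (2 * L * h z) = ennreal (2 * L) * (ennreal (h z) * indicator U z)" for z
      using L h0[of z] by (auto simp: ennreal_mult' h_def indicator_def)
    moreover have "(\<lambda>z. ennreal (h z) * indicator U z) \<in> borel_measurable borel"
      by (intro borel_measurable_times_ennreal borel_measurable_indicator measurable_compose[OF hm measurable_ennreal])
         (use openU in simp)
    ultimately show ?thesis by (simp add: nn_integral_cmult)
  qed
  finally have main: "ennreal ?\<Lambda> * ennreal (\<omega> * s ^ n) \<le> ennreal (2 * L) * (\<integral>\<^sup>+z. ennreal (h z) * indicator U z \<partial>lborel)" .
  define V where "V = {x \<in> ball 0 1. G x \<noteq> 0}"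
  define \<phi> where "\<phi> = \<Psi> \<circ> f"
  have fV: "f x \<in> \<Omega>" if "x \<in> V" for x using that f_im by (auto simp: V_def)
  have \<gamma>\<phi>: "\<gamma> (\<phi> x) = x" if "x \<in> ball 0 1" for x
    using that f_im \<Phi>\<Psi>'[of "f x"] gf[OF that] by (auto simp: \<gamma>_def \<phi>_def)
  have \<phi>\<gamma>: "\<phi> (\<gamma> z) = z" if "z \<in> ball 0 1" for z
    using that im fg[of "\<Phi> z"] \<Psi>\<Phi>[of z] by (auto simp: \<gamma>_def \<phi>_def)
  have \<phi>V: "\<phi> ` V = U"
  proof (intro equalityI subsetI)
    fix z assume "z \<in> \<phi> ` V"
    then obtain x where x: "x \<in> V" "z = \<phi> x" by blast
    then show "z \<in> U" using \<gamma>\<phi>[of x] \<Psi>im[OF fV[OF x(1)]] by (auto simp: U_def V_def \<phi>_def)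
  next
    fix z assume z: "z \<in> U"
    then have "\<gamma> z \<in> V" using \<gamma>im by (auto simp: U_def V_def)
    moreover have "z = \<phi> (\<gamma> z)" using \<phi>\<gamma> z by (auto simp: U_def)
    ultimately show "z \<in> \<phi> ` V" by blast
  qed
  have openV: "open V"
  proof -
    have "open (ball 0 1 \<inter> G -` (- {0}))"
      by (rule continuous_open_preimage[OF G_cont open_ball]) auto
    also have "ball 0 1 \<inter> G -` (- {0}) = V" by (auto simp: V_def)
    finally show ?thesis .
  qed
  have cqi: "continuous_on W (\<lambda>x. 1 / q x)" for W
    by (intro continuous_intros q_cont) (use qn in auto)
  \<comment> \<open>the Jacobian bound cancels the singular factor \<open>1 / G x\<close>\<close>
  have pw: "(L * G x) ^ n * h (\<phi> x) = 2 * K * L ^ n * ((1 / q x) * G x ^ (n - 1))" if x: "x \<in> V" for x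
  proof -
    have "\<phi> x \<in> U" using \<phi>V x by blast
    then have "h (\<phi> x) = 2 * K / (q x * G x)" using \<gamma>\<phi>[of x] x by (simp add: h_def A_def V_def)
    moreover have "G x ^ n = G x * G x ^ (n - 1)" using n1 power_minus_mult[of n "G x"] by (simp add: mult.commute)
    ultimately show ?thesis using x qn[of x] by (simp add: V_def power_mult_distrib)
  qed
  have "(\<integral>\<^sup>+z. ennreal (h z) * indicator U z \<partial>lborel) = (\<integral>\<^sup>+z. ennreal (h z) * indicator (\<phi> ` V) z \<partial>lborel)"
    by (simp add: \<phi>V)
  also have "\<dots> \<le> ennreal (fact CARD('n)) * (\<integral>\<^sup>+x. ennreal ((L * G x) ^ CARD('n) * h (\<phi> x)) * indicator V x \<partial>lborel)"
  proof (rule nn_integral_image_le[OF openV _ _ _ hm h0])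
    show "open (\<phi> ` V)" using openU \<phi>V by simp
    show "(\<phi> has_derivative (blinfun_apply (\<Psi>' (f x)) \<circ> f' x)) (at x)" if "x \<in> V" for x
      unfolding \<phi>_def by (rule diff_chain_at[OF deriv d\<Psi>]) (use that fV in \<open>auto simp: V_def\<close>)
    show "inj_on \<phi> V" using \<gamma>\<phi> by (intro inj_on_inverseI[of _ \<gamma>]) (auto simp: V_def)
    show "norm ((blinfun_apply (\<Psi>' (f x)) \<circ> f' x) k) \<le> L * G x * norm k" if x: "x \<in> V" for x k
    proof -
      have "norm (\<Psi>' (f x) (f' x k)) \<le> norm (\<Psi>' (f x)) * norm (f' x k)" by (rule norm_blinfun)
      also have "\<dots> \<le> L * (G x * norm k)"
        using n\<Psi>[OF fV[OF x]] L G_bound[of x k] x by (intro mult_mono) (auto simp: V_def)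
      finally show ?thesis by simp
    qed
    have "continuous_on V (\<lambda>x. 2 * K * L ^ n * ((1 / q x) * G x ^ (n - 1)))"
      by (intro continuous_intros cqi continuous_on_subset[OF G_cont]) (auto simp: V_def)
    then have "(\<lambda>x. ennreal (2 * K * L ^ n * ((1 / q x) * G x ^ (n - 1))) * indicator V x) \<in> borel_measurable borel"
      by (rule borel_measurable_continuous_restricted[OF openV])
    moreover have "ennreal (2 * K * L ^ n * ((1 / q x) * G x ^ (n - 1))) * indicator V x
        = ennreal ((L * G x) ^ CARD('n) * h (\<phi> x)) * indicator V x" for x
      by (cases "x \<in> V") (simp_all add: pw n_def[symmetric])
    ultimately show "(\<lambda>x. ennreal ((L * G x) ^ CARD('n) * h (\<phi> x)) * indicator V x) \<in> borel_measurable borel" by simp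
  qed
  also have "(\<integral>\<^sup>+x. ennreal ((L * G x) ^ CARD('n) * h (\<phi> x)) * indicator V x \<partial>lborel)
     \<le> (\<integral>\<^sup>+x. ennreal (2 * K * L ^ n) * (ennreal (1 / \<tau> ^ (n - 1)) * (ennreal ((1 / q x) ^ n) * indicator (ball a (2 ^ k * d)) x)
            + ennreal \<tau> * (ennreal (G x ^ n * 1) * indicator (ball 0 1) x)) \<partial>lborel)"
  proof (rule nn_integral_mono)
    fix x :: "real^'n"
    show "ennreal ((L * G x) ^ CARD('n) * h (\<phi> x)) * indicator V x \<le>
        ennreal (2 * K * L ^ n) * (ennreal (1 / \<tau> ^ (n - 1)) * (ennreal ((1 / q x) ^ n) * indicator (ball a (2 ^ k * d)) x)
            + ennreal \<tau> * (ennreal (G x ^ n * 1) * indicator (ball 0 1) x))"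
    proof (cases "x \<in> V")
      case True
      then have xB: "x \<in> ball 0 1" by (simp add: V_def)
      have "norm (x - a) < 2" using xB a norm_triangle_ineq4[of x a] by simp
      then have xb: "x \<in> ball a (2 ^ k * d)" using k by (simp add: dist_norm norm_minus_commute)
      have "(1 / q x) * G x ^ (n - 1) \<le> (1 / q x) ^ n / \<tau> ^ (n - 1) + \<tau> * G x ^ n"
        by (rule young_product) (use q0[of x] G_nonneg[OF xB] \<tau> n1 in auto)
      then have "(L * G x) ^ n * h (\<phi> x) \<le> 2 * K * L ^ n * ((1 / q x) ^ n / \<tau> ^ (n - 1) + \<tau> * G x ^ n)"
        unfolding pw[OF True] using K L by (intro mult_left_mono) auto
      then have "ennreal ((L * G x) ^ n * h (\<phi> x)) \<le> ennreal (2 * K * L ^ n * ((1 / q x) ^ n / \<tau> ^ (n - 1) + \<tau> * G x ^ n))"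
        by (rule ennreal_leI)
      also have "\<dots> = ennreal (2 * K * L ^ n) * (ennreal (1 / \<tau> ^ (n - 1)) * ennreal ((1 / q x) ^ n) + ennreal \<tau> * ennreal (G x ^ n))"
        using K L \<tau> q0[of x] G_nonneg[OF xB]
        by (simp add: ennreal_mult'[symmetric] ennreal_plus[symmetric] del: ennreal_plus)
      finally show ?thesis using True xB xb by (simp add: n_def)
    qed simp
  qed
  also have "\<dots> = ennreal (2 * K * L ^ n) * (ennreal (1 / \<tau> ^ (n - 1)) * (\<integral>\<^sup>+x. ennreal ((1 / q x) ^ n) * indicator (ball a (2 ^ k * d)) x \<partial>lborel)
            + ennreal \<tau> * (\<integral>\<^sup>+x. ennreal (G x ^ n * 1) * indicator (ball 0 1) x \<partial>lborel))"
  proof -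
    have m1: "(\<lambda>x. ennreal ((1 / q x) ^ n) * indicator (ball a (2 ^ k * d)) x) \<in> borel_measurable borel"
      using borel_measurable_continuous_onI[OF cqi]
      by (intro borel_measurable_times_ennreal borel_measurable_indicator measurable_compose[OF _ measurable_ennreal] borel_measurable_power) auto
    have m2: "(\<lambda>x. ennreal (G x ^ n * 1) * indicator (ball 0 1) x) \<in> borel_measurable borel"
      by (intro borel_measurable_continuous_restricted open_ball continuous_intros G_cont)
    show ?thesis using m1 m2 by (simp add: nn_integral_cmult nn_integral_add borel_measurable_times_ennreal)
  qed
  finally have I: "(\<integral>\<^sup>+z. ennreal (h z) * indicator U z \<partial>lborel) \<le> ennreal (fact n) * (ennreal (2 * K * L ^ n) * (ennreal (1 / \<tau> ^ (n - 1)) * (\<integral>\<^sup>+x. ennreal ((1 / q x) ^ n) * indicator (ball a (2 ^ k * d)) x \<partial>lborel)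
            + ennreal \<tau> * (\<integral>\<^sup>+x. ennreal (G x ^ n * 1) * indicator (ball 0 1) x \<partial>lborel)))"
    by (simp add: mult_left_mono n_def)
  have J1: "(\<integral>\<^sup>+x. ennreal ((1 / q x) ^ n) * indicator (ball a (2 ^ k * d)) x \<partial>lborel) \<le> ennreal (real (k + 1) * 2 ^ n * \<omega>)"
    using log_energy[OF d, of a k] by (simp add: q_def n_def \<omega>_def)
  have emO: "emeasure lborel \<Omega> = ennreal (measure lborel \<Omega>)"
    by (rule emeasure_eq_ennreal_measure) (use emeasure_bounded_finite[OF bd] in simp)
  have J2: "(\<integral>\<^sup>+x. ennreal (G x ^ n * 1) * indicator (ball 0 1) x \<partial>lborel) \<le> ennreal (fact n * K ^ n * measure lborel \<Omega>)"
  proof -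
    have "(\<integral>\<^sup>+x. ennreal (G x ^ n * 1) * indicator (ball 0 1) x \<partial>lborel) \<le> ennreal (fact n * K ^ n) * (\<integral>\<^sup>+y. ennreal 1 * indicator \<Omega> y \<partial>lborel)"
      unfolding n_def by (rule energy_le[where h = "\<lambda>_. 1"]) auto
    also have "(\<integral>\<^sup>+y. ennreal 1 * indicator \<Omega> y \<partial>lborel) = ennreal (measure lborel \<Omega>)"
      using open_image emO by simp
    finally show ?thesis using K by (simp add: ennreal_mult')
  qed
  define J where "J = fact n * (2 * K * L ^ n * (1 / \<tau> ^ (n - 1) * (real (k + 1) * 2 ^ n * \<omega>) + \<tau> * (fact n * K ^ n * measure lborel \<Omega>)))"
  have J0: "0 \<le> J" using \<tau> K L \<omega> by (simp add: J_def)
  have "(\<integral>\<^sup>+z. ennreal (h z) * indicator U z \<partial>lborel) \<le> ennreal (fact n) * (ennreal (2 * K * L ^ n) * (ennreal (1 / \<tau> ^ (n - 1)) * ennreal (real (k + 1) * 2 ^ n * \<omega>)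
            + ennreal \<tau> * ennreal (fact n * K ^ n * measure lborel \<Omega>)))"
    by (rule order_trans[OF I]) (intro mult_left_mono add_mono J1 J2; simp)
  also have "\<dots> = ennreal J"
    using \<tau> K L \<omega> by (simp add: J_def ennreal_mult'[symmetric] ennreal_plus[symmetric] del: ennreal_plus)
  finally have "ennreal (2 * L) * (\<integral>\<^sup>+z. ennreal (h z) * indicator U z \<partial>lborel) \<le> ennreal (2 * L) * ennreal J"
    by (rule mult_left_mono) simp
  with main have "ennreal ?\<Lambda> * ennreal (\<omega> * s ^ n) \<le> ennreal (2 * L) * ennreal J" by (rule order_trans)
  moreover have "ennreal ?\<Lambda> * ennreal (\<omega> * s ^ n) = ennreal (?\<Lambda> * (\<omega> * s ^ n))"
    by (rule ennreal_mult'[symmetric]) (use False in simp)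
  moreover have "ennreal (2 * L) * ennreal J = ennreal (2 * L * J)"
    by (rule ennreal_mult'[symmetric]) (use L in simp)
  ultimately have "ennreal (?\<Lambda> * (\<omega> * s ^ n)) \<le> ennreal (2 * L * J)" by (simp only:)
  then have "?\<Lambda> * (\<omega> * s ^ n) \<le> 2 * L * J" using J0 L by (subst (asm) ennreal_le_iff) auto
  also have "2 * L * J = 4 * L ^ (n + 1) * fact n * K *
       (real (k + 1) * 2 ^ n * \<omega> / \<tau> ^ (n - 1) + \<tau> * (fact n * K ^ n * measure lborel \<Omega>))"
    by (simp add: J_def)
  finally show ?thesis by (simp add: n_def \<omega>_def mult.assoc)
qed

end

section \<open>No concentration near the boundary\<close>

text \<open>First choose \<open>\<tau>\<close> so large that the coefficient of \<open>k\<close> on the left is at most half of that on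
  the right, then \<open>k\<close> large. The exponent \<open>n - 1\<close> has to be positive.\<close>

lemma log_beats_energy:
  fixes A B a m :: real
  assumes m: "0 < m" and A: "0 \<le> A" and n: "2 \<le> n"
  obtains \<tau> and k :: nat where "0 < \<tau>" "A * real (k + 1) / \<tau> ^ (n - 1) + B * \<tau> < m * (2 * real k * ln 2 - a)"
proof -
  define \<tau> where "\<tau> = max 1 (A / (m * ln 2))"
  have \<tau>: "1 \<le> \<tau>" "A / (m * ln 2) \<le> \<tau>" by (auto simp: \<tau>_def)
  have "\<tau> ^ 1 \<le> \<tau> ^ (n - 1)" using \<tau> n by (intro power_increasing) auto
  then have "A / \<tau> ^ (n - 1) \<le> A / \<tau>" using \<tau> A by (intro divide_left_mono mult_pos_pos) auto
  also have "A / \<tau> \<le> m * ln 2" using \<tau> m by (simp add: field_simps)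
  finally have le: "A / \<tau> ^ (n - 1) \<le> m * ln 2" .
  obtain k :: nat where k: "(m * ln 2 + B * \<tau> + m * a) / (m * ln 2) < real k" using reals_Archimedean2 by blast
  then have k': "m * ln 2 + B * \<tau> + m * a < m * ln 2 * real k" using m by (simp add: field_simps)
  have "A * real (k + 1) / \<tau> ^ (n - 1) \<le> m * ln 2 * real (k + 1)"
    using mult_right_mono[OF le, of "real (k + 1)"] by (simp add: mult.commute)
  then have "A * real (k + 1) / \<tau> ^ (n - 1) + B * \<tau> < m * (2 * real k * ln 2 - a)"
    using k' by (simp add: algebra_simps)
  then show ?thesis using that[of \<tau> k] \<tau> by simp
qed

text \<open>The base point keeps a fixed distance \<open>c\<close> from the boundary, which excludes that
  the half ball is compressed to an arbitrarily small neighbourhood of \<open>b\<close>.\<close>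

lemma half_ball_image_not_small:
  fixes \<Omega> :: "(real^'n) set" and b :: "real^'n"
  assumes n: "2 \<le> CARD('n)" and op: "open \<Omega>" and bd: "bounded \<Omega>" and b: "b \<in> \<Omega>" and K: "1 \<le> K"
  obtains s where "0 < s"
    "\<And>f g f' Q. harmonic_qc \<Omega> f g f' K Q \<Longrightarrow> f 0 = b \<Longrightarrow> \<exists>x\<in>ball 0 (1/2). s \<le> norm (f x - b)"
proof -
  obtain c where c: "0 < c" "ball b c \<subseteq> \<Omega>" using op b openE by blast
  obtain D where D: "0 < D" "\<Omega> \<subseteq> ball b D" using bounded_subset_ballD[OF bd] by blast
  define E where "E = (2::real) ^ (CARD('n) + 1)"
  obtain \<tau> and k :: nat where \<tau>: "0 < \<tau>" and less:
    "E * (4 ^ CARD('n) * fact CARD('n) * K ^ CARD('n)) * real (k + 1) / \<tau> ^ (CARD('n) - 1) + E * \<tau>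
       < 1 * (2 * real k * ln 2 - ln (8 * D\<^sup>2 / c\<^sup>2))"
    by (rule log_beats_energy[of 1 "E * (4 ^ CARD('n) * fact CARD('n) * K ^ CARD('n))" "CARD('n)" E "ln (8 * D\<^sup>2 / c\<^sup>2)"])
       (use n K in \<open>auto simp: E_def\<close>)
  define s where "s = D / 2 ^ k"
  have s: "0 < s" using D by (simp add: s_def)
  show ?thesis
  proof (rule that[OF s])
    fix f g f' Q assume H: "harmonic_qc \<Omega> f g f' K Q" and f0: "f 0 = b"
    interpret harmonic_qc \<Omega> f g f' K Q by (rule H)
    show "\<exists>x\<in>ball 0 (1/2). s \<le> norm (f x - b)"
    proof (rule ccontr)
      assume "\<not> ?thesis"
      then have small: "\<And>x. x \<in> ball 0 (1/2) \<Longrightarrow> norm (f x - f 0) < s" using f0 by (auto simp: not_le)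
      have "ln (c\<^sup>2 / (8 * s\<^sup>2)) \<le>
         2 ^ (CARD('n) + 1) * (4 ^ CARD('n) * fact CARD('n) * K ^ CARD('n) * real (k + 1) / \<tau> ^ (CARD('n) - 1) + \<tau>)"
        by (rule half_ball_image_inequality[OF s c(1) _ _ small \<tau>])
           (use f0 c(2) D(2) in \<open>auto simp: s_def\<close>)
      also have "\<dots> = E * (4 ^ CARD('n) * fact CARD('n) * K ^ CARD('n)) * real (k + 1) / \<tau> ^ (CARD('n) - 1) + E * \<tau>"
        by (simp add: E_def distrib_left mult.assoc)
      also have "\<dots> < 2 * real k * ln 2 - ln (8 * D\<^sup>2 / c\<^sup>2)" using less by simp
      also have "\<dots> = ln (c\<^sup>2 / (8 * s\<^sup>2))"
      proof -
        have "c\<^sup>2 / (8 * s\<^sup>2) = (2 ^ (2 * k)) / (8 * D\<^sup>2 / c\<^sup>2)"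
          by (simp add: s_def power_divide power_mult power2_eq_square power_mult_distrib[symmetric])
        then have "ln (c\<^sup>2 / (8 * s\<^sup>2)) = ln (2 ^ (2 * k)) - ln (8 * D\<^sup>2 / c\<^sup>2)"
          using c D by (simp only:) (rule ln_divide_pos; simp)
        moreover have "ln (2 ^ (2 * k) :: real) = 2 * real k * ln 2" by (subst ln_realpow) auto
        ultimately show ?thesis by simp
      qed
      finally show False by simp
    qed
  qed
qed

text \<open>Points outside the unit ball are excluded by following the segment from \<open>\<Psi> p\<close>: where it
  meets the sphere, \<open>\<Phi>\<close> would take a value in \<open>\<Omega>\<close>, although \<open>\<Phi>\<close> maps the sphere outside \<open>\<Omega>\<close>.\<close>

lemma chart_ball:
  fixes \<Phi> \<Psi> :: "real^'n \<Rightarrow> real^'n"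
  assumes hom: "homeomorphism (cball 0 1) (closure \<Omega>) \<Phi> \<Psi>" and im: "\<Phi> ` ball 0 1 = \<Omega>" and L: "1 \<le> L"
    and lip: "\<And>x y. x \<in> cball 0 1 \<Longrightarrow> y \<in> cball 0 1 \<Longrightarrow> norm (\<Phi> x - \<Phi> y) \<le> L * norm (x - y)"
    and p: "0 < s" "ball p s \<subseteq> \<Omega>" and y: "y \<in> ball (\<Psi> p) (s / L)"
  shows "y \<in> ball 0 1" "\<Phi> y \<in> ball p s"
proof -
  have \<Psi>\<Phi>: "\<Psi> (\<Phi> z) = z" if "z \<in> cball 0 1" for z using hom that by (simp add: homeomorphism_def)
  have "p \<in> \<Omega>" using p by auto
  then obtain z0 where z0: "z0 \<in> ball 0 1" "p = \<Phi> z0" using im by blast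
  have pz: "\<Psi> p = z0" using \<Psi>\<Phi>[of z0] z0 by auto
  have step: "\<Phi> z \<in> ball p s" if z: "z \<in> cball 0 1" "z \<in> ball (\<Psi> p) (s / L)" for z
  proof -
    have "norm (\<Phi> z0 - \<Phi> z) \<le> L * norm (z0 - z)" by (rule lip) (use z0 z in auto)
    also have "\<dots> < L * (s / L)" using z(2) L by (intro mult_strict_left_mono) (auto simp: pz dist_norm)
    finally show ?thesis using L z0 by (simp add: dist_norm)
  qed
  show yB: "y \<in> ball 0 1"
  proof (rule ccontr)
    assume ny: "y \<notin> ball 0 1"
    have "\<exists>t. 0 \<le> t \<and> t \<le> 1 \<and> norm ((1 - t) *\<^sub>R z0 + t *\<^sub>R y) = 1"
      by (rule IVT') (use z0 ny in \<open>auto intro!: continuous_intros\<close>)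
    then obtain t where t: "0 \<le> t" "t \<le> 1" "norm ((1 - t) *\<^sub>R z0 + t *\<^sub>R y) = 1" by blast
    define w where "w = (1 - t) *\<^sub>R z0 + t *\<^sub>R y"
    have w1: "w \<in> cball 0 1" "w \<notin> ball 0 1" using t by (auto simp: w_def)
    have "z0 \<in> ball (\<Psi> p) (s / L)" using p L pz by simp
    then have "w \<in> ball (\<Psi> p) (s / L)" unfolding w_def
      using y t by (intro convexD_alt[OF convex_ball]) auto
    then have "\<Phi> w \<in> \<Omega>" using step[OF w1(1)] p by blast
    then obtain z1 where z1: "z1 \<in> ball 0 1" "\<Phi> w = \<Phi> z1" using im by blast
    then have "w = z1" using \<Psi>\<Phi>[of z1] \<Psi>\<Phi>[OF w1(1)] by auto
    then show False using z1 w1 by simp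
  qed
  show "\<Phi> y \<in> ball p s" by (rule step[OF subsetD[OF ball_subset_cball yB] y])
qed

context harmonic_qc
begin

lemma G_bound_dist:
  fixes D :: real
  assumes D: "\<And>p. p \<in> \<Omega> \<Longrightarrow> norm p \<le> D" and x: "x \<in> ball 0 1"
  shows "G x \<le> 2 * (real CARD('n))\<^sup>2 * D / (1 - norm x)"
proof (rule onorm_le)
  fix k
  have r: "0 < 1 - norm x" using x by simp
  have sub: "ball x (1 - norm x) \<subseteq> ball 0 1" by (rule ball_subset_unit_ball[OF x]) simp
  show "norm (f' x k) \<le> 2 * (real CARD('n))\<^sup>2 * D / (1 - norm x) * norm k"
  proof (rule vector_gradient_bound[OF r harm_sub[OF sub], where c = 0])
    show "norm (f z - 0) \<le> D" if "z \<in> ball x (1 - norm x)" for z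
      using D[of "f z"] that sub f_im by auto
  qed
qed

lemma exists_large_derivative:
  assumes s: "0 < s" and x1: "x1 \<in> ball 0 (1/2)" "s \<le> norm (f x1 - f 0)"
  obtains x where "x \<in> ball 0 (1/2)" "2 * s \<le> G x"
proof (rule ccontr)
  assume "\<not> thesis"
  then have "\<And>x. x \<in> ball 0 (1/2) \<Longrightarrow> G x \<le> 2 * s" using that by force
  then have "norm (f x1 - f 0) \<le> 2 * s * norm (x1 - 0)"
  proof (intro differentiable_bound[OF convex_ball[of 0 "1/2"]])
    show "(f has_derivative f' x) (at x within ball 0 (1/2))" if "x \<in> ball 0 (1/2)" for x
      by (rule has_derivative_at_withinI, rule deriv) (use that in auto)
  qed (use x1 in auto)
  also have "\<dots> < 2 * s * (1/2)" using x1 s by (intro mult_strict_left_mono) auto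
  finally show False using x1 by simp
qed

end

text \<open>Otherwise the tiny ball around \<open>x\<close> and the ball of radius \<open>1/4\<close> around a point \<open>x2\<close> of
  the half ball, where the derivative is not small, both have images that contain balls of a fixed
  radius \<open>\<sigma>\<close>, against the separation inequality.\<close>

lemma conformal_scale_small:
  fixes \<Omega> :: "(real^'n) set" and b :: "real^'n"
  assumes n: "3 \<le> CARD('n)" and op: "open \<Omega>" and bd: "bounded \<Omega>" and C1: "has_C1_boundary \<Omega>"
    and b: "b \<in> \<Omega>" and K: "1 \<le> K" and \<eta>: "0 < \<eta>"
  obtains d where "0 < d"
    "\<And>f g f' Q x. harmonic_qc \<Omega> f g f' K Q \<Longrightarrow> f 0 = b \<Longrightarrow> x \<in> ball 0 1 \<Longrightarrow> 1 - norm x < d \<Longrightarrow>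
       (\<And>z. z \<in> ball x ((1 - norm x) / 2) \<Longrightarrow> onorm (f' z) \<le> 4 * onorm (f' x)) \<Longrightarrow>
       (1 - norm x) * onorm (f' x) \<le> \<eta>"
proof -
  obtain \<Phi> \<Psi> :: "real^'n \<Rightarrow> real^'n" and \<Phi>' \<Psi>' :: "real^'n \<Rightarrow> (real^'n) \<Rightarrow>\<^sub>L (real^'n)" and L :: real
    where hom\<Phi>: "homeomorphism (cball 0 1) (closure \<Omega>) \<Phi> \<Psi>" and im\<Phi>: "\<Phi> ` ball 0 1 = \<Omega>" and L: "1 \<le> L"
    and \<Phi>': "\<And>x. x \<in> cball 0 1 \<Longrightarrow> (\<Phi> has_derivative blinfun_apply (\<Phi>' x)) (at x within cball 0 1)"
    and c\<Phi>': "continuous_on (cball 0 1) \<Phi>'" and n\<Phi>': "\<And>x. x \<in> cball 0 1 \<Longrightarrow> norm (\<Phi>' x) \<le> L"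
    and \<Psi>': "\<And>p. p \<in> \<Omega> \<Longrightarrow> (\<Psi> has_derivative blinfun_apply (\<Psi>' p)) (at p)" and n\<Psi>': "\<And>p. p \<in> \<Omega> \<Longrightarrow> norm (\<Psi>' p) \<le> L"
    and lipU: "\<And>x y. x \<in> cball 0 1 \<Longrightarrow> y \<in> cball 0 1 \<Longrightarrow> norm (\<Phi> x - \<Phi> y) \<le> L * norm (x - y)"
    and lipL: "\<And>x y. x \<in> cball 0 1 \<Longrightarrow> y \<in> cball 0 1 \<Longrightarrow> norm (x - y) \<le> L * norm (\<Phi> x - \<Phi> y)"
    by (rule C1_domain_chart[OF C1 op]) (rule that; assumption)
  have n2: "2 \<le> CARD('n)" using n by simp
  obtain s where s: "0 < s" "\<And>f g f' Q. harmonic_qc \<Omega> f g f' K Q \<Longrightarrow> f 0 = b \<Longrightarrow> \<exists>x\<in>ball 0 (1/2). s \<le> norm (f x - b)"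
    using half_ball_image_not_small[OF n2 op bd b K] by blast
  obtain D where D: "0 < D" "\<And>p. p \<in> \<Omega> \<Longrightarrow> norm p \<le> D" using bd unfolding bounded_pos by blast
  define m where "m = 16 * (real CARD('n))\<^sup>2 * K\<^sup>2"
  have m: "0 < m" using n K by (simp add: m_def)
  \<comment> \<open>bound for the ratio between the largest derivative near \<open>x2\<close> and the derivative at \<open>x2\<close>\<close>
  define P where "P = max 1 (2 * (real CARD('n))\<^sup>2 * D * 4 / (2 * s))"
  have P: "1 \<le> P" "2 * (real CARD('n))\<^sup>2 * D * 4 / (2 * s) \<le> P" by (auto simp: P_def)
  define \<sigma> where "\<sigma> = min (\<eta> / (8 * m)) (2 * s * (1/4) / (m * P))"
  have \<sigma>: "0 < \<sigma>" using \<eta> m s P by (simp add: \<sigma>_def)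
  define s' where "s' = \<sigma> / L"
  have s': "0 < s'" using \<sigma> L by (simp add: s'_def)
  define \<omega> where "\<omega> = unit_ball_vol (real CARD('n))"
  have \<omega>: "0 < \<omega>" by (simp add: \<omega>_def unit_ball_vol_pos)
  define E where "E = 4 * L ^ (CARD('n) + 1) * fact CARD('n) * K"
  have E: "0 \<le> E" using L K by (simp add: E_def)
  obtain \<tau> and k :: nat where \<tau>: "0 < \<tau>" and less:
    "E * (2 ^ CARD('n) * \<omega>) * real (k + 1) / \<tau> ^ (CARD('n) - 1) + E * (fact CARD('n) * K ^ CARD('n) * measure lborel \<Omega>) * \<tau>
       < (\<omega> * s' ^ CARD('n)) * (2 * real k * ln 2 - ln 512)"
    by (rule log_beats_energy[of "\<omega> * s' ^ CARD('n)" "E * (2 ^ CARD('n) * \<omega>)" "CARD('n)" "E * (fact CARD('n) * K ^ CARD('n) * measure lborel \<Omega>)" "ln 512"])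
       (use \<omega> s' E n in auto)
  \<comment> \<open>then \<open>2 ^ k * d = 2\<close> is the diameter of the unit ball, and \<open>128 * d\<^sup>2 = 512 / 4 ^ k\<close>\<close>
  define d where "d = 2 / (2::real) ^ k"
  have d: "0 < d" by (simp add: d_def)
  have min: "0 < min d (1/8)" using d by simp
  show ?thesis
  proof (rule that[OF min])
    fix f g f' Q x
    assume H: "harmonic_qc \<Omega> f g f' K Q" and f0: "f 0 = b" and x: "x \<in> ball 0 1" and xd: "1 - norm x < min d (1/8)"
      and G4: "\<And>z. z \<in> ball x ((1 - norm x) / 2) \<Longrightarrow> onorm (f' z) \<le> 4 * onorm (f' x)"
    interpret harmonic_qc \<Omega> f g f' K Q by (rule H)
    show "(1 - norm x) * G x \<le> \<eta>"
    proof (rule ccontr)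
      assume "\<not> ?thesis"
      then have big: "\<eta> < (1 - norm x) * G x" by simp
      define \<delta> where "\<delta> = 1 - norm x"
      have \<delta>: "0 < \<delta>" "\<delta> < d" "\<delta> < 1/8" using x xd by (auto simp: \<delta>_def)
      have "ball (f x) (G x * (\<delta> / 2) / (16 * (real CARD('n))\<^sup>2 * 4 * K\<^sup>2)) \<subseteq> f ` ball x (\<delta> / 2)"
        by (rule image_contains_ball[OF x]) (use \<delta> G4 in \<open>auto simp: \<delta>_def\<close>)
      moreover have "\<sigma> \<le> G x * (\<delta> / 2) / (16 * (real CARD('n))\<^sup>2 * 4 * K\<^sup>2)"
      proof -
        have "\<sigma> \<le> \<eta> / (8 * m)" by (simp add: \<sigma>_def)
        also have "\<dots> \<le> (\<delta> * G x) / (8 * m)" using big m by (intro divide_right_mono) (auto simp: \<delta>_def)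
        also have "\<dots> = G x * (\<delta> / 2) / (16 * (real CARD('n))\<^sup>2 * 4 * K\<^sup>2)" by (simp add: m_def)
        finally show ?thesis .
      qed
      ultimately have b1: "ball (f x) \<sigma> \<subseteq> f ` ball x (\<delta> / 2)" by (meson order_trans subset_ball)
      obtain x1 where "x1 \<in> ball 0 (1/2)" "s \<le> norm (f x1 - f 0)" using s(2)[OF H f0] f0 by blast
      then obtain x2 where x2: "x2 \<in> ball 0 (1/2)" "2 * s \<le> G x2" using exists_large_derivative[OF s(1)] by blast
      have x2B: "x2 \<in> ball 0 1" using x2 by auto
      have "ball (f x2) (G x2 * (1/4) / (16 * (real CARD('n))\<^sup>2 * P * K\<^sup>2)) \<subseteq> f ` ball x2 (1/4)"
      proof (rule image_contains_ball[OF x2B _ _ P(1)])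
        show "1/4 \<le> 1 - norm x2" using x2 by simp
        show "G z \<le> P * G x2" if z: "z \<in> ball x2 (1/4)" for z
        proof -
          have nz: "norm z < 3/4" using z x2 norm_triangle_ineq2[of z x2] by (simp add: dist_norm norm_minus_commute)
          have "G z \<le> 2 * (real CARD('n))\<^sup>2 * D / (1 - norm z)" by (rule G_bound_dist[OF D(2)]) (use nz in auto)
          also have "\<dots> \<le> 2 * (real CARD('n))\<^sup>2 * D / (1/4)" using nz D by (intro divide_left_mono) auto
          also have "\<dots> = 2 * (real CARD('n))\<^sup>2 * D * 4 / (2 * s) * (2 * s)" using s by simp
          also have "\<dots> \<le> P * G x2" using P x2 s by (intro mult_mono) auto
          finally show ?thesis .
        qed
      qed simp
      moreover have "\<sigma> \<le> G x2 * (1/4) / (16 * (real CARD('n))\<^sup>2 * P * K\<^sup>2)"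
      proof -
        have "\<sigma> \<le> 2 * s * (1/4) / (m * P)" by (simp add: \<sigma>_def)
        also have "\<dots> \<le> G x2 * (1/4) / (m * P)" using x2 m P by (intro divide_right_mono) auto
        also have "\<dots> = G x2 * (1/4) / (16 * (real CARD('n))\<^sup>2 * P * K\<^sup>2)" by (simp add: m_def mult_ac)
        finally show ?thesis .
      qed
      ultimately have b2: "ball (f x2) \<sigma> \<subseteq> f ` ball x2 (1/4)" by (meson order_trans subset_ball)
      have sub1: "ball x (\<delta> / 2) \<subseteq> ball 0 1" by (rule ball_subset_unit_ball[OF x]) (use \<delta> in \<open>simp add: \<delta>_def\<close>)
      have sub2: "ball x2 (1/4) \<subseteq> ball 0 1" by (rule ball_subset_unit_ball[OF x2B]) (use x2 in simp)
      have o1: "ball (f x) \<sigma> \<subseteq> \<Omega>" using b1 sub1 f_im by blast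
      have o2: "ball (f x2) \<sigma> \<subseteq> \<Omega>" using b2 sub2 f_im by blast
      have ch1: "y \<in> ball 0 1" "\<Phi> y \<in> ball (f x) \<sigma>" if y: "y \<in> ball (\<Psi> (f x)) s'" for y
        by (rule chart_ball[OF hom\<Phi> im\<Phi> L _ \<sigma> o1 y[unfolded s'_def]], rule lipU, assumption, assumption)+
      have ch2: "y \<in> ball 0 1" "\<Phi> y \<in> ball (f x2) \<sigma>" if y: "y \<in> ball (\<Psi> (f x2)) s'" for y
        by (rule chart_ball[OF hom\<Phi> im\<Phi> L _ \<sigma> o2 y[unfolded s'_def]], rule lipU, assumption, assumption)+
      have "ln (1 / (128 * d\<^sup>2)) * unit_ball_vol CARD('n) * s' ^ CARD('n) \<le>
        4 * L ^ (CARD('n) + 1) * fact CARD('n) * K *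
          (real (k + 1) * 2 ^ CARD('n) * unit_ball_vol CARD('n) / \<tau> ^ (CARD('n) - 1)
           + \<tau> * (fact CARD('n) * K ^ CARD('n) * measure lborel \<Omega>))"
      proof (rule separation_inequality[OF n bd hom\<Phi> im\<Phi> L \<Phi>' n\<Phi>' \<Psi>' n\<Psi>' lipL x d _ s' \<tau>])
        show "2 \<le> 2 ^ k * d" by (simp add: d_def)
        show "ball (\<Psi> (f x)) s' \<subseteq> ball 0 1" using ch1(1) by blast
        show "ball (\<Psi> (f x2)) s' \<subseteq> ball 0 1" using ch2(1) by blast
        show "norm (g (\<Phi> y) - x) < d" if y: "y \<in> ball (\<Psi> (f x)) s'" for y
        proof -
          obtain z where z: "z \<in> ball x (\<delta> / 2)" "\<Phi> y = f z" using b1 ch1(2)[OF y] by blast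
          then have "g (\<Phi> y) = z" using gf[of z] sub1 by auto
          then show ?thesis using z \<delta> by (simp add: dist_norm norm_minus_commute)
        qed
        show "1/8 \<le> norm (g (\<Phi> y) - x)" if y: "y \<in> ball (\<Psi> (f x2)) s'" for y
        proof -
          obtain z where z: "z \<in> ball x2 (1/4)" "\<Phi> y = f z" using b2 ch2(2)[OF y] by blast
          then have gz: "g (\<Phi> y) = z" using gf[of z] sub2 by auto
          have "norm z < 3/4" using z x2 norm_triangle_ineq2[of z x2] by (simp add: dist_norm norm_minus_commute)
          moreover have "norm x - norm z \<le> norm (z - x)" using norm_triangle_ineq2[of x z] by (simp add: norm_minus_commute)
          ultimately show ?thesis using \<delta> by (simp add: gz \<delta>_def)
        qed
      qed
      also have "\<dots> = E * (2 ^ CARD('n) * \<omega>) * real (k + 1) / \<tau> ^ (CARD('n) - 1) + E * (fact CARD('n) * K ^ CARD('n) * measure lborel \<Omega>) * \<tau>"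
        unfolding E_def \<omega>_def by (simp add: distrib_left mult_ac)
      also have "\<dots> < (\<omega> * s' ^ CARD('n)) * (2 * real k * ln 2 - ln 512)" by (rule less)
      also have "2 * real k * ln 2 - ln 512 = ln (1 / (128 * d\<^sup>2))"
      proof -
        have "1 / (128 * d\<^sup>2) = 2 ^ (2 * k) / 512"
          by (simp add: d_def power_divide power_mult power2_eq_square power_mult_distrib[symmetric])
        then have "ln (1 / (128 * d\<^sup>2)) = ln (2 ^ (2 * k)) - ln 512"
          by (simp only:) (rule ln_divide_pos; simp)
        moreover have "ln (2 ^ (2 * k) :: real) = 2 * real k * ln 2" by (subst ln_realpow) auto
        ultimately show ?thesis by simp
      qed
      finally show False by (simp add: \<omega>_def mult_ac)
    qed
  qed
qed

section \<open>From the gradient bound to boundary values\<close>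

lemma has_laplacian_cong:
  assumes u: "has_laplacian u l x" and U: "open U" "x \<in> U" and eq: "\<And>z. z \<in> U \<Longrightarrow> u z = v z"
  shows "has_laplacian v l x"
proof -
  obtain g gg where g: "\<And>i. \<forall>\<^sub>F t in nhds 0. ((\<lambda>t. u (x + t *\<^sub>R axis i 1)) has_real_derivative g i t) (at t)"
    "\<And>i. (g i has_real_derivative gg i) (at 0)" "l = (\<Sum>i\<in>UNIV. gg i)"
    using u unfolding has_laplacian_def by blast
  show ?thesis
  proof (rule has_laplacianI[OF _ g(2,3)])
    fix i
    define S where "S = (\<lambda>t. x + t *\<^sub>R axis i 1) -` U"
    have S: "open S" unfolding S_def by (rule open_vimage[OF U(1)]) (intro continuous_intros)
    then have "\<forall>\<^sub>F t in nhds 0. t \<in> S" using U(2) by (intro eventually_nhds_in_open) (auto simp: S_def)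
    then show "\<forall>\<^sub>F t in nhds 0. ((\<lambda>t. v (x + t *\<^sub>R axis i 1)) has_real_derivative g i t) (at t)"
      using g(1)[of i]
    proof eventually_elim
      case (elim t)
      show ?case
        by (rule has_field_derivative_transform_within_open[OF elim(2) S elim(1)]) (simp add: S_def eq)
    qed
  qed
qed

lemma radial_approach:
  fixes w :: "real^'n"
  assumes "w \<in> cball 0 1"
  shows "(1 - inverse (real (Suc m))) *\<^sub>R w \<in> ball 0 1" "(\<lambda>m. (1 - inverse (real (Suc m))) *\<^sub>R w) \<longlonglongrightarrow> w"
proof -
  have p: "0 < inverse (real (Suc m))" "inverse (real (Suc m)) \<le> 1" by (auto simp: field_simps)
  then have "\<bar>1 - inverse (real (Suc m))\<bar> * norm w \<le> (1 - inverse (real (Suc m))) * 1"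
    using assms by (intro mult_mono) auto
  also have "\<dots> < 1" using p by simp
  finally show "(1 - inverse (real (Suc m))) *\<^sub>R w \<in> ball 0 1"
    by (simp only: mem_ball_0 norm_scaleR)
  have "(\<lambda>m. (1 - inverse (real (Suc m))) *\<^sub>R w) \<longlonglongrightarrow> (1 - 0) *\<^sub>R w"
    by (intro tendsto_intros LIMSEQ_inverse_real_of_nat)
  then show "(\<lambda>m. (1 - inverse (real (Suc m))) *\<^sub>R w) \<longlonglongrightarrow> w" by simp
qed

context harmonic_qc
begin

text \<open>Integrate the bound for the derivative along the radius; the exponent \<open>\<alpha> - 1\<close> is
  integrable at the sphere.\<close>

lemma radial_bound:
  assumes \<alpha>: "0 < \<alpha>" "\<alpha> < 1" and N: "0 \<le> N"
    and grad: "\<And>z. z \<in> ball 0 1 \<Longrightarrow> G z \<le> N * (1 - norm z) powr (\<alpha> - 1)"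
    and z: "z \<in> ball 0 1" and r: "0 < r" "r \<le> 1"
  shows "norm (f z - f ((1 - r) *\<^sub>R z)) \<le> N / \<alpha> * r powr \<alpha>"
proof -
  have inB: "t *\<^sub>R z \<in> ball 0 1" if "0 \<le> t" "t \<le> 1" for t
    using that z mult_left_le_one_le[of "norm z" t] by simp
  have "norm (f (1 *\<^sub>R z) - f ((1 - r) *\<^sub>R z)) \<le> - (N / \<alpha>) * (1 - 1) powr \<alpha> - (- (N / \<alpha>) * (1 - (1 - r)) powr \<alpha>)"
  proof (rule differentiable_bound_general[where f = "\<lambda>t. f (t *\<^sub>R z)" and \<phi> = "\<lambda>t. - (N / \<alpha>) * (1 - t) powr \<alpha>"
        and f' = "\<lambda>t. f' (t *\<^sub>R z) z" and \<phi>' = "\<lambda>t. N * (1 - t) powr (\<alpha> - 1)"])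
    show "1 - r < 1" using r by simp
    show "continuous_on {1 - r..1} (\<lambda>t. f (t *\<^sub>R z))"
      by (rule continuous_on_compose2[OF f_cont]) (use inB r in \<open>auto intro!: continuous_intros\<close>)
    have "continuous_on {1 - r..1} (\<lambda>t. (1 - t) powr \<alpha>)"
      by (rule continuous_on_powr') (use \<alpha> in \<open>auto intro!: continuous_intros\<close>)
    then show "continuous_on {1 - r..1} (\<lambda>t. - (N / \<alpha>) * (1 - t) powr \<alpha>)"
      by (intro continuous_on_mult continuous_on_const)
    fix t assume t: "1 - r < t" "t < 1"
    have t0: "0 \<le> t" "t \<le> 1" using t r by auto
    have "((\<lambda>t. t *\<^sub>R z) has_derivative (\<lambda>h. h *\<^sub>R z)) (at t)" by (auto intro!: derivative_eq_intros)
    from diff_chain_at[OF this deriv[OF inB[OF t0]]]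
    show "((\<lambda>t. f (t *\<^sub>R z)) has_vector_derivative f' (t *\<^sub>R z) z) (at t)"
      using linear_cmul[OF bounded_linear.linear[OF deriv_bl[OF inB[OF t0]]]]
      by (simp add: has_vector_derivative_def o_def)
    have "((\<lambda>t. 1 - t) has_real_derivative - 1) (at t)" by (auto intro!: derivative_eq_intros)
    from DERIV_cmult[OF DERIV_fun_powr[OF this, of \<alpha>], of "- (N / \<alpha>)"] t
    show "((\<lambda>t. - (N / \<alpha>) * (1 - t) powr \<alpha>) has_vector_derivative N * (1 - t) powr (\<alpha> - 1)) (at t)"
      using \<alpha> by (simp add: has_real_derivative_iff_has_vector_derivative[symmetric])
    have nz: "norm z < 1" using z by simp
    have tz: "t * norm z \<le> t" using nz t0 by (simp add: mult_left_le)
    have "norm (f' (t *\<^sub>R z) z) \<le> G (t *\<^sub>R z) * norm z" by (rule G_bound[OF inB[OF t0]])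
    also have "\<dots> \<le> (N * (1 - norm (t *\<^sub>R z)) powr (\<alpha> - 1)) * 1"
      using grad[OF inB[OF t0]] nz N by (intro mult_mono) auto
    also have "\<dots> \<le> N * (1 - t) powr (\<alpha> - 1)"
      using t0 t tz \<alpha> N by (simp add: mult_left_mono powr_mono2')
    finally show "norm (f' (t *\<^sub>R z) z) \<le> N * (1 - t) powr (\<alpha> - 1)" .
  qed
  then show ?thesis by simp
qed

text \<open>Move both points towards the centre by an amount comparable with their distance, and join
  them there, where the bound for the gradient is at most \<open>N * r powr (\<alpha> - 1)\<close>.\<close>

lemma holder_of_gradient:
  assumes \<alpha>: "0 < \<alpha>" "\<alpha> < 1" and N: "0 \<le> N"
    and grad: "\<And>z. z \<in> ball 0 1 \<Longrightarrow> G z \<le> N * (1 - norm z) powr (\<alpha> - 1)"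
    and z: "z \<in> ball 0 1" and w: "w \<in> ball 0 1"
  shows "norm (f z - f w) \<le> (2 / \<alpha> + 1) * N * norm (z - w) powr \<alpha>"
proof (cases "z = w")
  case False
  define r where "r = min 1 (norm (z - w))"
  have r: "0 < r" "r \<le> 1" "r \<le> norm (z - w)" using False by (auto simp: r_def)
  define z1 where "z1 = (1 - r) *\<^sub>R z"
  define w1 where "w1 = (1 - r) *\<^sub>R w"
  have a: "norm (f z - f z1) \<le> N / \<alpha> * r powr \<alpha>" unfolding z1_def by (rule radial_bound[OF \<alpha> N grad z r(1,2)])
  have b: "norm (f w - f w1) \<le> N / \<alpha> * r powr \<alpha>" unfolding w1_def by (rule radial_bound[OF \<alpha> N grad w r(1,2)])
  have c: "norm (f z1 - f w1) \<le> N * r powr \<alpha>"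
  proof (cases "r = 1")
    case True
    then show ?thesis using N by (simp add: z1_def w1_def)
  next
    case False
    then have rd: "r = norm (z - w)" by (auto simp: r_def min_def split: if_splits)
    have "norm (f z1 - f w1) \<le> N * r powr (\<alpha> - 1) * norm (z1 - w1)"
    proof (rule differentiable_bound[OF convex_cball[of 0 "1 - r"]])
      fix y :: "real^'n" assume y: "y \<in> cball 0 (1 - r)"
      then have yB: "y \<in> ball 0 1" using r by auto
      show "(f has_derivative f' y) (at y within cball 0 (1 - r))"
        by (rule has_derivative_at_withinI[OF deriv[OF yB]])
      have "G y \<le> N * (1 - norm y) powr (\<alpha> - 1)" by (rule grad[OF yB])
      also have "\<dots> \<le> N * r powr (\<alpha> - 1)" using y r \<alpha> N by (intro mult_left_mono powr_mono2') auto
      finally show "G y \<le> N * r powr (\<alpha> - 1)" .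
    qed (use z w r in \<open>auto simp: z1_def w1_def mult_left_le\<close>)
    also have "norm (z1 - w1) \<le> r"
    proof -
      have "z1 - w1 = (1 - r) *\<^sub>R (z - w)" by (simp add: z1_def w1_def algebra_simps)
      then have "norm (z1 - w1) = (1 - r) * r" using r by (simp add: rd)
      then show ?thesis using r by (simp add: mult_left_le_one_le)
    qed
    then have "N * r powr (\<alpha> - 1) * norm (z1 - w1) \<le> N * r powr (\<alpha> - 1) * r" using N by (intro mult_left_mono) auto
    also have "\<dots> = N * r powr \<alpha>" using r powr_mult_base[of r "\<alpha> - 1"] by (simp add: mult_ac)
    finally show ?thesis .
  qed
  have "norm (f z - f w) \<le> norm (f z - f z1) + norm (f z1 - f w1) + norm (f w - f w1)"
    using norm_triangle_ineq[of "f z - f z1" "f z1 - f w"] norm_triangle_ineq[of "f z1 - f w1" "f w1 - f w"]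
    by (simp add: norm_minus_commute)
  also have "\<dots> \<le> (2 / \<alpha> + 1) * N * r powr \<alpha>"
  proof -
    have "(2 / \<alpha> + 1) * N * r powr \<alpha> = 2 * (N / \<alpha> * r powr \<alpha>) + N * r powr \<alpha>"
      by (simp add: distrib_right)
    then show ?thesis using a b c by linarith
  qed
  also have "\<dots> \<le> (2 / \<alpha> + 1) * N * norm (z - w) powr \<alpha>"
    using r \<alpha> N by (intro mult_left_mono powr_mono2) auto
  finally show ?thesis .
qed simp

text \<open>A boundary point cannot go to a point of \<open>\<Omega>\<close>, since the inverse is continuous there.\<close>

lemma boundary_extension:
  obtains F where "continuous_on (cball 0 1) F" "\<And>z. z \<in> ball 0 1 \<Longrightarrow> F z = f z"
    "\<And>w. w \<in> sphere 0 1 \<Longrightarrow> F w \<in> frontier \<Omega>"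
proof -
  have "norm (f z - f w) \<le> Q * norm (z - w)" if "z \<in> ball 0 1" "w \<in> ball 0 1" for z w
    by (rule differentiable_bound[OF convex_ball[of 0 1] has_derivative_at_withinI[OF deriv] Q]) (use that in auto)
  moreover have "0 \<le> Q" using Q[of 0] G_nonneg[of 0] by simp
  ultimately have "Q-lipschitz_on (ball 0 1) f" by (intro lipschitz_onI) (auto simp: dist_norm)
  then have "uniformly_continuous_on (ball 0 1) f" by (rule lipschitz_on_uniformly_continuous)
  then obtain F where F: "uniformly_continuous_on (closure (ball 0 1)) F" "\<And>z. z \<in> ball 0 1 \<Longrightarrow> f z = F z"
    using uniformly_continuous_on_extension_on_closure by metis
  have cF: "continuous_on (cball 0 1) F" using uniformly_continuous_imp_continuous[OF F(1)] by simp
  show ?thesis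
  proof (rule that[OF cF])
    show "F z = f z" if "z \<in> ball 0 1" for z using F(2)[OF that] by simp
    fix w :: "real^'n" assume w: "w \<in> sphere 0 1"
    then have wc: "w \<in> cball 0 1" by simp
    define z where "z m = (1 - inverse (real (Suc m))) *\<^sub>R w" for m
    have zB: "z m \<in> ball 0 1" for m unfolding z_def by (rule radial_approach(1)[OF wc])
    have zlim: "z \<longlonglongrightarrow> w" unfolding z_def[abs_def] by (rule radial_approach(2)[OF wc])
    have "(\<lambda>m. F (z m)) \<longlonglongrightarrow> F w"
      by (rule continuous_on_tendsto_compose[OF cF zlim wc])
         (rule always_eventually, rule allI, rule subsetD[OF ball_subset_cball zB])
    then have flim: "(\<lambda>m. f (z m)) \<longlonglongrightarrow> F w" using F(2)[OF zB] by simp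
    have fz: "f (z m) \<in> \<Omega>" for m using zB f_im by blast
    have "F w \<in> closure \<Omega>"
      unfolding closure_sequential using flim fz by (intro exI[of _ "\<lambda>m. f (z m)"]) simp
    moreover have "F w \<notin> \<Omega>"
    proof
      assume Fw: "F w \<in> \<Omega>"
      have "(\<lambda>m. g (f (z m))) \<longlonglongrightarrow> g (F w)"
        by (rule continuous_on_tendsto_compose[OF g_cont flim Fw])
           (rule always_eventually, rule allI, rule fz)
      then have "z \<longlonglongrightarrow> g (F w)" using gf[OF zB] by simp
      then have "w = g (F w)" by (rule LIMSEQ_unique[OF zlim])
      then have "w \<in> ball 0 1" using g_im Fw by blast
      then show False using w by simp
    qed
    ultimately show "F w \<in> frontier \<Omega>" using open_image by (simp add: frontier_def interior_open)
  qed
qed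

text \<open>The assumption \<open>near\<close> says that \<open>x\<close> is almost extremal for the weighted gradient
  bound \<open>grad\<close>. The larger exponent \<open>\<gamma>\<close>, still below \<open>1\<close>, is used for distant boundary points: at
  distance more than \<open>R\<close> from \<open>a\<close>, a power \<open>\<alpha>\<close> of the distance is at most \<open>R powr (\<alpha> - \<gamma>)\<close> times the power \<open>\<gamma>\<close>, and the
  barrier of exponent \<open>\<gamma>\<close> is small at the scale \<open>d\<close> compared with \<open>R\<close>.\<close>

lemma extremal_point_contradiction:
  fixes \<alpha> \<epsilon> \<epsilon>\<^sub>0 \<rho> N :: real
  defines "\<gamma> \<equiv> (1 + \<alpha>) / 2" and "C \<equiv> 2 / \<alpha> + 1" and "A \<equiv> \<lambda>\<beta>. (real CARD('n) - 2 + \<beta>) / (1 - \<beta>)"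
  assumes n: "2 \<le> CARD('n)" and \<alpha>: "0 < \<alpha>" "\<alpha> < 1" and \<epsilon>: "0 < \<epsilon>" "0 < \<epsilon>\<^sub>0"
    and flat: "\<And>q. q \<in> frontier \<Omega> \<Longrightarrow> \<exists>v. norm v = 1 \<and>
       (\<forall>p\<in>frontier \<Omega>. norm (p - q) < \<rho> \<longrightarrow> \<bar>(p - q) \<bullet> v\<bar> \<le> \<epsilon> * norm (p - q))"
    and N: "0 < N" and grad: "\<And>z. z \<in> ball 0 1 \<Longrightarrow> G z \<le> N * (1 - norm z) powr (\<alpha> - 1)"
    and x: "x \<in> ball 0 1" "x \<noteq> 0" and near: "N * (1 - norm x) powr (\<alpha> - 1) \<le> 2 * G x"
    and small: "2 * C * \<epsilon>\<^sub>0 powr (- \<alpha>) * ((1 - norm x) * G x) < \<rho>"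
    and theta: "16 * (real CARD('n))\<^sup>2 * K * C * (\<epsilon> * (1 + A \<alpha>) + \<epsilon>\<^sub>0 powr (\<gamma> - \<alpha>) * (1 + A \<gamma>)) < 1"
  shows False
proof -
  obtain F where cF: "continuous_on (cball 0 1) F" and Ff: "\<And>z. z \<in> ball 0 1 \<Longrightarrow> F z = f z"
    and Fb: "\<And>w. w \<in> sphere 0 1 \<Longrightarrow> F w \<in> frontier \<Omega>"
    using boundary_extension by blast
  have \<gamma>: "0 < \<gamma>" "\<gamma> < 1" "\<alpha> < \<gamma>" using \<alpha> by (auto simp: \<gamma>_def)
  have C: "0 < C" using \<alpha> by (simp add: C_def add_pos_pos)
  have A: "0 \<le> A \<alpha>" "0 \<le> A \<gamma>" using n \<alpha> \<gamma> by (auto simp: A_def)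
  define d where "d = 1 - norm x"
  have d: "0 < d" using x by (simp add: d_def)
  have Gx: "0 < G x"
  proof -
    have "0 < N * d powr (\<alpha> - 1)" using N d by simp
    then show ?thesis using near by (simp add: d_def)
  qed
  have Nd: "N * d powr \<alpha> \<le> 2 * (d * G x)"
  proof -
    have "N * d powr \<alpha> = d * (N * d powr (\<alpha> - 1))"
      using d powr_mult_base[of d "\<alpha> - 1"] by (simp add: mult_ac)
    also have "\<dots> \<le> d * (2 * G x)" using near d by (intro mult_left_mono) (auto simp: d_def)
    finally show ?thesis by simp
  qed
  define a where "a = (1 / norm x) *\<^sub>R x"
  have a: "norm a = 1" using x by (simp add: a_def)
  have xa: "norm (x - a) = d"
  proof -
    have "x = norm x *\<^sub>R a" using x by (simp add: a_def)
    then have "x - a = (norm x - 1) *\<^sub>R a" by (metis scaleR_left_diff_distrib scaleR_one)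
    then show ?thesis using a x by (simp add: d_def)
  qed
  define q where "q = F a"
  have q: "q \<in> frontier \<Omega>" unfolding q_def by (rule Fb) (use a in simp)
  obtain v where v: "norm v = 1" "\<And>p. p \<in> frontier \<Omega> \<Longrightarrow> norm (p - q) < \<rho> \<Longrightarrow> \<bar>(p - q) \<bullet> v\<bar> \<le> \<epsilon> * norm (p - q)"
    using flat[OF q] by blast
  have hold: "norm (F w - q) \<le> C * N * norm (w - a) powr \<alpha>" if w: "w \<in> sphere 0 1" for w
  proof -
    define c where "c m = 1 - inverse (real (Suc m))" for m
    have c: "0 \<le> c m" "c m \<le> 1" for m by (auto simp: c_def field_simps)
    have wc: "w \<in> cball 0 1" and ac: "a \<in> cball 0 1" using w a by auto
    have l1: "(\<lambda>m. F (c m *\<^sub>R w)) \<longlonglongrightarrow> F w"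
      unfolding c_def
      by (rule continuous_on_tendsto_compose[OF cF radial_approach(2)[OF wc] wc])
         (rule always_eventually, rule allI, rule subsetD[OF ball_subset_cball radial_approach(1)[OF wc]])
    have l2: "(\<lambda>m. F (c m *\<^sub>R a)) \<longlonglongrightarrow> F a"
      unfolding c_def
      by (rule continuous_on_tendsto_compose[OF cF radial_approach(2)[OF ac] ac])
         (rule always_eventually, rule allI, rule subsetD[OF ball_subset_cball radial_approach(1)[OF ac]])
    have "norm (F (c m *\<^sub>R w) - F (c m *\<^sub>R a)) \<le> C * N * norm (w - a) powr \<alpha>" for m
    proof -
      have B: "c m *\<^sub>R w \<in> ball 0 1" "c m *\<^sub>R a \<in> ball 0 1"
        unfolding c_def by (rule radial_approach(1)[OF wc], rule radial_approach(1)[OF ac])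
      have "norm (f (c m *\<^sub>R w) - f (c m *\<^sub>R a)) \<le> C * N * norm (c m *\<^sub>R w - c m *\<^sub>R a) powr \<alpha>"
        unfolding C_def by (rule holder_of_gradient[OF \<alpha> less_imp_le[OF N] grad B])
      also have "norm (c m *\<^sub>R w - c m *\<^sub>R a) = c m * norm (w - a)"
        using c[of m] by (simp add: scaleR_right_diff_distrib[symmetric])
      also have "C * N * (c m * norm (w - a)) powr \<alpha> \<le> C * N * norm (w - a) powr \<alpha>"
        using c[of m] C N \<alpha> by (intro mult_left_mono powr_mono2) (auto simp: mult_left_le_one_le)
      finally show ?thesis by (simp only: Ff B)
    qed
    then have "norm (F w - F a) \<le> C * N * norm (w - a) powr \<alpha>"
      by (intro LIMSEQ_le_const2[OF tendsto_norm[OF tendsto_diff[OF l1 l2]]]) auto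
    then show ?thesis by (simp add: q_def)
  qed
  \<comment> \<open>boundary points within \<open>R\<close> of \<open>a\<close> are mapped into the flat part of the boundary near \<open>q\<close>\<close>
  define R where "R = d / \<epsilon>\<^sub>0"
  have R: "0 < R" using d \<epsilon> by (simp add: R_def)
  define c\<^sub>1 where "c\<^sub>1 = \<epsilon> * (C * N)"
  define c\<^sub>2 where "c\<^sub>2 = C * N * R powr (\<alpha> - \<gamma>)"
  have c0: "0 \<le> c\<^sub>1" "0 \<le> c\<^sub>2" using \<epsilon> C N by (auto simp: c\<^sub>1_def c\<^sub>2_def)
  have bd: "\<bar>(F w - q) \<bullet> v\<bar> \<le> c\<^sub>1 * norm (w - a) powr \<alpha> + c\<^sub>2 * norm (w - a) powr \<gamma>" if w: "w \<in> sphere 0 1" for w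
  proof (cases "norm (w - a) \<le> R")
    case True
    have "norm (F w - q) \<le> C * N * norm (w - a) powr \<alpha>" by (rule hold[OF w])
    also have "\<dots> \<le> C * N * R powr \<alpha>" using True C N \<alpha> by (intro mult_left_mono powr_mono2) auto
    also have "\<dots> = C * \<epsilon>\<^sub>0 powr (- \<alpha>) * (N * d powr \<alpha>)"
      using d \<epsilon> by (simp add: R_def powr_divide powr_minus_divide)
    also have "\<dots> \<le> C * \<epsilon>\<^sub>0 powr (- \<alpha>) * (2 * (d * G x))" using Nd C by (intro mult_left_mono) auto
    also have "\<dots> < \<rho>" using small by (simp add: d_def mult_ac)
    finally have "\<bar>(F w - q) \<bullet> v\<bar> \<le> \<epsilon> * norm (F w - q)" by (rule v(2)[OF Fb[OF w]])
    also have "\<dots> \<le> \<epsilon> * (C * N * norm (w - a) powr \<alpha>)" using hold[OF w] \<epsilon> by (intro mult_left_mono) auto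
    finally show ?thesis using c0 by (simp add: c\<^sub>1_def mult.assoc add_increasing2)
  next
    case False
    then have wa: "R < norm (w - a)" by simp
    have "\<bar>(F w - q) \<bullet> v\<bar> \<le> norm (F w - q)" using Cauchy_Schwarz_ineq2[of "F w - q" v] v(1) by simp
    also have "\<dots> \<le> C * N * norm (w - a) powr \<alpha>" by (rule hold[OF w])
    also have "norm (w - a) powr \<alpha> = norm (w - a) powr (\<alpha> - \<gamma>) * norm (w - a) powr \<gamma>"
      by (simp add: powr_add[symmetric])
    also have "C * N * (norm (w - a) powr (\<alpha> - \<gamma>) * norm (w - a) powr \<gamma>) \<le> C * N * (R powr (\<alpha> - \<gamma>) * norm (w - a) powr \<gamma>)"
      using wa R C N \<gamma> by (intro mult_left_mono mult_right_mono powr_mono2') auto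
    finally show ?thesis using c0 by (simp add: c\<^sub>2_def mult.assoc add_increasing)
  qed
  have lap: "has_laplacian (\<lambda>z. (F z - q) \<bullet> v) 0 z" if z: "z \<in> ball 0 1" for z
  proof (rule has_laplacian_cong[OF _ open_ball z])
    show "has_laplacian (\<lambda>z. f z \<bullet> v - q \<bullet> v) 0 z"
      using has_laplacian_diff[of "\<lambda>z. f z \<bullet> v" 0 z, OF _ has_laplacian_const] harm z
      by (auto simp: harmonic_with_derivative_def)
  qed (simp add: Ff inner_diff_left)
  have cu: "continuous_on (cball 0 1) (\<lambda>z. (F z - q) \<bullet> v)" by (intro continuous_intros cF)
  have ub: "\<bar>(F z - q) \<bullet> v\<bar> \<le> c\<^sub>1 * barrier a \<alpha> z + c\<^sub>2 * barrier a \<gamma> z" if z: "z \<in> ball 0 1" for z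
  proof -
    have "(F z - q) \<bullet> v \<le> c\<^sub>1 * barrier a \<alpha> z + c\<^sub>2 * barrier a \<gamma> z"
      by (rule harmonic_le_barrier[OF n a \<alpha> \<gamma>(1,2) c0 cu lap _ z]) (use bd in \<open>auto simp: abs_le_iff\<close>)
    moreover have "- ((F z - q) \<bullet> v) \<le> c\<^sub>1 * barrier a \<alpha> z + c\<^sub>2 * barrier a \<gamma> z"
    proof (rule harmonic_le_barrier[OF n a \<alpha> \<gamma>(1,2) c0 _ _ _ z])
      show "continuous_on (cball 0 1) (\<lambda>z. - ((F z - q) \<bullet> v))" by (intro continuous_intros cu)
      show "has_laplacian (\<lambda>z. - ((F z - q) \<bullet> v)) 0 z" if "z \<in> ball 0 1" for z
        using has_laplacian_uminus[OF lap[OF that]] by simp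
    qed (use bd in \<open>auto simp: abs_le_iff\<close>)
    ultimately show ?thesis by (simp add: abs_le_iff)
  qed
  define B where "B = \<epsilon> * (1 + A \<alpha>) + \<epsilon>\<^sub>0 powr (\<gamma> - \<alpha>) * (1 + A \<gamma>)"
  have B0: "0 \<le> B" using \<epsilon> A by (simp add: B_def)
  define M where "M = 2 * C * (N * d powr \<alpha>) * B"
  have sub: "ball x (d / 2) \<subseteq> ball 0 1" by (rule ball_subset_unit_ball[OF x(1)]) (use d in \<open>simp add: d_def\<close>)
  have MM: "\<bar>f z \<bullet> v - q \<bullet> v\<bar> \<le> M" if z: "z \<in> ball x (d / 2)" for z
  proof -
    have zB: "z \<in> ball 0 1" using z sub by blast
    have "norm (z - a) \<le> norm (z - x) + norm (x - a)" using norm_triangle_ineq[of "z - x" "x - a"] by simp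
    then have za: "norm (z - a) \<le> 2 * d" using z xa d by (simp add: dist_norm norm_minus_commute)
    have p2: "(2 * d) powr \<beta> \<le> 2 * d powr \<beta>" if "0 < \<beta>" "\<beta> < 1" for \<beta>
    proof -
      have "(2::real) powr \<beta> \<le> 2 powr 1" using that by (intro powr_mono) auto
      then show ?thesis using d by (simp add: powr_mult mult_right_mono)
    qed
    have "c\<^sub>1 * barrier a \<alpha> z \<le> c\<^sub>1 * ((1 + A \<alpha>) * (2 * d powr \<alpha>))"
    proof (rule mult_left_mono[OF _ c0(1)])
      have "barrier a \<alpha> z \<le> (1 + A \<alpha>) * (2 * d) powr \<alpha>"
        unfolding A_def by (rule barrier_le[OF n a \<alpha> zB za])
      also have "\<dots> \<le> (1 + A \<alpha>) * (2 * d powr \<alpha>)" using p2[OF \<alpha>] A by (intro mult_left_mono) auto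
      finally show "barrier a \<alpha> z \<le> (1 + A \<alpha>) * (2 * d powr \<alpha>)" .
    qed
    moreover have "c\<^sub>2 * barrier a \<gamma> z \<le> c\<^sub>2 * ((1 + A \<gamma>) * (2 * d powr \<gamma>))"
    proof (rule mult_left_mono[OF _ c0(2)])
      have "barrier a \<gamma> z \<le> (1 + A \<gamma>) * (2 * d) powr \<gamma>"
        unfolding A_def by (rule barrier_le[OF n a \<gamma>(1,2) zB za])
      also have "\<dots> \<le> (1 + A \<gamma>) * (2 * d powr \<gamma>)" using p2[OF \<gamma>(1,2)] A by (intro mult_left_mono) auto
      finally show "barrier a \<gamma> z \<le> (1 + A \<gamma>) * (2 * d powr \<gamma>)" .
    qed
    moreover have "c\<^sub>1 * ((1 + A \<alpha>) * (2 * d powr \<alpha>)) + c\<^sub>2 * ((1 + A \<gamma>) * (2 * d powr \<gamma>)) = M"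
    proof -
      have "R powr (\<alpha> - \<gamma>) * d powr \<gamma> = \<epsilon>\<^sub>0 powr (\<gamma> - \<alpha>) * d powr \<alpha>"
      proof -
        have "R powr (\<alpha> - \<gamma>) = d powr (\<alpha> - \<gamma>) * \<epsilon>\<^sub>0 powr (\<gamma> - \<alpha>)"
          using d \<epsilon> powr_minus_divide[of \<epsilon>\<^sub>0 "\<alpha> - \<gamma>"] by (simp add: R_def powr_divide)
        moreover have "d powr (\<alpha> - \<gamma>) * d powr \<gamma> = d powr \<alpha>" by (simp add: powr_add[symmetric])
        ultimately show ?thesis by (simp add: mult_ac)
      qed
      moreover have "c\<^sub>2 * ((1 + A \<gamma>) * (2 * d powr \<gamma>)) = C * N * (1 + A \<gamma>) * 2 * (R powr (\<alpha> - \<gamma>) * d powr \<gamma>)"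
        by (simp add: c\<^sub>2_def mult_ac)
      ultimately have "c\<^sub>2 * ((1 + A \<gamma>) * (2 * d powr \<gamma>)) = C * N * (1 + A \<gamma>) * 2 * (\<epsilon>\<^sub>0 powr (\<gamma> - \<alpha>) * d powr \<alpha>)"
        by (simp only:)
      then show ?thesis by (simp add: c\<^sub>1_def M_def B_def algebra_simps)
    qed
    moreover have "f z \<bullet> v - q \<bullet> v = (F z - q) \<bullet> v" by (simp add: Ff[OF zB] inner_diff_left)
    ultimately show ?thesis using ub[OF zB] by simp
  qed
  have lin: "linear (f' x)" using deriv_bl[OF x(1)] bounded_linear.linear by blast
  have inj: "inj (f' x)" by (rule derivative_inj[OF x(1) Gx])
  \<comment> \<open>a preimage of the normal is short, so the derivative of \<open>f \<bullet> v\<close> is large in its direction\<close>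
  obtain k where k: "f' x k = v" using linear_injective_imp_surjective[OF lin inj] by (metis surjD)
  have nk: "norm k \<le> K / G x" using qc[OF x(1), of k] k v Gx by (simp add: field_simps)
  have "\<bar>f' x k \<bullet> v\<bar> \<le> 2 * (real CARD('n))\<^sup>2 * M / (d / 2) * norm k"
  proof (rule harmonic_gradient_bound[where u = "\<lambda>z. f z \<bullet> v - q \<bullet> v"])
    show "continuous_on (ball x (d / 2)) (\<lambda>z. f z \<bullet> v - q \<bullet> v)"
      by (intro continuous_intros continuous_on_subset[OF f_cont sub])
    show "has_laplacian (\<lambda>z. f z \<bullet> v - q \<bullet> v) 0 z" if "z \<in> ball x (d / 2)" for z
      using has_laplacian_diff[of "\<lambda>z. f z \<bullet> v" 0 z, OF _ has_laplacian_const] harm sub that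
      by (auto simp: harmonic_with_derivative_def)
    show "((\<lambda>z. f z \<bullet> v - q \<bullet> v) has_derivative (\<lambda>h. f' x h \<bullet> v)) (at x)"
      using deriv[OF x(1)] by (auto intro!: derivative_eq_intros)
  qed (use d MM in auto)
  then have "1 \<le> 2 * (real CARD('n))\<^sup>2 * M / (d / 2) * norm k" using k v(1) by (simp add: dot_square_norm)
  also have "\<dots> \<le> 2 * (real CARD('n))\<^sup>2 * M / (d / 2) * (K / G x)"
    using nk d C N B0 by (intro mult_left_mono) (auto simp: M_def)
  finally have "d * G x \<le> 4 * (real CARD('n))\<^sup>2 * K * M" using d Gx by (simp add: field_simps)
  also have "\<dots> = 8 * (real CARD('n))\<^sup>2 * K * C * B * (N * d powr \<alpha>)" by (simp add: M_def)
  also have "\<dots> \<le> 8 * (real CARD('n))\<^sup>2 * K * C * B * (2 * (d * G x))"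
    using Nd K C B0 by (intro mult_left_mono) auto
  also have "\<dots> = (16 * (real CARD('n))\<^sup>2 * K * C * B) * (d * G x)" by simp
  also have "\<dots> < 1 * (d * G x)"
    using theta d Gx unfolding B_def by (intro mult_strict_right_mono) auto
  finally show False by simp
qed

end

section \<open>Uniform Hoelder continuity\<close>

lemma stretch_bounds:
  assumes "bounded_linear A"
  shows "norm (A h) \<le> max_stretch A * norm h" "min_stretch A * norm h \<le> norm (A h)"
proof -
  have bA: "bdd_above ((\<lambda>h. norm (A h)) ` sphere 0 1)"
    using onorm[OF assms] by (intro bdd_aboveI2[of _ _ "onorm A"]) (metis mem_sphere_0 mult.right_neutral)
  have bB: "bdd_below ((\<lambda>h. norm (A h)) ` sphere 0 1)" by (intro bdd_belowI2[of _ 0]) auto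
  have "norm (A h) \<le> max_stretch A * norm h \<and> min_stretch A * norm h \<le> norm (A h)"
  proof (cases "h = 0")
    case True
    then show ?thesis using linear_0[OF bounded_linear.linear[OF assms]] by simp
  next
    case False
    define e where "e = (1 / norm h) *\<^sub>R h"
    have e: "e \<in> sphere 0 1" using False by (simp add: e_def)
    have "h = norm h *\<^sub>R e" using False by (simp add: e_def)
    then have Ah: "norm (A h) = norm (A e) * norm h"
      using linear_cmul[OF bounded_linear.linear[OF assms], of "norm h" e] by (metis abs_norm_cancel mult.commute norm_scaleR)
    have "norm (A e) \<le> max_stretch A" unfolding max_stretch_def by (rule cSUP_upper[OF e bA])
    moreover have "min_stretch A \<le> norm (A e)" unfolding min_stretch_def by (rule cINF_lower[OF bB e])
    ultimately show ?thesis by (simp add: Ah mult_right_mono)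
  qed
  then show "norm (A h) \<le> max_stretch A * norm h" "min_stretch A * norm h \<le> norm (A h)" by auto
qed

text \<open>The Lipschitz constant enters only through the bound \<open>Q\<close>, which the gradient estimate provides.\<close>

lemma harmonic_qc_intro:
  fixes f :: "real^'n \<Rightarrow> real^'n"
  assumes op: "open \<Omega>" and K: "1 \<le> K" and qc: "quasiconformal K (ball 0 1) \<Omega> f"
    and harm: "harmonic_mapping_on (ball 0 1) f" and lip: "L-lipschitz_on (ball 0 1) f"
  obtains g where "harmonic_qc \<Omega> f g (\<lambda>x. frechet_derivative f (at x)) K (2 * (real CARD('n))\<^sup>2 * L)"
proof -
  obtain g where g: "homeomorphism (ball 0 1) \<Omega> f g" using qc unfolding quasiconformal_def by blast
  define f' where "f' x = frechet_derivative f (at x)" for x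
  have der: "(f has_derivative f' x) (at x)" if "x \<in> ball 0 1" for x
    using qc that unfolding quasiconformal_def f'_def by (simp add: frechet_derivative_works[symmetric])
  have lap: "has_laplacian (\<lambda>z. f z \<bullet> e) 0 x" if x: "x \<in> ball 0 1" for x e
  proof -
    have "has_laplacian (\<lambda>z. f z $ j) 0 x" for j
      using has_laplacian_harmonic_function[OF _ open_ball x, of "\<lambda>z. f z $ j"] harm
      unfolding harmonic_mapping_on_def by blast
    then have "has_laplacian (\<lambda>z. \<Sum>j\<in>UNIV. e $ j * f z $ j) (\<Sum>j\<in>UNIV. e $ j * 0) x"
      by (intro has_laplacian_sum has_laplacian_cmult) auto
    then show ?thesis by (simp add: inner_vec_def mult.commute)
  qed
  have H: "harmonic_with_derivative (ball 0 1) f f'"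
    unfolding harmonic_with_derivative_def using der lap by blast
  show ?thesis
  proof (rule that[of g], fold f'_def, unfold_locales)
    fix x h :: "real^'n" assume x: "x \<in> ball 0 1"
    have bl: "bounded_linear (f' x)" using der[OF x] has_derivative_bounded_linear by blast
    have "onorm (f' x) \<le> max_stretch (f' x)" by (rule onorm_le) (rule stretch_bounds(1)[OF bl])
    also have "\<dots> \<le> K * min_stretch (f' x)" using qc x unfolding quasiconformal_def f'_def by blast
    finally have "onorm (f' x) * norm h \<le> K * min_stretch (f' x) * norm h" by (rule mult_right_mono) simp
    also have "\<dots> \<le> K * norm (f' x h)"
      using stretch_bounds(2)[OF bl, of h] K by (simp add: mult.assoc mult_left_mono)
    finally show "onorm (f' x) * norm h \<le> K * norm (f' x h)" .
  next
    fix x :: "real^'n" assume x: "x \<in> ball 0 1"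
    define r where "r = 1 - norm x"
    have r: "0 < r" using x by (simp add: r_def)
    have sub: "ball x r \<subseteq> ball 0 1" by (rule ball_subset_unit_ball[OF x]) (simp add: r_def)
    show "onorm (f' x) \<le> 2 * (real CARD('n))\<^sup>2 * L"
    proof (rule onorm_le)
      fix k
      have "norm (f' x k) \<le> 2 * (real CARD('n))\<^sup>2 * (L * r) / r * norm k"
      proof (rule vector_gradient_bound[OF r, where c = "f x" and f = f and f' = f' and x = x])
        show "harmonic_with_derivative (ball x r) f f'"
          using H sub by (auto simp: harmonic_with_derivative_def)
        show "norm (f z - f x) \<le> L * r" if z: "z \<in> ball x r" for z
        proof -
          have "norm (f z - f x) \<le> L * norm (z - x)"
            using lipschitz_onD[OF lip subsetD[OF sub z] x] by (simp add: dist_norm)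
          also have "\<dots> \<le> L * r"
            using z lipschitz_on_nonneg[OF lip] by (intro mult_left_mono) (auto simp: dist_norm norm_minus_commute)
          finally show ?thesis .
        qed
      qed
      then show "norm (f' x k) \<le> 2 * (real CARD('n))\<^sup>2 * L * norm k" using r by simp
    qed
  qed (use op g H K in auto)
qed

theorem theorem1p2:
  fixes \<Omega> :: "(real^'n) set" and b :: "real^'n" and \<alpha> K :: real
  assumes "CARD('n) \<ge> 3"
    and "open \<Omega>" and "connected \<Omega>" and "has_C1_boundary \<Omega>"
    and "b \<in> \<Omega>"
    and "0 < \<alpha>" and "\<alpha> < 1"
    and "K \<ge> 1"
  shows "\<exists>M::real. \<forall>f :: real^'n \<Rightarrow> real^'n.
           quasiconformal K (ball 0 1) \<Omega> f \<and> harmonic_mapping_on (ball 0 1) f \<and>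
           (\<exists>L. L-lipschitz_on (ball 0 1) f) \<and> f 0 = b
           \<longrightarrow> (\<forall>x\<in>ball 0 1. \<forall>y\<in>ball 0 1. norm (f x - f y) \<le> M * norm (x - y) powr \<alpha>)"
proof -
  note n = assms(1) and op = assms(2) and C1 = assms(4) and b = assms(5) and \<alpha> = assms(6,7) and K = assms(8)
  have n2: "2 \<le> CARD('n)" using n by simp
  have bd: "bounded \<Omega>"
  proof -
    obtain \<Phi> \<Psi> :: "real^'n \<Rightarrow> real^'n" where "homeomorphism (cball 0 1) (closure \<Omega>) \<Phi> \<Psi>"
      using C1 unfolding has_C1_boundary_def C1_diffeomorphism_def by blast
    then have "compact (closure \<Omega>)"
      using compact_continuous_image[of "cball 0 1" \<Phi>] by (auto simp: homeomorphism_def)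
    then show ?thesis using compact_imp_bounded bounded_subset closure_subset by blast
  qed
  obtain D where D: "0 < D" "\<And>p. p \<in> \<Omega> \<Longrightarrow> norm p \<le> D" using bd unfolding bounded_pos by blast
  define \<gamma> where "\<gamma> = (1 + \<alpha>) / 2"
  define C where "C = 2 / \<alpha> + 1"
  define A where "A \<beta> = (real CARD('n) - 2 + \<beta>) / (1 - \<beta>)" for \<beta>
  have \<gamma>: "0 < \<gamma>" "\<gamma> < 1" "\<alpha> < \<gamma>" using \<alpha> by (auto simp: \<gamma>_def)
  have C: "0 < C" using \<alpha> by (simp add: C_def add_pos_pos)
  have A: "0 \<le> A \<alpha>" "0 \<le> A \<gamma>" using n \<alpha> \<gamma> by (auto simp: A_def)
  define X where "X = 16 * (real CARD('n))\<^sup>2 * K * C"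
  have X: "0 < X" using n K C by (simp add: X_def)
  \<comment> \<open>multiplied by \<open>X\<close>, each of the two summands in \<open>theta\<close> becomes \<open>1/4\<close>\<close>
  define \<epsilon> where "\<epsilon> = 1 / (4 * X * (1 + A \<alpha>))"
  define \<epsilon>\<^sub>1 where "\<epsilon>\<^sub>1 = 1 / (4 * X * (1 + A \<gamma>))"
  define \<epsilon>\<^sub>0 where "\<epsilon>\<^sub>0 = \<epsilon>\<^sub>1 powr (1 / (\<gamma> - \<alpha>))"
  have \<epsilon>: "0 < \<epsilon>" "0 < \<epsilon>\<^sub>1" using X A by (auto simp: \<epsilon>_def \<epsilon>\<^sub>1_def)
  have \<epsilon>0: "0 < \<epsilon>\<^sub>0" using \<epsilon> by (simp add: \<epsilon>\<^sub>0_def)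
  have \<epsilon>\<^sub>0pow: "\<epsilon>\<^sub>0 powr (\<gamma> - \<alpha>) = \<epsilon>\<^sub>1" using \<epsilon> \<gamma> by (simp add: \<epsilon>\<^sub>0_def powr_powr)
  have theta: "16 * (real CARD('n))\<^sup>2 * K * C * (\<epsilon> * (1 + A \<alpha>) + \<epsilon>\<^sub>0 powr (\<gamma> - \<alpha>) * (1 + A \<gamma>)) < 1"
  proof -
    have "\<epsilon> * (1 + A \<alpha>) = 1 / (4 * X)" "\<epsilon>\<^sub>1 * (1 + A \<gamma>) = 1 / (4 * X)"
      using A by (auto simp: \<epsilon>_def \<epsilon>\<^sub>1_def)
    then have "X * (\<epsilon> * (1 + A \<alpha>) + \<epsilon>\<^sub>0 powr (\<gamma> - \<alpha>) * (1 + A \<gamma>)) = 1 / 2" using X by (simp add: \<epsilon>\<^sub>0pow distrib_left)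
    then show ?thesis unfolding X_def by simp
  qed
  obtain \<rho> where \<rho>: "0 < \<rho>"
    "\<And>q. q \<in> frontier \<Omega> \<Longrightarrow> \<exists>v. norm v = 1 \<and>
       (\<forall>p\<in>frontier \<Omega>. norm (p - q) < \<rho> \<longrightarrow> \<bar>(p - q) \<bullet> v\<bar> \<le> \<epsilon> * norm (p - q))"
    by (rule C1_boundary_flat[OF C1 op \<epsilon>(1)]) blast
  \<comment> \<open>images of boundary points within \<open>R\<close> then stay within \<open>\<rho>/2\<close> of \<open>q\<close>\<close>
  define \<eta> where "\<eta> = \<rho> / (4 * C * \<epsilon>\<^sub>0 powr (- \<alpha>))"
  have \<eta>: "0 < \<eta>" using \<rho>(1) C \<epsilon>0 by (simp add: \<eta>_def)
  obtain d\<^sub>0 where d\<^sub>0: "0 < d\<^sub>0"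
    "\<And>f g f' Q x. harmonic_qc \<Omega> f g f' K Q \<Longrightarrow> f 0 = b \<Longrightarrow> x \<in> ball 0 1 \<Longrightarrow> 1 - norm x < d\<^sub>0 \<Longrightarrow>
       (\<And>z. z \<in> ball x ((1 - norm x) / 2) \<Longrightarrow> onorm (f' z) \<le> 4 * onorm (f' x)) \<Longrightarrow>
       (1 - norm x) * onorm (f' x) \<le> \<eta>"
    by (rule conformal_scale_small[OF n op bd C1 b K \<eta>]) blast
  define d where "d = min d\<^sub>0 1"
  have d: "0 < d" "d \<le> d\<^sub>0" "d \<le> 1" using d\<^sub>0(1) by (auto simp: d_def)
  define N\<^sub>0 where "N\<^sub>0 = 4 * (real CARD('n))\<^sup>2 * D / d"
  show ?thesis
  proof (intro exI[of _ "C * N\<^sub>0"] allI impI, elim conjE exE)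
    fix f :: "real^'n \<Rightarrow> real^'n" and L
    assume qc: "quasiconformal K (ball 0 1) \<Omega> f" and harm: "harmonic_mapping_on (ball 0 1) f"
      and f0: "f 0 = b" and lip: "L-lipschitz_on (ball 0 1) f"
    obtain g where H: "harmonic_qc \<Omega> f g (\<lambda>x. frechet_derivative f (at x)) K (2 * (real CARD('n))\<^sup>2 * L)"
      by (rule harmonic_qc_intro[OF op K qc harm lip])
    interpret harmonic_qc \<Omega> f g "\<lambda>x. frechet_derivative f (at x)" K "2 * (real CARD('n))\<^sup>2 * L" by (rule H)
    define W where "W x = (1 - norm x) powr (1 - \<alpha>) * G x" for x
    have pos: "0 < 1 - norm x" "1 - norm x \<le> 1" if "x \<in> ball 0 1" for x :: "real^'n" using that by auto
    have Wle: "W x \<le> 2 * (real CARD('n))\<^sup>2 * L" if x: "x \<in> ball 0 1" for x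
    proof -
      have "(1 - norm x) powr (1 - \<alpha>) \<le> 1 powr (1 - \<alpha>)" using pos[OF x] \<alpha> by (intro powr_mono2) auto
      then have "W x \<le> 1 * G x" unfolding W_def using G_nonneg[OF x] by (intro mult_right_mono) auto
      then show ?thesis using Q[OF x] by simp
    qed
    \<comment> \<open>finite by the Lipschitz assumption; the rest of the proof bounds it by \<open>N\<^sub>0\<close>\<close>
    define N where "N = (SUP x\<in>ball 0 1. W x)"
    have bdd: "bdd_above (W ` ball 0 1)" using Wle by (intro bdd_aboveI2) auto
    have WN: "W x \<le> N" if "x \<in> ball 0 1" for x unfolding N_def by (rule cSUP_upper[OF that bdd])
    have N0: "0 \<le> N"
    proof -
      have "0 \<le> W 0" using G_nonneg[of 0] by (simp add: W_def)
      then show ?thesis using WN[of 0] by simp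
    qed
    have GW: "G x = W x * (1 - norm x) powr (\<alpha> - 1)" if x: "x \<in> ball 0 1" for x
    proof -
      have "(1 - norm x) powr (1 - \<alpha>) * (1 - norm x) powr (\<alpha> - 1) = 1"
        using pos(1)[OF x] by (simp add: powr_add[symmetric])
      then show ?thesis by (simp add: W_def mult_ac)
    qed
    have grad: "G x \<le> N * (1 - norm x) powr (\<alpha> - 1)" if x: "x \<in> ball 0 1" for x
      unfolding GW[OF x] by (rule mult_right_mono[OF WN[OF x]]) simp
    have NN: "N \<le> N\<^sub>0"
    proof (cases "N = 0")
      case True
      then show ?thesis using D d by (simp add: N\<^sub>0_def)
    next
      case False
      then have Npos: "0 < N" using N0 by simp
      have "\<exists>x\<in>ball 0 1. N / 2 < W x"
        using less_cSUP_iff[OF _ bdd, of "N / 2"] Npos unfolding N_def[symmetric] by auto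
      then obtain x where x: "x \<in> ball 0 1" "N / 2 < W x" by blast
      have near: "N * (1 - norm x) powr (\<alpha> - 1) \<le> 2 * G x"
        unfolding GW[OF x(1)] using mult_right_mono[of N "2 * W x" "(1 - norm x) powr (\<alpha> - 1)"] x(2) by simp
      have G4: "G z \<le> 4 * G x" if z: "z \<in> ball x ((1 - norm x) / 2)" for z
      proof -
        have nz: "(1 - norm x) / 2 \<le> 1 - norm z"
          using z norm_triangle_ineq2[of z x] by (simp add: dist_norm norm_minus_commute field_simps)
        have zB: "z \<in> ball 0 1" using nz pos(1)[OF x(1)] by simp
        have "G z \<le> N * (1 - norm z) powr (\<alpha> - 1)" by (rule grad[OF zB])
        also have "\<dots> \<le> N * ((1 - norm x) / 2) powr (\<alpha> - 1)"
          using nz pos(1)[OF x(1)] \<alpha> N0 by (intro mult_left_mono powr_mono2') auto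
        also have "((1 - norm x) / 2) powr (\<alpha> - 1) = (1 - norm x) powr (\<alpha> - 1) * 2 powr (1 - \<alpha>)"
          using pos(1)[OF x(1)] powr_minus_divide[of 2 "\<alpha> - 1"] by (simp add: powr_divide)
        also have "N * ((1 - norm x) powr (\<alpha> - 1) * 2 powr (1 - \<alpha>)) = (N * (1 - norm x) powr (\<alpha> - 1)) * 2 powr (1 - \<alpha>)"
          by simp
        also have "\<dots> \<le> (2 * G x) * 2"
        proof (rule mult_mono[OF near])
          have "(2::real) powr (1 - \<alpha>) \<le> 2 powr 1" using \<alpha> by (intro powr_mono) auto
          then show "(2::real) powr (1 - \<alpha>) \<le> 2" by simp
        qed (use G_nonneg[OF x(1)] in auto)
        finally show ?thesis by simp
      qed
      have far: "d \<le> 1 - norm x"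
      proof (rule ccontr)
        assume "\<not> ?thesis"
        then have lt: "1 - norm x < d" by simp
        have le: "(1 - norm x) * G x \<le> \<eta>"
          by (rule d\<^sub>0(2)[OF H f0 x(1)]) (use lt d G4 in auto)
        have "2 * C * \<epsilon>\<^sub>0 powr (- \<alpha>) * ((1 - norm x) * G x) \<le> 2 * C * \<epsilon>\<^sub>0 powr (- \<alpha>) * \<eta>"
          using le C by (intro mult_left_mono) auto
        also have "\<dots> = \<rho> / 2" using C \<epsilon>0 by (simp add: \<eta>_def)
        also have "\<dots> < \<rho>" using \<rho>(1) by simp
        finally have small: "2 * C * \<epsilon>\<^sub>0 powr (- \<alpha>) * ((1 - norm x) * G x) < \<rho>" .
        have x0: "x \<noteq> 0" using lt d by auto
        show False
          by (rule extremal_point_contradiction[OF n2 \<alpha> \<epsilon>(1) \<epsilon>0 \<rho>(2) Npos grad x(1) x0 near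
                small[unfolded C_def] theta[unfolded C_def A_def \<gamma>_def]])
      qed
      have "N \<le> 2 * W x" using x(2) by simp
      also have "W x \<le> 1 * G x"
      proof -
        have "(1 - norm x) powr (1 - \<alpha>) \<le> 1 powr (1 - \<alpha>)" using pos[OF x(1)] \<alpha> by (intro powr_mono2) auto
        then show ?thesis unfolding W_def using G_nonneg[OF x(1)] by (intro mult_right_mono) auto
      qed
      also have "G x \<le> 2 * (real CARD('n))\<^sup>2 * D / (1 - norm x)" by (rule G_bound_dist[OF D(2) x(1)])
      also have "\<dots> \<le> 2 * (real CARD('n))\<^sup>2 * D / d" using far d D by (intro divide_left_mono mult_pos_pos) auto
      finally show ?thesis by (simp add: N\<^sub>0_def)
    qed
    show "\<forall>x\<in>ball 0 1. \<forall>y\<in>ball 0 1. norm (f x - f y) \<le> C * N\<^sub>0 * norm (x - y) powr \<alpha>"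
    proof (intro ballI)
      fix x y :: "real^'n" assume xy: "x \<in> ball 0 1" "y \<in> ball 0 1"
      have "norm (f x - f y) \<le> C * N * norm (x - y) powr \<alpha>"
        unfolding C_def by (rule holder_of_gradient[OF \<alpha> N0 grad xy])
      also have "\<dots> \<le> C * N\<^sub>0 * norm (x - y) powr \<alpha>"
        using NN C by (intro mult_right_mono mult_left_mono) auto
      finally show "norm (f x - f y) \<le> C * N\<^sub>0 * norm (x - y) powr \<alpha>" .
    qed
  qed
qed

end
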